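(* Let $n\in\mathbb{N}$ (a positive integer). If $n$ is odd, then $$\sum_{r=-\infty}^{\infty}|\overline{\alpha}(n-r^2)|=-16\lambda_1(n)+16\sigma_1(n)-12\sum_{r\ \mathrm{odd}}H(4n-r^2)+\begin{cases}4,&n\text{ is a perfect square},\\0,&\text{otherwise}.\end{cases}$$ If $n$ is even, then $$\sum_{r=-\infty}^{\infty}|\overline{\alpha}(n-r^2)|=-8\lambda_1(n)-16\lambda_1(n/4)+24\sigma_1(n/2)-4\sum_{r\ \mathrm{odd}}H(4n-r^2)+\begin{cases}4,&n\text{ is a perfect square},\\0,&\text{otherwise}.\end{cases}$$ The sums over odd $r$ run over all (positive and negative) odd integers.
   Context: An overpartition of $n$ is a partition of $n$ in which the first occurrence of each distinct part may be overlined; its rank is its largest part minus its number of parts. $\overline{\alpha}(n)$ is the number of overpartitions of $n$ with even rank minus the number of overpartitions of $n$ with odd rank, with the conventions $\overline{\alpha}(0)=1$ and $\overline{\alpha}(n)=0$ for $n<0$. $H(n)$ is the Hurwitz class number, with $H(n)=0$ for $n<0$. $\sigma_1(n)=\sum_{d\mid n}d$. $\lambda_1(n)=\frac12\sum_{d\mid n}\min(d,n/d)$, and $\lambda_1(n/4)=0$ if $4\nmid n$. *)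

theory Defs
  imports "HOL-Library.Multiset" "HOL-Analysis.Infinite_Sum" "HOL-Computational_Algebra.Nth_Powers"
begin

(* An overpartition is encoded as a pair (P, U): P is the multiset of its parts and U is the set
   of those distinct parts whose first occurrence is overlined. *)
definition overpartitions :: "nat \<Rightarrow> (nat multiset \<times> nat set) set" where
  "overpartitions n = {(P, U). 0 \<notin># P \<and> sum_mset P = n \<and> U \<subseteq> set_mset P}"

(* Only meaningful for nonempty overpartitions. *)
definition op_rank :: "nat multiset \<times> nat set \<Rightarrow> int" where
  "op_rank \<pi> = int (Max (set_mset (fst \<pi>))) - int (size (fst \<pi>))"

definition alpha_bar :: "int \<Rightarrow> int" where
  "alpha_bar n =
    (if n < 0 then 0
     else if n = 0 then 1
     else int (card {\<pi> \<in> overpartitions (nat n). even (op_rank \<pi>)})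
        - int (card {\<pi> \<in> overpartitions (nat n). odd (op_rank \<pi>)}))"

(* The triple (a, b, c) stands for the form a x^2 + b x y + c y^2. *)
type_synonym bqf = "int \<times> int \<times> int"

fun bqf_eval :: "bqf \<Rightarrow> int \<Rightarrow> int \<Rightarrow> int" where
  "bqf_eval (a, b, c) x y = a * x^2 + b * x * y + c * y^2"

fun bqf_discr :: "bqf \<Rightarrow> int" where
  "bqf_discr (a, b, c) = b^2 - 4 * a * c"

definition bqf_pos_def :: "bqf \<Rightarrow> bool" where
  "bqf_pos_def f \<longleftrightarrow> (\<forall>x y. (x, y) \<noteq> (0, 0) \<longrightarrow> bqf_eval f x y > 0)"

definition pos_def_forms :: "int \<Rightarrow> bqf set" where
  "pos_def_forms D = {f. bqf_pos_def f \<and> bqf_discr f = D}"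

(* Equivalence under the action of SL(2,Z) by substitution of variables. *)
definition bqf_equiv :: "int \<Rightarrow> (bqf \<times> bqf) set" where
  "bqf_equiv D = {(f, g). f \<in> pos_def_forms D \<and> g \<in> pos_def_forms D \<and>
     (\<exists>p q r s. p * s - q * r = 1 \<and>
        (\<forall>x y. bqf_eval g x y = bqf_eval f (p * x + q * y) (r * x + s * y)))}"

(* Classes of multiples of x^2 + y^2 and of x^2 + x y + y^2 are counted with weights 1/2 and 1/3. *)
definition class_weight :: "bqf set \<Rightarrow> real" where
  "class_weight C =
    (if \<exists>m. (m, 0, m) \<in> C then 1 / 2
     else if \<exists>m. (m, m, m) \<in> C then 1 / 3
     else 1)"

(* The forms are not required to be primitive. H(0) = -1/12 is the usual convention. *)
definition hurwitz_class_number :: "int \<Rightarrow> real" where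
  "hurwitz_class_number n =
    (if n < 0 then 0
     else if n = 0 then - 1 / 12
     else \<Sum>C \<in> pos_def_forms (- n) // bqf_equiv (- n). class_weight C)"

definition sigma1 :: "nat \<Rightarrow> nat" where
  "sigma1 n = (\<Sum>d | d dvd n. d)"

definition lambda1 :: "nat \<Rightarrow> real" where
  "lambda1 n = 1 / 2 * (\<Sum>d | d dvd n. real (min d (n div d)))"

end

theory Submission
  imports Defs "HOL-Computational_Algebra.Formal_Power_Series"
begin

text \<open>
  For \<open>n > 0\<close> the number \<open>(-1)\<^sup>n\<^sup>+\<^sup>1 alpha_bar n\<close> is twice a weighted count of the triples
  \<open>p, q, r \<ge> 0\<close> with \<open>p \<equiv> q (mod 2)\<close> and \<open>pq + qr + rp = n\<close>, hence nonnegative. Convolution with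
  the theta series turns triples into integer matrices \<open>(a, b; c, d)\<close> of determinant \<open>n\<close> through
  \<open>a = p + r, d = q + r, b = s - r, c = -s - r\<close>; likewise \<open>3 H(m)\<close> counts, for odd \<open>m\<close>, the odd positive
  triples with \<open>pq + qr + rp = m\<close>, so that both sides of the claim count matrices in a cone.

  That count comes from two weights which both have total value 2 on every pair \<open>v, flip v\<close>, hence the same
  total sum: added up over the three rotations of a matrix they differ by the cone weight and by boundary terms
  with a vanishing entry, and the boundary terms give divisor sums. The convolution of \<open>alpha_bar\<close>
  with the alternating theta series is a Lambert series: iterate the functional equation of the rank generating
  function and insert a Bailey pair.
\<close>

section \<open>A signed count of integer matrices of determinant n\<close>

text \<open>Border (a, b; c, d) by a third row and a third column so that all row and column sums
  vanish. \<open>rot\<close> moves the rows and columns of this 3 x 3 matrix cyclically together,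
  \<open>row_rot\<close> moves the rows alone, and neither changes the determinant of the leading
  minor. A weight asks whether two rows agree in sign in some column. Three nonzero integers with
  sum 0 contain exactly one pair of equal sign, so if the three pairs of rows are read in one fixed
  column the answers add up to 2; only a zero entry disturbs this. \<open>sign_weight\<close>
  instead reads rows i and j in column i or j, whichever holds the larger in absolute value of the
  entries (i, j) and (j, i). If p, q, r > 0 in 2(a x^2 + (b+c) x y + d y^2) = p x^2 + q y^2 + r
  (x-y)^2, the diagonal entries are positive and each of these larger entries is negative, so all
  three answers are 0: this defect of 2 is what detects the cone. Zeros and ties produce every other
  term. Negating one row turns agreement into disagreement, which is why two weights that differ
  locally still have the same total.\<close>

type_synonym quad_weight = "int \<Rightarrow> int \<Rightarrow> int \<Rightarrow> int \<Rightarrow> int"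

definition opposite :: "int \<Rightarrow> int \<Rightarrow> bool" where
  "opposite x y \<longleftrightarrow> (x < 0 \<and> y > 0) \<or> (x > 0 \<and> y < 0)"

definition same_sign :: "int \<Rightarrow> int \<Rightarrow> bool" where
  "same_sign x y \<longleftrightarrow> (x < 0 \<and> y < 0) \<or> (x > 0 \<and> y > 0)"

text \<open>This is |b| < |c|, that is (c - b)(c + b) > 0, written as sign conditions on linear
  forms.\<close>

definition lt_abs :: "int \<Rightarrow> int \<Rightarrow> bool" where
  "lt_abs b c \<longleftrightarrow> (b < c \<and> b + c > 0) \<or> (c < b \<and> b + c < 0)"

text \<open>Rows 1 and 2 of the bordered matrix have opposite signs in some column. The third column
  is -(a+b), -(c+d); negating both entries does not affect the test.\<close>

definition has_neg :: "int \<Rightarrow> int \<Rightarrow> int \<Rightarrow> int \<Rightarrow> bool" where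
  "has_neg a b c d \<longleftrightarrow> opposite a c \<or> opposite b d \<or> opposite (a+b) (c+d)"

definition has_pos :: "int \<Rightarrow> int \<Rightarrow> int \<Rightarrow> int \<Rightarrow> bool" where
  "has_pos a b c d \<longleftrightarrow> same_sign a c \<or> same_sign b d \<or> same_sign (a+b) (c+d)"

text \<open>A zero in the first column is resolved by the second column. The value 2 leaves room for
  averaging two columns as 1 + 1.\<close>

definition lex_sign :: quad_weight where
  "lex_sign x y z w = (if same_sign x y then 2 else if opposite x y then 0 else if same_sign z w then 2 else 0)"

text \<open>The columns are 1, 2 here and 3, 1 and 2, 3 in the two variants below, because
  \<open>rot\<close> also moves the columns: evaluated at v, \<open>rot v\<close> and
  \<open>rot (rot v)\<close>, all three weights read column 1 of v and break ties by column
  2.\<close>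

definition lex_weight0 :: quad_weight where
  "lex_weight0 a b c d = (if has_neg a b c d \<and> has_pos a b c d then lex_sign a c b d else 0)"

definition lex_weight1 :: quad_weight where
  "lex_weight1 a b c d = (if has_neg a b c d \<and> has_pos a b c d then lex_sign (a+b) (c+d) a c else 0)"

definition lex_weight2 :: quad_weight where
  "lex_weight2 a b c d = (if has_neg a b c d \<and> has_pos a b c d then lex_sign b d (a+b) (c+d) else 0)"

text \<open>For (0, b; c, d), the values of d at which all three lexicographic answers are 0: d runs
  from 0 to -b, and the sign of c decides which endpoint belongs to the range.\<close>

definition cusp_range :: "int \<Rightarrow> int \<Rightarrow> int \<Rightarrow> bool" where
  "cusp_range x y z \<longleftrightarrow> (x > 0 \<and> y > 0 \<and> -x \<le> z \<and> z < 0) \<or> (x > 0 \<and> y \<le> 0 \<and> -x < z \<and> z \<le> 0) \<or>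
     (x < 0 \<and> y < 0 \<and> 0 < z \<and> z \<le> -x) \<or> (x < 0 \<and> y \<ge> 0 \<and> 0 \<le> z \<and> z < -x)"

text \<open>Any two of the three rows of the bordered matrix have opposite signs in some
  column.\<close>

definition gate :: "int \<Rightarrow> int \<Rightarrow> int \<Rightarrow> int \<Rightarrow> bool" where
  "gate a b c d \<longleftrightarrow> has_neg a b c d \<and> has_neg d (-(c+d)) (-(b+d)) (a+b+c+d) \<and> has_neg (a+b+c+d) (-(a+c)) (-(a+b)) a"

text \<open>Rows 1 and 2 are read in the column that holds the larger of |b| and |c|, the cyclically
  next column breaking ties. For |b| = |c| columns 1 and 2 count half each, unless a = 0 or d = 0
  leaves one of them undecided.\<close>

definition sign_weight :: quad_weight where
  "sign_weight a b c d = (if has_neg a b c d \<and> has_pos a b c d then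
     (if lt_abs b c then lex_sign a c b d else if lt_abs c b then lex_sign b d (a+b) (c+d)
      else if a = 0 then lex_sign b d (a+b) (c+d) else if d = 0 then lex_sign (a+b) (c+d) a c
      else (if same_sign a c then 1 else 0) + (if same_sign b d then 1 else 0)) else 0)"

definition diagonal_indicator :: "int \<Rightarrow> int \<Rightarrow> int" where
  "diagonal_indicator b c = (if b = 0 \<and> c = 0 then 1 else 0)"

definition fan_weight :: quad_weight where
  "fan_weight a b c d = (if a = 0 \<and> \<not> lt_abs c b \<and> cusp_range b c d then 2 else 0)"

text \<open>Walls carry half the weight of the interior, as in a fundamental domain whose walls are
  shared by two neighbours.\<close>

definition cone_weight :: "int \<Rightarrow> int \<Rightarrow> int \<Rightarrow> int" where
  "cone_weight p q r = (if p > 0 \<and> q > 0 \<and> r > 0 then 2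
     else if p \<ge> 0 \<and> q \<ge> 0 \<and> r \<ge> 0 \<and> p + q > 0 \<and> q + r > 0 \<and> r + p > 0 then 1 else 0)"

text \<open>The arguments p = 2a+b+c, q = 2d+b+c, r = -b-c are the Selling parameters of the
  symmetric part: minus the off-diagonal entries of M + M^T for the bordered matrix M. The other
  terms record ties |b| = |c| and zero diagonal entries.\<close>

definition sign_weight_value :: quad_weight where
  "sign_weight_value a b c d = cone_weight (a+a+b+c) (d+d+b+c) (-b-c) + cone_weight (-a-a-b-c) (-d-d-b-c) (b+c)
    - (if b = c \<and> (a = 0 \<or> d = 0 \<or> a+b+c+d = 0) then 1 else 0) - (if a = 0 \<and> d = 0 \<and> b = -c then 4 else 0)
    + fan_weight a b c d + fan_weight d (-(c+d)) (-(b+d)) (a+b+c+d) + fan_weight (a+b+c+d) (-(a+c)) (-(a+b)) a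
    + diagonal_indicator b c + diagonal_indicator (c+d) (b+d) + diagonal_indicator (a+c) (a+b)"

definition sign_weight_sum :: quad_weight where
  "sign_weight_sum a b c d = sign_weight a b c d + sign_weight d (-(c+d)) (-(b+d)) (a+b+c+d) + sign_weight (a+b+c+d) (-(a+c)) (-(a+b)) a"

text \<open>Only the column (a, c, -(a+c)) is read. Without a zero in it exactly one pair of rows
  agrees there, and \<open>gate\<close> makes sure that this pair is counted; each correction
  belongs to one possible position of a zero.\<close>

lemma lex_weight_local:
  assumes "gate a b c d"
  shows "2 - lex_weight0 a b c d - lex_weight1 d (-(c+d)) (-(b+d)) (a+b+c+d) - lex_weight2 (a+b+c+d) (-(a+c)) (-(a+b)) a
   = (if a = 0 \<and> cusp_range b c d then 2 else 0) + (if c = 0 \<and> cusp_range d (-(a+c)) (-(b+d)) then 2 else 0)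
     + (if a + c = 0 \<and> cusp_range (-(b+d)) a b then 2 else 0)"
  using assms unfolding gate_def lex_weight0_def lex_weight1_def lex_weight2_def lex_sign_def cusp_range_def has_neg_def has_pos_def opposite_def same_sign_def
  by (smt (verit))

lemma sign_uminus:
  "opposite (-x) (-y) = opposite x y" "same_sign (-x) (-y) = same_sign x y" "lt_abs (-x) (-y) = lt_abs x y"
  by (auto simp: opposite_def same_sign_def lt_abs_def)

lemma has_neg_uminus: "has_neg (-a) (-b) (-c) (-d) = has_neg a b c d"
  using sign_uminus(1)[of "a+b" "c+d"] by (simp add: has_neg_def sign_uminus)

lemma has_pos_uminus: "has_pos (-a) (-b) (-c) (-d) = has_pos a b c d"
  using sign_uminus(2)[of "a+b" "c+d"] by (simp add: has_pos_def sign_uminus)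

lemma lex_sign_uminus: "lex_sign (-x) (-y) (-z) (-w) = lex_sign x y z w"
  by (simp add: lex_sign_def sign_uminus)

lemma sign_weight_uminus: "sign_weight (-a) (-b) (-c) (-d) = sign_weight a b c d"
proof -
  have add: "- x + - y = - (x + y)" for x y :: int by simp
  show ?thesis unfolding sign_weight_def
    by (simp only: add has_neg_uminus has_pos_uminus lex_sign_uminus sign_uminus neg_equal_0_iff_equal)
qed

lemma cusp_range_uminus: "cusp_range (-x) (-y) (-z) = cusp_range x y z" if "y \<noteq> 0"
  using that by (auto simp: cusp_range_def)

lemma gate_uminus: "gate (-a) (-b) (-c) (-d) = gate a b c d"
  using has_neg_uminus[of d "-(c+d)" "-(b+d)" "a+b+c+d"] has_neg_uminus[of "a+b+c+d" "-(a+c)" "-(a+b)" a]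
  by (simp add: gate_def has_neg_uminus algebra_simps)

lemma fan_weight_uminus: "fan_weight (-a) (-b) (-c) (-d) = fan_weight a b c d"
proof (cases "c = 0")
  case True
  then show ?thesis by (auto simp: fan_weight_def lt_abs_def cusp_range_def)
next
  case False
  then show ?thesis by (simp add: fan_weight_def sign_uminus cusp_range_uminus)
qed

lemma diagonal_indicator_uminus: "diagonal_indicator (-b) (-c) = diagonal_indicator b c"
  by (simp add: diagonal_indicator_def)

lemma sign_weight_sum_uminus: "sign_weight_sum (-a) (-b) (-c) (-d) = sign_weight_sum a b c d"
  using sign_weight_uminus[of a b c d] sign_weight_uminus[of d "-(c+d)" "-(b+d)" "a+b+c+d"] sign_weight_uminus[of "a+b+c+d" "-(a+c)" "-(a+b)" a]
  by (simp add: sign_weight_sum_def algebra_simps)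

lemma sign_weight_value_uminus: "sign_weight_value (-a) (-b) (-c) (-d) = sign_weight_value a b c d"
proof -
  have "(if - b = - c \<and> (- a = 0 \<or> - d = 0 \<or> -a + -b + -c + -d = 0) then 1 else 0) =
      (if b = c \<and> (a = 0 \<or> d = 0 \<or> a+b+c+d = 0) then 1 else (0::int))"
    by (intro if_cong) auto
  moreover have "(if - a = 0 \<and> - d = 0 \<and> - b = - (- c) then 4 else 0) =
      (if a = 0 \<and> d = 0 \<and> b = -c then 4 else (0::int))"
    by (intro if_cong) auto
  moreover have "cone_weight (-a + -a + -b + -c) (-d + -d + -b + -c) (- (-b) - (-c)) = cone_weight (-a-a-b-c) (-d-d-b-c) (b+c)"
    "cone_weight (- (-a) - (-a) - (-b) - (-c)) (- (-d) - (-d) - (-b) - (-c)) (-b + -c) = cone_weight (a+a+b+c) (d+d+b+c) (-b-c)"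
    by (simp_all only: minus_minus diff_minus_eq_add add_uminus_conv_diff)
  moreover have "fan_weight (-d) (-(-c + -d)) (-(-b + -d)) (-a + -b + -c + -d) = fan_weight d (-(c+d)) (-(b+d)) (a+b+c+d)"
    "fan_weight (-a + -b + -c + -d) (-(-a + -c)) (-(-a + -b)) (-a) = fan_weight (a+b+c+d) (-(a+c)) (-(a+b)) a"
    "diagonal_indicator (-c + -d) (-b + -d) = diagonal_indicator (c+d) (b+d)" "diagonal_indicator (-a + -c) (-a + -b) = diagonal_indicator (a+c) (a+b)"
    using fan_weight_uminus[of d "-(c+d)" "-(b+d)" "a+b+c+d"] fan_weight_uminus[of "a+b+c+d" "-(a+c)" "-(a+b)" a]
      diagonal_indicator_uminus[of "c+d" "b+d"] diagonal_indicator_uminus[of "a+c" "a+b"]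
    by (simp_all only: minus_add_distrib minus_minus)
  ultimately show ?thesis
    unfolding sign_weight_value_def by (simp only: fan_weight_uminus diagonal_indicator_uminus)
qed

lemmas weight_defs = sign_weight_sum_def sign_weight_value_def gate_def lt_abs_def sign_weight_def lex_sign_def cusp_range_def has_neg_def has_pos_def opposite_def same_sign_def diagonal_indicator_def fan_weight_def cone_weight_def

text \<open>After v is replaced by -v this settles the case a > 0 > d of the next lemma.\<close>

lemma sign_weight_local_greater:
  assumes "gate a b c d" "b < c" "b + c > 0" "a < 0" "d > 0"
  shows "2 - sign_weight_sum a b c d = sign_weight_value a b c d"
  using assms unfolding weight_defs by (smt (verit))

lemma sign_weight_local_less:
  assumes "gate a b c d" "c < b"
  shows "2 - sign_weight_sum a b c d = sign_weight_value a b c d"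
proof -
  consider "b + c < 0" | "b + c = 0" | "b + c > 0" by linarith
  then show ?thesis
  proof cases
    case neg: 1
    consider "a < 0" | "a = 0" | "a > 0" "d = 0" | "a > 0" "d > 0" | "a > 0" "d < 0" by linarith
    then show ?thesis
    proof cases
      case 1
      show ?thesis using assms neg 1 unfolding weight_defs by (smt (verit))
    next
      case 2
      show ?thesis using assms neg 2 unfolding weight_defs by (smt (verit))
    next
      case 3
      show ?thesis using assms neg 3 unfolding weight_defs by (smt (verit))
    next
      case 4
      show ?thesis using assms neg 4 unfolding weight_defs by (smt (verit))
    next
      case 5
      have "gate (-a) (-b) (-c) (-d)" "-b < -c" "-b + -c > 0" "-a < 0" "-d > 0"
        using assms neg 5 by (simp_all add: gate_uminus)
      from sign_weight_local_greater[OF this] show ?thesis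
        using sign_weight_sum_uminus[of a b c d] sign_weight_value_uminus[of a b c d] by linarith
    qed
  next
    case zero: 2
    consider "a < 0" | "a = 0" | "a > 0" by linarith
    then show ?thesis
    proof cases
      case 1
      show ?thesis using assms zero 1 unfolding weight_defs by (smt (verit))
    next
      case 2
      show ?thesis using assms zero 2 unfolding weight_defs by (smt (verit))
    next
      case 3
      show ?thesis using assms zero 3 unfolding weight_defs by (smt (verit))
    qed
  next
    case pos: 3
    consider "d < 0" | "d = 0" | "d > 0" by linarith
    then show ?thesis
    proof cases
      case 1
      show ?thesis using assms pos 1 unfolding weight_defs by (smt (verit))
    next
      case 2
      show ?thesis using assms pos 2 unfolding weight_defs by (smt (verit))
    next
      case 3
      show ?thesis using assms pos 3 unfolding weight_defs by (smt (verit))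
    qed
  qed
qed

lemma sign_weight_local_sym_pos:
  assumes "gate a b b d" "b > 0"
  shows "2 - sign_weight_sum a b b d = sign_weight_value a b b d"
proof -
  consider "a+b+b+d < 0" | "a+b+b+d = 0" | "a+b+b+d > 0" by linarith
  then show ?thesis
  proof cases
    case 1
    show ?thesis using assms 1 unfolding weight_defs by (smt (verit))
  next
    case 2
    show ?thesis using assms 2 unfolding weight_defs by (smt (verit))
  next
    case 3
    show ?thesis using assms 3 unfolding weight_defs by (smt (verit))
  qed
qed

lemma sign_weight_local_sym_zero:
  assumes "gate a b b d" "b = 0"
  shows "2 - sign_weight_sum a b b d = sign_weight_value a b b d"
proof -
  consider "a < 0" | "a = 0" | "a > 0" by linarith
  then show ?thesis
  proof cases
    case 1
    show ?thesis using assms 1 unfolding weight_defs by (smt (verit))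
  next
    case 2
    show ?thesis using assms 2 unfolding weight_defs by (smt (verit))
  next
    case 3
    show ?thesis using assms 3 unfolding weight_defs by (smt (verit))
  qed
qed

text \<open>Both sides depend only on signs of linear forms in a, b, c, d and are unchanged under v
  \<mapsto> -v, so c < b and b = c \<ge> 0 suffice.\<close>

lemma sign_weight_local:
  assumes "gate a b c d"
  shows "2 - sign_weight_sum a b c d = sign_weight_value a b c d"
proof -
  have neg: "gate (-a) (-b) (-c) (-d)" using assms by (simp add: gate_uminus)
  consider "c < b" | "b < c" | "b = c" "b > 0" | "b = c" "b = 0" | "b = c" "b < 0" by linarith
  then show ?thesis
  proof cases
    case 1 then show ?thesis using sign_weight_local_less assms by simp
  next
    case 2 then show ?thesis using sign_weight_local_less[OF neg] by (simp add: sign_weight_sum_uminus sign_weight_value_uminus)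
  next
    case 3 then show ?thesis using sign_weight_local_sym_pos assms by simp
  next
    case 4 then show ?thesis using sign_weight_local_sym_zero[of a b d] assms by simp
  next
    case 5
    then have "gate (-a) (-b) (-b) (-d)" "-b > 0" using neg by simp_all
    from sign_weight_local_sym_pos[OF this] show ?thesis
      using 5 sign_weight_sum_uminus[of a b b d] sign_weight_value_uminus[of a b b d] by simp
  qed
qed

section \<open>Symmetries of the bordered matrix and finiteness of the index sets\<close>

type_synonym quad = "int \<times> int \<times> int \<times> int"

fun qdet :: "quad \<Rightarrow> int" where "qdet (a, b, c, d) = a * d - b * c"

text \<open>The minor of the bordered matrix in rows 2, 3 and columns 2, 3.\<close>

fun rot :: "quad \<Rightarrow> quad" where "rot (a, b, c, d) = (d, -(c+d), -(b+d), a+b+c+d)"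

text \<open>Only the first row changes sign: |b| and |c| stay, the determinant is negated, and
  agreement of rows 1 and 2 in a column becomes disagreement.\<close>

fun flip :: "quad \<Rightarrow> quad" where "flip (a, b, c, d) = (-a, -b, c, d)"

definition on_quad :: "(int \<Rightarrow> int \<Rightarrow> int \<Rightarrow> int \<Rightarrow> 'b) \<Rightarrow> quad \<Rightarrow> 'b" where
  "on_quad f v = (case v of (a, b, c, d) \<Rightarrow> f a b c d)"

lemma on_quad_simp [simp]: "on_quad f (a, b, c, d) = f a b c d"
  by (simp add: on_quad_def)

definition crossing :: "quad \<Rightarrow> bool" where
  "crossing v \<longleftrightarrow> on_quad has_neg v \<and> on_quad has_pos v"

text \<open>Conditions modulo 2 survive every change of signs, so the count may be restricted to a
  residue class without spoiling \<open>flip\<close> or v \<mapsto> -v.\<close>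

definition mod2_inv :: "(quad \<Rightarrow> bool) \<Rightarrow> bool" where
  "mod2_inv P \<longleftrightarrow> (\<forall>a b c d a' b' c' d'. even (a - a') \<longrightarrow> even (b - b') \<longrightarrow> even (c - c') \<longrightarrow> even (d - d') \<longrightarrow>
     P (a, b, c, d) = P (a', b', c', d'))"

lemma rot_rot [simp]: "rot (rot (rot v)) = v"
  by (cases v) simp

lemma qdet_rot [simp]: "qdet (rot v) = qdet v"
  by (cases v) (simp add: algebra_simps)

lemma flip_flip [simp]: "flip (flip v) = v"
  by (cases v) simp

lemma qdet_flip [simp]: "qdet (flip v) = - qdet v"
  by (cases v) simp

lemma gate_iff: "on_quad gate v \<longleftrightarrow> on_quad has_neg v \<and> on_quad has_neg (rot v) \<and> on_quad has_neg (rot (rot v))"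
  by (cases v) (simp add: gate_def)

lemma gate_rot [simp]: "on_quad gate (rot v) = on_quad gate v"
  by (auto simp: gate_iff)

text \<open>In a column where rows 1 and 2 agree, row 3 has the opposite sign to both; this serves
  the two other pairs of rows.\<close>

lemma gate_if_signs: "has_neg a b c d \<Longrightarrow> has_pos a b c d \<Longrightarrow> gate a b c d"
  unfolding gate_def has_neg_def has_pos_def opposite_def same_sign_def by (smt (verit))

lemma crossing_gate: "crossing v \<Longrightarrow> on_quad gate v"
  by (cases v) (simp add: crossing_def gate_if_signs)

lemma flip_signs: "has_neg (-a) (-b) c d = has_pos a b c d" "has_pos (-a) (-b) c d = has_neg a b c d"
  unfolding has_neg_def has_pos_def opposite_def same_sign_def by (smt (verit))+

lemma crossing_flip [simp]: "crossing (flip v) = crossing v"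
  by (cases v) (auto simp: crossing_def flip_signs)

lemma mod2_inv_flip: "mod2_inv P \<Longrightarrow> P (flip v) = P v"
  by (cases v) (simp, erule mod2_inv_def[THEN iffD1, rule_format]; simp)

lemma mod2_inv_rot: "mod2_inv P \<Longrightarrow> mod2_inv (\<lambda>v. P (rot v))"
proof -
  assume P: "mod2_inv P"
  show ?thesis
    unfolding mod2_inv_def rot.simps
    by (intro allI impI, rule P[unfolded mod2_inv_def, rule_format]) (assumption | presburger)+
qed

text \<open>Only the absolute value of the determinant is fixed, because \<open>flip\<close> negates
  it.\<close>

definition Vset :: "nat \<Rightarrow> (quad \<Rightarrow> bool) \<Rightarrow> quad set" where
  "Vset n P = {v. on_quad gate v \<and> \<bar>qdet v\<bar> = int n \<and> P v}"

definition Eset :: "nat \<Rightarrow> (quad \<Rightarrow> bool) \<Rightarrow> quad set" where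
  "Eset n P = {v. crossing v \<and> \<bar>qdet v\<bar> = int n \<and> P v}"

text \<open>Disagreement in one column and agreement in another rule out cancellation: |det| = |x w|
  + |y z| with all four entries nonzero.\<close>

lemma opp_same_bound:
  fixes x y z w :: int
  assumes "opposite x y" "same_sign z w" "\<bar>x * w - y * z\<bar> = int n"
  shows "\<bar>x\<bar> \<le> n" "\<bar>y\<bar> \<le> n" "\<bar>z\<bar> \<le> n" "\<bar>w\<bar> \<le> n"
proof -
  have nz: "\<bar>x\<bar> \<ge> 1" "\<bar>y\<bar> \<ge> 1" "\<bar>z\<bar> \<ge> 1" "\<bar>w\<bar> \<ge> 1"
    using assms by (auto simp: opposite_def same_sign_def)
  have s: "\<bar>x * w - y * z\<bar> = \<bar>x\<bar> * \<bar>w\<bar> + \<bar>y\<bar> * \<bar>z\<bar>"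
  proof -
    have "x * w \<le> 0 \<and> y * z \<ge> 0 \<or> x * w \<ge> 0 \<and> y * z \<le> 0"
      using assms(1,2) unfolding opposite_def same_sign_def by (auto simp: mult_le_0_iff zero_le_mult_iff)
    then show ?thesis unfolding abs_mult[symmetric] by linarith
  qed
  have "1 * \<bar>w\<bar> \<le> \<bar>x\<bar> * \<bar>w\<bar>" "\<bar>x\<bar> * 1 \<le> \<bar>x\<bar> * \<bar>w\<bar>" "1 * \<bar>z\<bar> \<le> \<bar>y\<bar> * \<bar>z\<bar>" "\<bar>y\<bar> * 1 \<le> \<bar>y\<bar> * \<bar>z\<bar>"
    using nz by (intro mult_right_mono mult_left_mono; simp)+
  moreover have "\<bar>x\<bar> * \<bar>w\<bar> \<ge> 0" "\<bar>y\<bar> * \<bar>z\<bar> \<ge> 0" by simp_all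
  ultimately show "\<bar>x\<bar> \<le> n" "\<bar>y\<bar> \<le> n" "\<bar>z\<bar> \<le> n" "\<bar>w\<bar> \<le> n"
    using s assms(3) by linarith+
qed

definition quad_box :: "nat \<Rightarrow> quad set" where
  "quad_box n = {- 2 * int n..2 * int n} \<times> {- 2 * int n..2 * int n} \<times> {- 2 * int n..2 * int n} \<times> {- 2 * int n..2 * int n}"

lemma finite_quad_box: "finite (quad_box n)"
  by (simp add: quad_box_def)

lemma crossing_quad_box:
  assumes "crossing v" "\<bar>qdet v\<bar> = int n"
  shows "v \<in> quad_box n"
proof -
  obtain a b c d where v: "v = (a, b, c, d)" by (cases v)
  have n: "opposite a c \<or> opposite b d \<or> opposite (a+b) (c+d)" "same_sign a c \<or> same_sign b d \<or> same_sign (a+b) (c+d)"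
    using assms(1) by (auto simp: v crossing_def has_neg_def has_pos_def)
  have excl: "\<not> (opposite x y \<and> same_sign x y)" for x y by (auto simp: opposite_def same_sign_def)
  have det: "\<bar>a * d - c * b\<bar> = int n" "\<bar>b * c - d * a\<bar> = int n" "\<bar>a * (c+d) - c * (a+b)\<bar> = int n"
      "\<bar>(a+b) * c - (c+d) * a\<bar> = int n" "\<bar>b * (c+d) - d * (a+b)\<bar> = int n" "\<bar>(a+b) * d - (c+d) * b\<bar> = int n"
    using assms(2) by (simp_all add: v algebra_simps abs_minus_commute)
  consider "opposite a c" "same_sign b d" | "opposite a c" "same_sign (a+b) (c+d)" | "opposite b d" "same_sign a c" | "opposite b d" "same_sign (a+b) (c+d)"
    | "opposite (a+b) (c+d)" "same_sign a c" | "opposite (a+b) (c+d)" "same_sign b d"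
    using n excl by blast
  \<comment> \<open>If one of the two bounded columns is the sum column, the remaining column is a
    difference of bounded ones; hence the factor 2.\<close>
  then have "\<bar>a\<bar> \<le> 2 * int n \<and> \<bar>b\<bar> \<le> 2 * int n \<and> \<bar>c\<bar> \<le> 2 * int n \<and> \<bar>d\<bar> \<le> 2 * int n"
  proof cases
    case 1 from opp_same_bound[OF this det(1)] show ?thesis by linarith
  next
    case 2 from opp_same_bound[OF this det(3)] show ?thesis by linarith
  next
    case 3 from opp_same_bound[OF this det(2)] show ?thesis by linarith
  next
    case 4 from opp_same_bound[OF this det(5)] show ?thesis by linarith
  next
    case 5 from opp_same_bound[OF this det(4)] show ?thesis by linarith
  next
    case 6 from opp_same_bound[OF this det(6)] show ?thesis by linarith
  qed
  then show ?thesis by (auto simp: quad_box_def v)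
qed

lemma finite_Eset: "finite (Eset n P)"
  by (rule finite_subset[OF _ finite_quad_box[of n]]) (auto simp: Eset_def intro: crossing_quad_box)

lemma sum_involution:
  fixes f :: "'a \<Rightarrow> int"
  assumes "finite S" "\<And>v. v \<in> S \<Longrightarrow> \<sigma> v \<in> S" "\<And>v. \<sigma> (\<sigma> v) = v" "\<And>v. v \<in> S \<Longrightarrow> f v + f (\<sigma> v) = 2"
  shows "sum f S = card S"
proof -
  have "sum f S = (\<Sum>v\<in>S. f (\<sigma> v))"
    by (rule sum.reindex_bij_witness[of _ \<sigma> \<sigma>]) (use assms in auto)
  then have "2 * sum f S = (\<Sum>v\<in>S. f v + f (\<sigma> v))" by (simp add: sum.distrib)
  also have "\<dots> = 2 * int (card S)" using assms(4) by simp
  finally show ?thesis by simp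
qed

definition orientation :: "(quad \<Rightarrow> int) \<Rightarrow> bool" where
  "orientation f \<longleftrightarrow> (\<forall>v. \<not> crossing v \<longrightarrow> f v = 0) \<and> (\<forall>v. crossing v \<and> qdet v \<noteq> 0 \<longrightarrow> f v + f (flip v) = 2)"

text \<open>The right-hand side does not involve f, which is what allows two different weights to be
  compared.\<close>

lemma orientation_sum:
  assumes f: "orientation f" and P: "mod2_inv P" and n: "n > 0" and fin: "finite (Vset n P)"
  shows "sum f (Vset n P) = card (Eset n P)"
proof -
  have "sum f (Vset n P) = sum f (Eset n P)"
    by (rule sum.mono_neutral_right[OF fin])
      (use f crossing_gate in \<open>unfold Vset_def Eset_def orientation_def, blast+\<close>)
  also have "\<dots> = card (Eset n P)"
  proof (rule sum_involution[of _ flip])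
    fix v assume "v \<in> Eset n P"
    then show "flip v \<in> Eset n P" using mod2_inv_flip[OF P] by (simp add: Eset_def)
    have "crossing v" "qdet v \<noteq> 0" using \<open>v \<in> Eset n P\<close> n by (auto simp: Eset_def)
    then show "f v + f (flip v) = 2" using f unfolding orientation_def by blast
  qed (simp_all add: finite_Eset)
  finally show ?thesis .
qed

lemma lex_sign_flip: "same_sign x y \<or> opposite x y \<or> same_sign z w \<or> opposite z w \<Longrightarrow> lex_sign x y z w + lex_sign (-x) y (-z) w = 2"
  unfolding lex_sign_def opposite_def same_sign_def by (smt (verit))

text \<open>Which columns are consulted depends only on |b|, |c| and on the vanishing of a or d, so
  \<open>flip\<close> keeps them and reverses the comparison made there. It remains to see that one
  of the consulted columns is decisive.\<close>

lemma R_flip: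
  assumes "has_neg a b c d" "has_pos a b c d"
  shows "sign_weight a b c d + sign_weight (-a) (-b) c d = 2"
proof -
  have uminus: "lt_abs (-b) c = lt_abs b c" "lt_abs c (-b) = lt_abs c b" by (auto simp: lt_abs_def)
  have "- a + - b = - (a + b)" by simp
  note sign_weight = sign_weight_def[of "-a" "-b" c d, unfolded this flip_signs uminus neg_equal_0_iff_equal] sign_weight_def[of a b c d]
  consider "lt_abs b c" | "\<not> lt_abs b c" "lt_abs c b" | "\<not> lt_abs b c" "\<not> lt_abs c b" "a = 0"
    | "\<not> lt_abs b c" "\<not> lt_abs c b" "a \<noteq> 0" "d = 0" | "\<not> lt_abs b c" "\<not> lt_abs c b" "a \<noteq> 0" "d \<noteq> 0" by blast
  then show ?thesis
  proof cases
    case 1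
    have "same_sign a c \<or> opposite a c \<or> same_sign b d \<or> opposite b d"
      using assms 1 unfolding has_neg_def has_pos_def opposite_def same_sign_def lt_abs_def by (smt (verit))
    with 1 show ?thesis using assms unfolding sign_weight by (simp add: lex_sign_flip)
  next
    case 2
    have "same_sign b d \<or> opposite b d \<or> same_sign (a+b) (c+d) \<or> opposite (a+b) (c+d)"
      using assms 2 unfolding has_neg_def has_pos_def opposite_def same_sign_def lt_abs_def by (smt (verit))
    from lex_sign_flip[OF this] 2 show ?thesis using assms unfolding sign_weight by simp
  next
    case 3
    have "same_sign b d \<or> opposite b d \<or> same_sign (a+b) (c+d) \<or> opposite (a+b) (c+d)"
      using assms 3 unfolding has_neg_def has_pos_def opposite_def same_sign_def lt_abs_def by (smt (verit))
    from lex_sign_flip[OF this] 3 show ?thesis using assms unfolding sign_weight by simp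
  next
    case 4
    have "same_sign (a+b) (c+d) \<or> opposite (a+b) (c+d) \<or> same_sign a c \<or> opposite a c"
      using assms 4 unfolding has_neg_def has_pos_def opposite_def same_sign_def lt_abs_def by (smt (verit))
    from lex_sign_flip[OF this] 4 show ?thesis using assms unfolding sign_weight by simp
  next
    case 5
    have "b \<noteq> 0" "c = b \<or> c = - b"
      using assms 5 unfolding has_neg_def has_pos_def opposite_def same_sign_def lt_abs_def by (smt (verit))+
    then have "same_sign (-a) c = (\<not> same_sign a c)" "same_sign (-b) d = (\<not> same_sign b d)"
      using 5 by (auto simp: same_sign_def)
    then show ?thesis using 5 assms unfolding sign_weight by simp
  qed
qed

lemma W_flip:
  assumes "has_neg a b c d" "has_pos a b c d"
  shows "lex_weight0 a b c d + lex_weight0 (-a) (-b) c d = 2" "lex_weight1 a b c d + lex_weight1 (-a) (-b) c d = 2" "lex_weight2 a b c d + lex_weight2 (-a) (-b) c d = 2"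
proof -
  have add: "- a + - b = - (a + b)" by simp
  have s: "same_sign a c \<or> opposite a c \<or> same_sign b d \<or> opposite b d" "same_sign (a+b) (c+d) \<or> opposite (a+b) (c+d) \<or> same_sign a c \<or> opposite a c"
    "same_sign b d \<or> opposite b d \<or> same_sign (a+b) (c+d) \<or> opposite (a+b) (c+d)"
    using assms unfolding has_neg_def has_pos_def opposite_def same_sign_def by (smt (verit))+
  show "lex_weight0 a b c d + lex_weight0 (-a) (-b) c d = 2" "lex_weight1 a b c d + lex_weight1 (-a) (-b) c d = 2" "lex_weight2 a b c d + lex_weight2 (-a) (-b) c d = 2"
    using s[THEN lex_sign_flip] by (simp_all only: lex_weight0_def lex_weight1_def lex_weight2_def flip_signs add) (simp_all add: assms)
qed

lemma orientationI:
  assumes "\<And>a b c d. has_neg a b c d \<Longrightarrow> has_pos a b c d \<Longrightarrow> f a b c d + f (-a) (-b) c d = 2"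
    "\<And>a b c d. \<not> (has_neg a b c d \<and> has_pos a b c d) \<Longrightarrow> f a b c d = 0"
  shows "orientation (on_quad f)"
  using assms by (auto simp: orientation_def crossing_def)

lemma orientation_R: "orientation (on_quad sign_weight)"
  by (rule orientationI) (rule R_flip, assumption+, auto simp: sign_weight_def)

lemma orientation_W: "orientation (on_quad lex_weight0)" "orientation (on_quad lex_weight1)" "orientation (on_quad lex_weight2)"
proof -
  show "orientation (on_quad lex_weight0)" by (rule orientationI) (rule W_flip, assumption+, auto simp: lex_weight0_def)
  show "orientation (on_quad lex_weight1)" by (rule orientationI) (rule W_flip, assumption+, auto simp: lex_weight1_def)
  show "orientation (on_quad lex_weight2)" by (rule orientationI) (rule W_flip, assumption+, auto simp: lex_weight2_def)
qed

lemma abs_factor_le: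
  fixes b c :: int
  assumes "\<bar>b * c\<bar> = int n" "n > 0"
  shows "\<bar>b\<bar> \<le> n" "\<bar>c\<bar> \<le> n" "b \<noteq> 0" "c \<noteq> 0"
proof -
  show nz: "b \<noteq> 0" "c \<noteq> 0" using assms by auto
  then have "1 * \<bar>c\<bar> \<le> \<bar>b\<bar> * \<bar>c\<bar>" "\<bar>b\<bar> * 1 \<le> \<bar>b\<bar> * \<bar>c\<bar>" by (intro mult_right_mono mult_left_mono; simp)+
  then show "\<bar>b\<bar> \<le> n" "\<bar>c\<bar> \<le> n" using assms by (simp_all add: abs_mult)
qed

lemma cusp_range_abs: "cusp_range x y z \<Longrightarrow> \<bar>z\<bar> \<le> \<bar>x\<bar>"
  by (auto simp: cusp_range_def)

text \<open>If no rotation of v is crossing, all lexicographic weights vanish and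
  \<open>lex_weight_local\<close> forces a zero in the first column. The determinant is then a
  single product, which bounds the entries.\<close>

lemma gate_quad_box:
  assumes v: "on_quad gate v" "\<bar>qdet v\<bar> = int n" and n: "n > 0"
  shows "v \<in> quad_box n \<union> rot ` quad_box n \<union> (rot \<circ> rot) ` quad_box n"
proof (cases "crossing v \<or> crossing (rot v) \<or> crossing (rot (rot v))")
  case True
  then have "v \<in> quad_box n \<or> rot v \<in> quad_box n \<or> rot (rot v) \<in> quad_box n"
    using crossing_quad_box v(2) qdet_rot by metis
  then show ?thesis using rot_rot[of v] by (metis UnCI comp_apply image_eqI)
next
  case False
  obtain a b c d where [simp]: "v = (a, b, c, d)" by (cases v)
  have "lex_weight0 a b c d = 0" "lex_weight1 d (-(c+d)) (-(b+d)) (a+b+c+d) = 0" "lex_weight2 (a+b+c+d) (-(a+c)) (-(a+b)) a = 0"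
    using False by (auto simp: crossing_def lex_weight0_def lex_weight1_def lex_weight2_def)
  moreover have "gate a b c d" using v(1) by simp
  ultimately consider "a = 0" "cusp_range b c d" | "c = 0" "cusp_range d (-(a+c)) (-(b+d))" | "a + c = 0" "cusp_range (-(b+d)) a b"
    using lex_weight_local[of a b c d] by (auto split: if_splits)
  then have "\<bar>a\<bar> \<le> 2 * int n \<and> \<bar>b\<bar> \<le> 2 * int n \<and> \<bar>c\<bar> \<le> 2 * int n \<and> \<bar>d\<bar> \<le> 2 * int n"
  proof cases
    case 1
    then have "\<bar>b * c\<bar> = int n" using v(2) by simp
    from abs_factor_le[OF this n] cusp_range_abs[OF 1(2)] 1 show ?thesis by linarith
  next
    case 2
    then have "\<bar>a * d\<bar> = int n" using v(2) by simp
    from abs_factor_le[OF this n] cusp_range_abs[OF 2(2)] 2 show ?thesis by linarith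
  next
    case 3
    then have c: "c = - a" by simp
    have "\<bar>a * (b + d)\<bar> = int n" using v(2) by (simp add: c algebra_simps)
    from abs_factor_le[OF this n] cusp_range_abs[OF 3(2)] c show ?thesis by linarith
  qed
  then show ?thesis by (auto simp: quad_box_def)
qed

lemma finite_Vset: "n > 0 \<Longrightarrow> finite (Vset n P)"
  by (rule finite_subset[of _ "quad_box n \<union> rot ` quad_box n \<union> (rot \<circ> rot) ` quad_box n"])
    (use gate_quad_box in \<open>unfold Vset_def, blast\<close>, simp add: finite_quad_box)

lemma sum_rot: "sum (\<lambda>v. f (rot v)) (Vset n P) = sum f (Vset n (\<lambda>v. P (rot (rot v))))"
  by (rule sum.reindex_bij_witness[of _ "\<lambda>v. rot (rot v)" rot]) (auto simp: Vset_def simp del: rot.simps)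

lemma sum_rot_rot: "sum (\<lambda>v. f (rot (rot v))) (Vset n P) = sum f (Vset n (\<lambda>v. P (rot v)))"
  by (rule sum.reindex_bij_witness[of _ rot "\<lambda>v. rot (rot v)"]) (auto simp: Vset_def simp del: rot.simps)

text \<open>The rows of the bordered matrix move and the columns stay. This is needed because the
  corrections in \<open>lex_weight_local\<close> test the three entries of one column.\<close>

fun row_rot :: "quad \<Rightarrow> quad" where "row_rot (a, b, c, d) = (c, d, -(a+c), -(b+d))"

lemma row_rot_row_rot [simp]: "row_rot (row_rot (row_rot v)) = v"
  by (cases v) simp

lemma qdet_row_rot [simp]: "qdet (row_rot v) = qdet v"
  by (cases v) (simp add: algebra_simps)

text \<open>\<open>gate\<close> concerns unordered pairs of rows and treats all columns alike, so
  permuting the rows alone preserves it.\<close>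

lemma gate_row_rot [simp]: "on_quad gate (row_rot v) = on_quad gate v"
proof (cases v)
  case (fields a b c d)
  have "gate c d (-(a+c)) (-(b+d)) = gate a b c d"
    unfolding gate_def has_neg_def opposite_def by (smt (verit))
  then show ?thesis by (simp add: fields)
qed

lemma sum_row_rot: "sum (\<lambda>v. f (row_rot v)) (Vset n P) = sum f (Vset n (\<lambda>v. P (row_rot (row_rot v))))"
  by (rule sum.reindex_bij_witness[of _ "\<lambda>v. row_rot (row_rot v)" row_rot]) (auto simp: Vset_def simp del: row_rot.simps)

lemma sum_row_rot_row_rot: "sum (\<lambda>v. f (row_rot (row_rot v))) (Vset n P) = sum f (Vset n (\<lambda>v. P (row_rot v)))"
  by (rule sum.reindex_bij_witness[of _ row_rot "\<lambda>v. row_rot (row_rot v)"]) (auto simp: Vset_def simp del: row_rot.simps)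

definition cusp :: "quad \<Rightarrow> int" where
  "cusp v = on_quad (\<lambda>a b c d. if a = 0 \<and> cusp_range b c d then 2 else 0) v"

lemma rot_sums:
  fixes a b c d :: int
  shows "-(-(b+d) + (a+b+c+d)) = -(a+c)" "-(-(c+d) + (a+b+c+d)) = -(a+b)" "d + -(c+d) + -(b+d) + (a+b+c+d) = a"
    "x - (y + z + w) = x - y - z - (w::int)"
  by simp_all

text \<open>Summed over the three rotations both kinds of weight have the same total, hence so have
  the defects from 2. One defect is given by \<open>sign_weight_local\<close>, the other by
  \<open>lex_weight_local\<close>.\<close>

lemma orientation_balance:
  assumes n: "n > 0" and P: "mod2_inv P"
  shows "(\<Sum>v\<in>Vset n P. on_quad sign_weight_value v) =
    sum cusp (Vset n P) + sum cusp (Vset n (\<lambda>v. P (row_rot (row_rot v)))) + sum cusp (Vset n (\<lambda>v. P (row_rot v)))"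
proof -
  let ?V = "Vset n P"
  note os = orientation_sum[OF _ _ n finite_Vset[OF n]]
  have P1: "mod2_inv (\<lambda>v. P (rot v))" using P by (rule mod2_inv_rot)
  have P2: "mod2_inv (\<lambda>v. P (rot (rot v)))" using mod2_inv_rot[OF P1] .
  have sign_weight: "(\<Sum>v\<in>?V. on_quad sign_weight_sum v) = int (card (Eset n P)) + card (Eset n (\<lambda>v. P (rot (rot v)))) + card (Eset n (\<lambda>v. P (rot v)))"
  proof -
    have "on_quad sign_weight_sum v = on_quad sign_weight v + on_quad sign_weight (rot v) + on_quad sign_weight (rot (rot v))" for v
      by (cases v) (simp add: sign_weight_sum_def)
    then show ?thesis
      by (simp add: sum.distrib sum_rot sum_rot_rot os orientation_R P P1 P2)
  qed
  have lex_weight: "(\<Sum>v\<in>?V. on_quad lex_weight0 v + on_quad lex_weight1 (rot v) + on_quad lex_weight2 (rot (rot v)))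
      = int (card (Eset n P)) + card (Eset n (\<lambda>v. P (rot (rot v)))) + card (Eset n (\<lambda>v. P (rot v)))"
    by (simp add: sum.distrib sum_rot sum_rot_rot os orientation_W P P1 P2)
  have "(\<Sum>v\<in>?V. on_quad sign_weight_value v) = (\<Sum>v\<in>?V. 2 - on_quad sign_weight_sum v)"
    by (rule sum.cong) (auto simp: Vset_def sign_weight_local)
  also have "\<dots> = (\<Sum>v\<in>?V. 2 - (on_quad lex_weight0 v + on_quad lex_weight1 (rot v) + on_quad lex_weight2 (rot (rot v))))"
    by (simp only: sum_subtractf sign_weight lex_weight)
  also have "\<dots> = (\<Sum>v\<in>?V. cusp v + cusp (row_rot v) + cusp (row_rot (row_rot v)))"
  proof (rule sum.cong)
    fix v assume "v \<in> ?V"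
    then show "2 - (on_quad lex_weight0 v + on_quad lex_weight1 (rot v) + on_quad lex_weight2 (rot (rot v))) =
        cusp v + cusp (row_rot v) + cusp (row_rot (row_rot v))"
    proof (cases v)
      case (fields a b c d)
      have e: "-(c + -(a + c)) = a" "-(d + -(b + d)) = b" "-(a + c) = 0 \<longleftrightarrow> a + c = 0" by auto
      have "gate a b c d" using \<open>v \<in> ?V\<close> by (simp add: Vset_def fields)
      note lex_weight = lex_weight_local[OF this]
      show ?thesis
        unfolding fields cusp_def rot.simps row_rot.simps on_quad_simp e
        using lex_weight by (simp only: rot_sums e)
    qed
  qed simp
  also have "\<dots> = sum cusp (Vset n P) + sum cusp (Vset n (\<lambda>v. P (row_rot (row_rot v)))) + sum cusp (Vset n (\<lambda>v. P (row_rot v)))"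
    by (simp add: sum.distrib sum_row_rot sum_row_rot_row_rot)
  finally show ?thesis .
qed

section \<open>Matrices with a zero corner, counted by divisors\<close>

definition cusp_count :: "nat \<Rightarrow> (int \<Rightarrow> int \<Rightarrow> int \<Rightarrow> bool) \<Rightarrow> nat" where
  "cusp_count n Q = card {(b, c, d). \<bar>b * c\<bar> = int n \<and> cusp_range b c d \<and> Q b c d}"

lemma cusp_range_gate: "cusp_range b c d \<Longrightarrow> c \<noteq> 0 \<Longrightarrow> gate 0 b c d"
  unfolding gate_def has_neg_def opposite_def cusp_range_def by (smt (verit))

lemma sum_indicator_cusp:
  assumes "n > 0"
  shows "(\<Sum>v\<in>Vset n P. on_quad (\<lambda>a b c d. if a = 0 \<and> S b c \<and> cusp_range b c d then 2 else (0::int)) v)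
     = 2 * int (cusp_count n (\<lambda>b c d. S b c \<and> P (0, b, c, d)))"
proof -
  let ?f = "on_quad (\<lambda>a b c d. if a = 0 \<and> S b c \<and> cusp_range b c d then 2 else (0::int))"
  let ?T = "{(b, c, d). \<bar>b * c\<bar> = int n \<and> cusp_range b c d \<and> S b c \<and> P (0, b, c, d)}"
  have im: "{v \<in> Vset n P. on_quad (\<lambda>a b c d. a = 0 \<and> S b c \<and> cusp_range b c d) v} = (\<lambda>(b, c, d). (0, b, c, d)) ` ?T"
    using assms by (auto simp: Vset_def image_iff intro!: cusp_range_gate)
  have "sum ?f (Vset n P) = sum ?f {v \<in> Vset n P. on_quad (\<lambda>a b c d. a = 0 \<and> S b c \<and> cusp_range b c d) v}"
    by (rule sum.mono_neutral_right) (auto simp: finite_Vset assms on_quad_def split: if_splits)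
  also have "\<dots> = sum ?f ((\<lambda>(b, c, d). (0, b, c, d)) ` ?T)"
    by (simp only: im)
  also have "\<dots> = (\<Sum>v\<in>?T. 2)"
    by (rule sum.reindex_cong[of "\<lambda>(b, c, d). (0, b, c, d)"]) (auto simp: inj_on_def)
  finally show ?thesis by (simp add: cusp_count_def)
qed

lemma sum_cusp: "n > 0 \<Longrightarrow> sum cusp (Vset n P) = 2 * int (cusp_count n (\<lambda>b c d. P (0, b, c, d)))"
  using sum_indicator_cusp[of n "\<lambda>_ _. True" P] by (simp add: cusp_def)

lemma sum_fan: "n > 0 \<Longrightarrow> sum (on_quad fan_weight) (Vset n P) = 2 * int (cusp_count n (\<lambda>b c d. \<not> lt_abs c b \<and> P (0, b, c, d)))"
  using sum_indicator_cusp[of n "\<lambda>b c. \<not> lt_abs c b" P] by (simp add: fan_weight_def[abs_def])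

lemma card_parity_interval:
  "card {d \<in> {- int x..<int x}. even d = z} = x" "card {d \<in> {- int x<..int x}. even d = z} = x"
proof -
  have bij: "card {d \<in> {- int x..<int x}. even d = z} = x" for z
  proof (induction x)
    case (Suc x)
    have "{d \<in> {- int (Suc x)..<int (Suc x)}. even d = z} =
      {d \<in> {- int x..<int x}. even d = z} \<union> (if even x = z then {int x} else {- int (Suc x)})"
      by (auto simp: le_less) presburger+
    moreover have "finite {d \<in> {- int x..<int x}. even d = z}"
      by (rule finite_subset[of _ "{- int x..<int x}"]) auto
    then have "card ({d \<in> {- int x..<int x}. even d = z} \<union> (if even x = z then {int x} else {- int (Suc x)})) = x + 1"
      using Suc by (subst card_Un_disjoint) auto
    ultimately show ?case by simp
  qed simp
  show "card {d \<in> {- int x..<int x}. even d = z} = x" by (rule bij)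
  have "card {d \<in> {- int x<..int x}. even d = z} = card {d \<in> {- int x..<int x}. even d = z}"
    by (rule bij_betw_same_card[of uminus], rule bij_betw_byWitness[of _ uminus]) auto
  then show "card {d \<in> {- int x<..int x}. even d = z} = x" using bij by simp
qed

text \<open>For |b| = x and a fixed sign of c, the ranges of d for the two signs of b are adjacent
  and form 2x consecutive integers, x of each parity. The two signs of c give 2x in all.\<close>

lemma cusp_count_parity:
  assumes n: "n > 0"
    and S: "\<And>b c. S (- b) c = S b c" "\<And>b c. S b (- c) = S b c"
    and Z: "\<And>b c. Z (- b) c = Z b c" "\<And>b c. Z b (- c) = Z b c"
  shows "cusp_count n (\<lambda>b c d. S b c \<and> even d = Z b c) = (\<Sum>x | x dvd n \<and> S (int x) (int (n div x)). 2 * x)"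
proof -
  let ?D = "\<lambda>x e. if e then {- int x..<int x} else {- int x<..int x}"
  let ?A = "{(b, c, d). \<bar>b * c\<bar> = int n \<and> cusp_range b c d \<and> S b c \<and> even d = Z b c}"
  let ?X = "{x. x dvd n \<and> S (int x) (int (n div x))}"
  let ?B = "SIGMA x:?X. SIGMA e:UNIV. {d \<in> ?D x e. even d = Z (int x) (int (n div x))}"
  have fin: "finite ?X" by (rule finite_subset[of _ "{x. x dvd n}"]) (use n in auto)
  have sgn: "S b c = S \<bar>b\<bar> \<bar>c\<bar>" "Z b c = Z \<bar>b\<bar> \<bar>c\<bar>" for b c
    by (auto simp: abs_if S Z)
  define F :: "int \<times> int \<times> int \<Rightarrow> nat \<times> bool \<times> int" where "F = (\<lambda>(b, c, d). (nat \<bar>b\<bar>, c > 0, d))"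
  \<comment> \<open>The sign of b is recovered from c and d, since the ranges for b > 0 and b < 0
    are disjoint.\<close>
  define G :: "nat \<times> bool \<times> int \<Rightarrow> int \<times> int \<times> int" where
    "G = (\<lambda>(x, e, d). (if (if e then d < 0 else d \<le> 0) then int x else - int x,
        if e then int (n div x) else - int (n div x), d))"
  have fac: "nat \<bar>b\<bar> dvd n \<and> int (n div nat \<bar>b\<bar>) = \<bar>c\<bar> \<and> c \<noteq> 0" if "\<bar>b * c\<bar> = int n" for b c
  proof -
    have nz: "b \<noteq> 0" "c \<noteq> 0" using that n by auto
    have e: "n = nat \<bar>b\<bar> * nat \<bar>c\<bar>" using that by (metis abs_mult nat_int nat_mult_distrib abs_ge_zero)
    then have "n div nat \<bar>b\<bar> = nat \<bar>c\<bar>" using nz by simp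
    then show ?thesis using e nz by auto
  qed
  have "bij_betw F ?A ?B"
  proof (rule bij_betw_byWitness[of _ G])
    show "\<forall>v\<in>?A. G (F v) = v"
    proof
      fix v assume "v \<in> ?A"
      then obtain b c d where v: "v = (b, c, d)" and h: "\<bar>b * c\<bar> = int n" "cusp_range b c d" by auto
      have y: "int (n div nat \<bar>b\<bar>) = \<bar>c\<bar>" "c \<noteq> 0" using fac[OF h(1)] by blast+
      then show "G (F v) = v" using h(2) by (auto simp: v F_def G_def cusp_range_def)
    qed
    show "\<forall>w\<in>?B. F (G w) = w"
    proof
      fix w assume "w \<in> ?B"
      then obtain x e d where w: "w = (x, e, d)" "x dvd n" by auto
      then have "n div x > 0" using n by (auto elim: dvdE)
      then show "F (G w) = w" by (cases e) (auto simp: w(1) F_def G_def)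
    qed
    show "F ` ?A \<subseteq> ?B"
    proof
      fix w assume "w \<in> F ` ?A"
      then obtain b c d where w: "w = (nat \<bar>b\<bar>, c > 0, d)" and h: "\<bar>b * c\<bar> = int n" "cusp_range b c d" "S b c" "even d = Z b c"
        by (auto simp: F_def)
      have y: "nat \<bar>b\<bar> dvd n" "int (n div nat \<bar>b\<bar>) = \<bar>c\<bar>" "c \<noteq> 0" using fac[OF h(1)] by blast+
      have S: "S \<bar>b\<bar> \<bar>c\<bar>" using h(3) unfolding sgn(1)[of b c] .
      have Z: "even d = Z \<bar>b\<bar> \<bar>c\<bar>" using h(4) unfolding sgn(2)[of b c] .
      have "d \<in> ?D (nat \<bar>b\<bar>) (c > 0)" using h(2) y(3) by (auto simp: cusp_range_def)
      then show "w \<in> ?B" using y S Z by (simp add: w)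
    qed
    show "G ` ?B \<subseteq> ?A"
    proof
      fix v assume "v \<in> G ` ?B"
      then obtain x e d where v: "v = G (x, e, d)" and h: "x dvd n" "S (int x) (int (n div x))" "d \<in> ?D x e"
          "even d = Z (int x) (int (n div x))" by auto
      have y: "n div x > 0" using n h(1) by (auto elim: dvdE)
      have xy: "int x * int (n div x) = int n" using h(1) by (metis dvd_mult_div_cancel of_nat_mult)
      have x: "x > 0" using h(1) n by (auto intro: Nat.gr0I)
      define b where "b = (if (if e then d < 0 else d \<le> 0) then int x else - int x)"
      define c where "c = (if e then int (n div x) else - int (n div x))"
      have bc: "\<bar>b\<bar> = int x" "\<bar>c\<bar> = int (n div x)" by (simp_all add: b_def c_def)
      have "\<bar>b * c\<bar> = int n" unfolding abs_mult bc by (rule xy)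
      moreover have "cusp_range b c d" using h(3) y x by (cases e) (auto simp: cusp_range_def b_def c_def)
      moreover have "S b c" using h(2) unfolding sgn(1)[of b c] bc .
      moreover have "even d = Z b c" using h(4) unfolding sgn(2)[of b c] bc .
      ultimately show "v \<in> ?A" by (simp add: v G_def b_def c_def)
    qed
  qed
  then have "card ?A = card ?B" by (rule bij_betw_same_card)
  also have "\<dots> = (\<Sum>x\<in>?X. \<Sum>e\<in>UNIV. card {d \<in> ?D x e. even d = Z (int x) (int (n div x))})"
    by (subst card_SigmaI[OF fin]) (auto intro!: sum.cong simp: UNIV_bool)
  also have "\<dots> = (\<Sum>x\<in>?X. 2 * x)"
    by (rule sum.cong) (simp_all add: UNIV_bool card_parity_interval[simplified])
  finally show ?thesis unfolding cusp_count_def by simp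
qed

lemma finite_cusp_set: "n > 0 \<Longrightarrow> finite {(b, c, d). \<bar>b * c\<bar> = int n \<and> cusp_range b c d \<and> Q b c d}"
proof (rule finite_subset)
  assume n: "n > 0"
  show "{(b, c, d). \<bar>b * c\<bar> = int n \<and> cusp_range b c d \<and> Q b c d} \<subseteq> {-int n..int n} \<times> {-int n..int n} \<times> {-int n..int n}"
  proof safe
    fix b c d assume h: "\<bar>b * c\<bar> = int n" "cusp_range b c d"
    from abs_factor_le[OF h(1) n] cusp_range_abs[OF h(2)]
    show "b \<in> {-int n..int n}" "c \<in> {-int n..int n}" "d \<in> {-int n..int n}" by auto
  qed
qed simp

lemma cusp_count_all:
  assumes n: "n > 0"
    and S: "\<And>b c. S (- b) c = S b c" "\<And>b c. S b (- c) = S b c"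
  shows "cusp_count n (\<lambda>b c d. S b c) = (\<Sum>x | x dvd n \<and> S (int x) (int (n div x)). 4 * x)"
proof -
  have "cusp_count n (\<lambda>b c d. S b c) = cusp_count n (\<lambda>b c d. S b c \<and> even d = True) + cusp_count n (\<lambda>b c d. S b c \<and> even d = False)"
    unfolding cusp_count_def
    by (subst card_Un_disjoint[symmetric]) (auto intro!: arg_cong[of _ _ card] finite_cusp_set[OF n])
  also have "\<dots> = (\<Sum>x | x dvd n \<and> S (int x) (int (n div x)). 2 * x) + (\<Sum>x | x dvd n \<and> S (int x) (int (n div x)). 2 * x)"
    using cusp_count_parity[OF n, of S "\<lambda>_ _. True"] cusp_count_parity[OF n, of S "\<lambda>_ _. False"] S by simp
  also have "\<dots> = (\<Sum>x | x dvd n \<and> S (int x) (int (n div x)). 4 * x)"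
    by (simp add: sum.distrib[symmetric])
  finally show ?thesis .
qed

section \<open>The cone and the general counting identity\<close>

definition sector :: quad_weight where
  "sector a b c d = cone_weight (a+a+b+c) (d+d+b+c) (-b-c)"

definition Dset :: "nat \<Rightarrow> (quad \<Rightarrow> bool) \<Rightarrow> quad set" where
  "Dset n P = {v. on_quad sector v > 0 \<and> qdet v = int n \<and> P v}"

definition diag :: "nat \<Rightarrow> (quad \<Rightarrow> bool) \<Rightarrow> quad set" where
  "diag n P = {v. on_quad (\<lambda>a b c d. b = 0 \<and> c = 0 \<and> a > 0 \<and> d > 0) v \<and> qdet v = int n \<and> P v}"

lemma sector_nonneg: "sector a b c d \<ge> 0"
  by (simp add: sector_def cone_weight_def)

text \<open>With p, q, r the arguments of \<open>cone_weight\<close>, 4(ad - bc) = pq + qr + rp + (b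
  - c)^2, and at most one of p, q, r is 0.\<close>

lemma sector_det:
  assumes "sector a b c d > 0"
  shows "a * d - b * c > 0"
proof -
  let ?p = "a+a+b+c" and ?q = "d+d+b+c" and ?r = "-b-c"
  have h: "?p \<ge> 0" "?q \<ge> 0" "?r \<ge> 0" "?p + ?q > 0" "?q + ?r > 0" "?r + ?p > 0"
    using assms by (auto simp: sector_def cone_weight_def split: if_splits)
  define u v w where "u = ?p * ?q" and "v = ?q * ?r" and "w = ?r * ?p"
  have "u \<ge> 0" "v \<ge> 0" "w \<ge> 0" unfolding u_def v_def w_def using h by simp_all
  moreover have "u > 0 \<or> v > 0 \<or> w > 0"
    unfolding u_def v_def w_def using h by (smt (verit) mult_pos_pos)
  moreover have "4 * (a * d - b * c) = u + v + w + (b - c)^2"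
    by (simp add: u_def v_def w_def algebra_simps power2_eq_square)
  moreover have "(b - c)^2 \<ge> 0" by simp
  ultimately have "4 * (a * d - b * c) > 0" by linarith
  then show ?thesis by simp
qed

lemma sector_gate:
  assumes "sector a b c d > 0"
  shows "gate a b c d \<or> (b = 0 \<and> c = 0 \<and> a > 0 \<and> d > 0) \<or> (c + d = 0 \<and> b + d = 0 \<and> d > 0 \<and> a+b+c+d > 0)
     \<or> (a + c = 0 \<and> a + b = 0 \<and> a > 0 \<and> a+b+c+d > 0)"
  using assms unfolding sector_def cone_weight_def gate_def has_neg_def opposite_def by (smt (verit))

lemma diag_sector:
  "a > 0 \<Longrightarrow> d > 0 \<Longrightarrow> sector a 0 0 d = 1"
  "d > 0 \<Longrightarrow> a+b+c+d > 0 \<Longrightarrow> c + d = 0 \<Longrightarrow> b + d = 0 \<Longrightarrow> sector a b c d = 1"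
  "a > 0 \<Longrightarrow> a+b+c+d > 0 \<Longrightarrow> a + c = 0 \<Longrightarrow> a + b = 0 \<Longrightarrow> sector a b c d = 1"
  by (auto simp: sector_def cone_weight_def)

lemma gate_diag: "gate a 0 0 d \<longleftrightarrow> opposite a d"
  by (auto simp: gate_def has_neg_def opposite_def)

lemma finite_diag: "finite (diag n P)"
proof (rule finite_subset)
  show "diag n P \<subseteq> {-int n..int n} \<times> {0} \<times> {0} \<times> {-int n..int n}"
  proof
    fix v assume v: "v \<in> diag n P"
    obtain a b c d where abcd: "v = (a, b, c, d)" by (cases v)
    have h: "a > 0" "d > 0" "b = 0" "c = 0" "a * d = int n" using v by (auto simp: diag_def abcd)
    then have "n > 0" by (metis of_nat_0_less_iff mult_pos_pos)
    moreover have "\<bar>a * d\<bar> = int n" using h by simp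
    ultimately show "v \<in> {-int n..int n} \<times> {0} \<times> {0} \<times> {-int n..int n}"
      using abs_factor_le[of a d n] h by (auto simp: abcd)
  qed
qed simp

text \<open>The cone leaves \<open>gate\<close> only at positive diagonal matrices and their
  rotations, which lie on walls and have weight 1. The three extra counts cancel later against the
  \<open>diagonal_indicator\<close> terms.\<close>

lemma sum_sector:
  assumes n: "n > 0"
  shows "finite (Dset n P)"
    "(\<Sum>v\<in>Dset n P. on_quad sector v) = (\<Sum>v\<in>Vset n P. on_quad sector v)
      + int (card (diag n P)) + card (diag n (\<lambda>v. P (rot v))) + card (diag n (\<lambda>v. P (rot (rot v))))"
proof -
  let ?V = "{v \<in> Vset n P. on_quad sector v > 0}"
  let ?A = "diag n P" let ?B = "rot ` diag n (\<lambda>v. P (rot v))"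
  let ?C = "(\<lambda>v. rot (rot v)) ` diag n (\<lambda>v. P (rot (rot v)))"
  have D: "Dset n P = ?V \<union> (?A \<union> (?B \<union> ?C))"
  proof (intro set_eqI iffI)
    fix v assume v: "v \<in> Dset n P"
    obtain a b c d where abcd: "v = (a, b, c, d)" by (cases v)
    have s: "sector a b c d > 0" and det: "a * d - b * c = int n" and P: "P v"
      using v by (auto simp: Dset_def abcd)
    from sector_gate[OF s] consider "gate a b c d" | "b = 0" "c = 0" "a > 0" "d > 0"
      | "c + d = 0" "b + d = 0" "d > 0" "a+b+c+d > 0" | "a + c = 0" "a + b = 0" "a > 0" "a+b+c+d > 0" by blast
    then show "v \<in> ?V \<union> (?A \<union> (?B \<union> ?C))"
    proof cases
      case 1 then show ?thesis using s det P by (simp add: Vset_def abcd)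
    next
      case 2 then show ?thesis using det P by (simp add: diag_def abcd)
    next
      case 3
      then have r: "rot v = (d, 0, 0, a+b+c+d)" by (simp add: abcd)
      have "on_quad (\<lambda>a b c d. b = 0 \<and> c = 0 \<and> a > 0 \<and> d > 0) (rot v)" unfolding r using 3 by simp
      moreover have "qdet (rot v) = int n" using det by (simp add: abcd del: rot.simps)
      ultimately have "rot v \<in> diag n (\<lambda>v. P (rot (rot v)))" using P by (simp add: diag_def del: rot.simps)
      then have "v \<in> ?C" by (metis (no_types, lifting) image_eqI rot_rot)
      then show ?thesis by blast
    next
      case 4
      then have r: "rot (rot v) = (a+b+c+d, 0, 0, a)" by (simp add: abcd)
      have "on_quad (\<lambda>a b c d. b = 0 \<and> c = 0 \<and> a > 0 \<and> d > 0) (rot (rot v))" unfolding r using 4 by simp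
      moreover have "qdet (rot (rot v)) = int n" using det by (simp add: abcd del: rot.simps)
      ultimately have "rot (rot v) \<in> diag n (\<lambda>v. P (rot v))" using P by (simp add: diag_def del: rot.simps)
      then have "v \<in> ?B" by (metis (no_types, lifting) image_eqI rot_rot)
      then show ?thesis by blast
    qed
  next
    fix v assume "v \<in> ?V \<union> (?A \<union> (?B \<union> ?C))"
    then consider "v \<in> ?V" | "v \<in> ?A" | "v \<in> ?B" | "v \<in> ?C" by blast
    then show "v \<in> Dset n P"
    proof cases
      case 1 then show ?thesis by (cases v) (auto simp: Vset_def Dset_def dest: sector_det)
    next
      case 2 then show ?thesis by (cases v) (auto simp: diag_def Dset_def diag_sector)
    next
      case 3 then show ?thesis by (auto simp: diag_def Dset_def diag_sector algebra_simps)
    next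
      case 4 then show ?thesis by (auto simp: diag_def Dset_def diag_sector algebra_simps)
    qed
  qed
  have fin: "finite ?V" "finite ?A" "finite ?B" "finite ?C" using n by (auto simp: finite_Vset finite_diag)
  show "finite (Dset n P)" unfolding D using fin by blast
  have gA: "\<not> on_quad gate v" if "v \<in> diag n Q" for v Q
    using that by (cases v) (auto simp: diag_def gate_diag opposite_def)
  have disj: "?V \<inter> (?A \<union> (?B \<union> ?C)) = {}"
  proof -
    have "\<not> on_quad gate v" if "v \<in> ?A \<union> (?B \<union> ?C)" for v
      using that by (elim UnE imageE) (simp_all add: gA del: rot.simps)
    then show ?thesis unfolding Vset_def by blast
  qed
  have disj2: "?A \<inter> (?B \<union> ?C) = {}" by (auto simp: diag_def)
  have disj3: "?B \<inter> ?C = {}" by (auto simp: diag_def)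
  have inj: "inj_on rot S" "inj_on (\<lambda>v. rot (rot v)) S" for S
    by (metis inj_onI rot_rot)+
  have one: "on_quad sector v = 1" if "v \<in> ?A \<union> (?B \<union> ?C)" for v
    using that by (cases v) (auto simp: diag_def diag_sector)
  have "(\<Sum>v\<in>Dset n P. on_quad sector v) = (\<Sum>v\<in>?V. on_quad sector v) + (\<Sum>v\<in>?A \<union> (?B \<union> ?C). on_quad sector v)"
    unfolding D using fin disj by (intro sum.union_disjoint) auto
  also have "(\<Sum>v\<in>?V. on_quad sector v) = (\<Sum>v\<in>Vset n P. on_quad sector v)"
  proof (rule sum.mono_neutral_left)
    show "\<forall>v\<in>Vset n P - ?V. on_quad sector v = 0"
    proof
      fix v assume "v \<in> Vset n P - ?V"
      then show "on_quad sector v = 0" using sector_nonneg by (cases v) (auto simp: not_less intro: antisym)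
    qed
  qed (use n in \<open>auto simp: finite_Vset\<close>)
  also have "(\<Sum>v\<in>?A \<union> (?B \<union> ?C). on_quad sector v) = (\<Sum>v\<in>?A \<union> (?B \<union> ?C). 1)"
    by (rule sum.cong[OF refl one])
  also have "\<dots> = int (card (?A \<union> (?B \<union> ?C)))"
    by (simp only: sum_constant mult_1_right of_nat_id)
  also have "card (?A \<union> (?B \<union> ?C)) = card ?A + (card ?B + card ?C)"
    using fin disj2 disj3 by (subst card_Un_disjoint; (subst card_Un_disjoint)?) auto
  finally show "(\<Sum>v\<in>Dset n P. on_quad sector v) = (\<Sum>v\<in>Vset n P. on_quad sector v)
      + int (card (diag n P)) + card (diag n (\<lambda>v. P (rot v))) + card (diag n (\<lambda>v. P (rot (rot v))))"
    by (simp add: card_image inj)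
qed

text \<open>A diagonal matrix satisfies \<open>gate\<close> exactly when its two entries have
  opposite signs. Negating the first or the second entry of a positive diagonal matrix yields each
  of these once.\<close>

lemma sum_dia:
  assumes n: "n > 0" and P: "mod2_inv P"
  shows "(\<Sum>v\<in>Vset n P. on_quad (\<lambda>a b c d. diagonal_indicator b c) v) = 2 * int (card (diag n P))"
proof -
  let ?A = "(\<lambda>(a, b, c, d). (- a, b, c, d)) ` diag n P" let ?B = "(\<lambda>(a, b, c, d). (a, b, c, - d)) ` diag n P"
  let ?S = "{v \<in> Vset n P. on_quad (\<lambda>a b c d. b = 0 \<and> c = 0) v}"
  have Pm: "P (- a, 0, 0, d) = P (a, 0, 0, d)" "P (a, 0, 0, - d) = P (a, 0, 0, d)" for a d
    by (rule P[unfolded mod2_inv_def, rule_format]; simp)+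
  have S: "?S = ?A \<union> ?B"
  proof (intro set_eqI iffI)
    fix v assume v: "v \<in> ?S"
    obtain a b c d where abcd: "v = (a, b, c, d)" by (cases v)
    have h: "b = 0" "c = 0" "opposite a d" "\<bar>a * d\<bar> = int n" "P (a, 0, 0, d)"
      using v by (auto simp: Vset_def abcd gate_diag)
    show "v \<in> ?A \<union> ?B"
    proof (cases "a < 0")
      case True
      then have "(- a, 0, 0, d) \<in> diag n P" using h Pm by (auto simp: diag_def opposite_def abs_mult)
      then show ?thesis using h by (force simp: abcd image_iff)
    next
      case False
      then have "(a, 0, 0, - d) \<in> diag n P" using h Pm by (auto simp: diag_def opposite_def abs_mult)
      then show ?thesis using h by (force simp: abcd image_iff)
    qed
  next
    fix v assume "v \<in> ?A \<union> ?B"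
    then show "v \<in> ?S" using Pm by (auto simp: diag_def Vset_def gate_diag opposite_def)
  qed
  have disj: "?A \<inter> ?B = {}" by (auto simp: diag_def)
  have "(\<Sum>v\<in>Vset n P. on_quad (\<lambda>a b c d. diagonal_indicator b c) v) = (\<Sum>v\<in>?S. on_quad (\<lambda>a b c d. diagonal_indicator b c) v)"
    by (rule sum.mono_neutral_right) (auto simp: finite_Vset n diagonal_indicator_def on_quad_def split: if_splits)
  also have "\<dots> = int (card ?S)"
    by (subst sum.cong[OF refl, of _ _ "\<lambda>_. 1"]) (auto simp: diagonal_indicator_def)
  also have "card ?S = card ?A + card ?B"
    unfolding S by (rule card_Un_disjoint) (simp_all only: finite_imageI finite_diag disj)
  finally have "(\<Sum>v\<in>Vset n P. on_quad (\<lambda>a b c d. diagonal_indicator b c) v) = int (card ?A + card ?B)" .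
  moreover have "card ?A = card (diag n P)" "card ?B = card (diag n P)"
    by (rule card_image; auto simp: inj_on_def)+
  ultimately show ?thesis by simp
qed

definition qneg :: "quad \<Rightarrow> quad" where "qneg v = on_quad (\<lambda>a b c d. (-a, -b, -c, -d)) v"

lemma sum_sector_uminus:
  assumes P: "mod2_inv P"
  shows "(\<Sum>v\<in>Vset n P. on_quad (\<lambda>a b c d. cone_weight (-a-a-b-c) (-d-d-b-c) (b+c)) v) = (\<Sum>v\<in>Vset n P. on_quad sector v)"
proof (rule sum.reindex_bij_witness[of _ qneg qneg])
  have Pm: "P (- a, - b, - c, - d) = P (a, b, c, d)" for a b c d
    by (rule P[unfolded mod2_inv_def, rule_format]; simp)
  fix v
  show "qneg (qneg v) = v" by (cases v) (simp add: qneg_def)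
  show "qneg (qneg v) = v" by (cases v) (simp add: qneg_def)
  show "v \<in> Vset n P \<Longrightarrow> qneg v \<in> Vset n P"
    by (cases v) (simp add: Vset_def qneg_def gate_uminus Pm)
  then show "v \<in> Vset n P \<Longrightarrow> qneg v \<in> Vset n P" .
  show "on_quad sector (qneg v) = on_quad (\<lambda>a b c d. cone_weight (-a-a-b-c) (-d-d-b-c) (b+c)) v"
    by (cases v) (simp add: sector_def qneg_def)
qed

abbreviation symmetric_term :: "quad \<Rightarrow> int" where
  "symmetric_term \<equiv> on_quad (\<lambda>a b c d. if b = c \<and> (a = 0 \<or> d = 0 \<or> a+b+c+d = 0) then 1 else 0)"

abbreviation antisymmetric_term :: "quad \<Rightarrow> int" where
  "antisymmetric_term \<equiv> on_quad (\<lambda>a b c d. if a = 0 \<and> d = 0 \<and> b = -c then 4 else 0)"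

text \<open>\<open>orientation_balance\<close> with all terms evaluated. The two choices of P below
  give the class number side and the \<open>alpha_bar\<close> side.\<close>

theorem sector_count:
  assumes n: "n > 0" and P: "mod2_inv P"
  shows "2 * (\<Sum>v\<in>Dset n P. on_quad sector v)
    - (\<Sum>v\<in>Vset n P. symmetric_term v)
    - (\<Sum>v\<in>Vset n P. antisymmetric_term v)
    + 2 * (int (cusp_count n (\<lambda>b c d. \<not> lt_abs c b \<and> P (0, b, c, d)))
       + cusp_count n (\<lambda>b c d. \<not> lt_abs c b \<and> P (b+c+d, -c, -b, 0))
       + cusp_count n (\<lambda>b c d. \<not> lt_abs c b \<and> P (d, -(c+d), -(b+d), b+c+d)))
    = 2 * (int (cusp_count n (\<lambda>b c d. P (0, b, c, d))) + cusp_count n (\<lambda>b c d. P (-c, -(b+d), 0, b))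
       + cusp_count n (\<lambda>b c d. P (c, d, -c, -(b+d))))"
proof -
  let ?V = "Vset n P"
  have P1: "mod2_inv (\<lambda>v. P (rot v))" using P by (rule mod2_inv_rot)
  have P2: "mod2_inv (\<lambda>v. P (rot (rot v)))" using mod2_inv_rot[OF P1] .
  let ?s = "symmetric_term"
  let ?t = "antisymmetric_term"
  let ?m = "on_quad (\<lambda>a b c d. cone_weight (-a-a-b-c) (-d-d-b-c) (b+c))"
  let ?d = "on_quad (\<lambda>a b c d. diagonal_indicator b c)"
  have "on_quad sign_weight_value v = on_quad sector v + ?m v - ?s v - ?t v + on_quad fan_weight v + on_quad fan_weight (rot v) + on_quad fan_weight (rot (rot v))
     + ?d v + ?d (rot v) + ?d (rot (rot v))" for v
  proof (cases v)
    case (fields a b c d)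
    show ?thesis
      using diagonal_indicator_uminus[of "c+d" "b+d"] diagonal_indicator_uminus[of "a+c" "a+b"] by (simp add: fields sign_weight_value_def sector_def)
  qed
  then have "(\<Sum>v\<in>?V. on_quad sign_weight_value v) = sum (on_quad sector) ?V + sum ?m ?V - sum ?s ?V - sum ?t ?V
     + sum (on_quad fan_weight) ?V + sum (on_quad fan_weight) (Vset n (\<lambda>v. P (rot (rot v)))) + sum (on_quad fan_weight) (Vset n (\<lambda>v. P (rot v)))
     + sum ?d ?V + sum ?d (Vset n (\<lambda>v. P (rot (rot v)))) + sum ?d (Vset n (\<lambda>v. P (rot v)))"
    by (simp add: sum.distrib sum_subtractf sum_rot sum_rot_rot)
  also have "\<dots> = 2 * (\<Sum>v\<in>Dset n P. on_quad sector v) - sum ?s ?V - sum ?t ?V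
     + sum (on_quad fan_weight) ?V + sum (on_quad fan_weight) (Vset n (\<lambda>v. P (rot (rot v)))) + sum (on_quad fan_weight) (Vset n (\<lambda>v. P (rot v)))"
    using sum_sector(2)[OF n, of P] sum_dia[OF n P] sum_dia[OF n P1] sum_dia[OF n P2] sum_sector_uminus[OF P, of n]
    by linarith
  finally show ?thesis
    unfolding orientation_balance[OF n P] by (simp add: sum_cusp n sum_fan algebra_simps)
qed

section \<open>The two residue classes\<close>

lemma lt_abs_of_nat: "lt_abs (int x) (int y) \<longleftrightarrow> x < y"
  by (auto simp: lt_abs_def)

lemma lt_abs_uminus: "lt_abs (- b) c = lt_abs b c" "lt_abs b (- c) = lt_abs b c"
  by (auto simp: lt_abs_def)

abbreviation co_sum :: "nat \<Rightarrow> (nat \<Rightarrow> nat \<Rightarrow> bool) \<Rightarrow> nat" where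
  "co_sum n Q \<equiv> (\<Sum>x | x dvd n \<and> Q x (n div x). x)"

text \<open>An odd b - c excludes b = c and b = -c, so the symmetric and antisymmetric terms
  disappear. It also makes the three cone parameters odd, so no matrix lies on a wall.\<close>

lemma sector_count_odd:
  assumes n: "n > 0"
  shows "int (card (Dset n (\<lambda>(a, b, c, d). odd (b - c)))) =
    2 * int (sigma1 n) + 2 * int (co_sum n (\<lambda>x y. odd (x + y))) - 6 * int (co_sum n (\<lambda>x y. x \<le> y \<and> odd (x + y)))"
proof -
  let ?P = "\<lambda>(a::int, b::int, c::int, d::int). odd (b - c)"
  have P: "mod2_inv ?P" by (auto simp: mod2_inv_def)
  have s: "(\<Sum>v\<in>Vset n ?P. symmetric_term v) = 0"
    by (rule sum.neutral) (auto simp: Vset_def on_quad_def)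
  have t: "(\<Sum>v\<in>Vset n ?P. antisymmetric_term v) = 0"
    by (rule sum.neutral) (auto simp: Vset_def on_quad_def)
  have D: "(\<Sum>v\<in>Dset n ?P. on_quad sector v) = 2 * int (card (Dset n ?P))"
  proof -
    have "on_quad sector v = 2" if "v \<in> Dset n ?P" for v
    proof (cases v)
      case (fields a b c d)
      then have h: "sector a b c d > 0" "odd (b - c)" using that by (auto simp: Dset_def)
      then have "a+a+b+c \<noteq> 0" "d+d+b+c \<noteq> 0" "-b-c \<noteq> 0" by presburger+
      then show ?thesis using h by (auto simp: fields sector_def cone_weight_def split: if_splits)
    qed
    then show ?thesis by simp
  qed
  let ?A = "co_sum n (\<lambda>x y. x \<le> y \<and> odd (x + y))" and ?B = "co_sum n (\<lambda>x y. odd (x + y))"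
  have "cusp_count n (\<lambda>b c d. \<not> lt_abs c b \<and> odd (b - c)) = 4 * ?A"
  proof -
    have "cusp_count n (\<lambda>b c d. \<not> lt_abs c b \<and> odd (b - c)) =
       (\<Sum>x | x dvd n \<and> (\<not> lt_abs (int (n div x)) (int x) \<and> odd (int x - int (n div x))). 4 * x)"
      by (rule cusp_count_all[OF n]) (auto simp: lt_abs_uminus)
    also have "\<dots> = 4 * ?A"
      unfolding sum_distrib_left by (rule sum.cong) (auto simp: lt_abs_of_nat not_less)
    finally show ?thesis .
  qed
  moreover have "cusp_count n (\<lambda>b c d. odd (b - c)) = 4 * ?B"
  proof -
    have "cusp_count n (\<lambda>b c d. odd (b - c)) = (\<Sum>x | x dvd n \<and> odd (int x - int (n div x)). 4 * x)"
      by (rule cusp_count_all[OF n]) auto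
    also have "\<dots> = 4 * ?B"
      unfolding sum_distrib_left by (rule sum.cong) auto
    finally show ?thesis .
  qed
  \<comment> \<open>For these two cusps the residue condition fixes the parity of d once b and c are
    given, which halves the full count 4x.\<close>
  moreover have "cusp_count n (\<lambda>b c d. True \<and> even d = odd b) = (\<Sum>x | x dvd n \<and> True. 2 * x)"
    "cusp_count n (\<lambda>b c d. True \<and> even d = odd c) = (\<Sum>x | x dvd n \<and> True. 2 * x)"
    by (rule cusp_count_parity[OF n]; simp)+
  moreover have "(\<Sum>x | x dvd n \<and> True. 2 * x) = 2 * sigma1 n"
    by (simp add: sigma1_def sum_distrib_left)
  moreover have "(\<lambda>b c (d::int). \<not> lt_abs c b \<and> odd (- c - - b)) = (\<lambda>b c d. \<not> lt_abs c b \<and> odd (b - c))"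
    "(\<lambda>b c d. \<not> lt_abs c b \<and> odd (-(c+d) - -(b+d))) = (\<lambda>b c d. \<not> lt_abs c b \<and> odd (b - c))"
    "(\<lambda>b (c::int) d. odd (-(b+d) - 0)) = (\<lambda>b c d::int. True \<and> even d = odd b)"
    "(\<lambda>(b::int) c d. odd (d - - c)) = (\<lambda>b c d::int. True \<and> even d = odd c)"
    by (intro ext; auto)+
  moreover note sector_count[OF n P, unfolded prod.case]
  ultimately have "2 * (2 * int (card (Dset n ?P))) - 0 - 0 + 2 * (int (4 * ?A) + int (4 * ?A) + int (4 * ?A)) =
      2 * (int (4 * ?B) + int (2 * sigma1 n) + int (2 * sigma1 n))"
    by (simp only: s t D)
  then show ?thesis by simp
qed

lemma gate_symmetric:
  "gate 0 b b d \<longleftrightarrow> (b > 0 \<and> -2*b < d \<and> d < 0) \<or> (b < 0 \<and> 0 < d \<and> d < -2*b)"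
  "gate a b b 0 \<longleftrightarrow> (b > 0 \<and> -2*b < a \<and> a < 0) \<or> (b < 0 \<and> 0 < a \<and> a < -2*b)"
  "gate a b b (-a-2*b) \<longleftrightarrow> (a+b > 0 \<and> 0 < a \<and> a < 2*(a+b)) \<or> (a+b < 0 \<and> 2*(a+b) < a \<and> a < 0)"
  "gate 0 b (-b) 0 \<longleftrightarrow> b \<noteq> 0"
  unfolding gate_def has_neg_def opposite_def by (smt (verit))+

lemma even_between:
  fixes d :: int
  assumes "even d" "-2*k < d" "d < 0"
  obtains j where "d = -2*j" "1 \<le> j" "j \<le> k - 1"
  using assms by (elim evenE) (auto intro!: that[of "- (d div 2)"])

text \<open>For b = c and a zero on the diagonal of the bordered matrix the determinant is minus a
  square, so b (or a + b, if the third diagonal entry is 0) is k or -k. \<open>gate\<close> bounds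
  the remaining parameter: the three positions give 2(k-1), 2(k-1) and 2(2k-1) matrices, the last
  more because a - d is then automatically even.\<close>

lemma symmetric_count:
  assumes n: "n = k^2" and k: "k > 0"
  shows "(\<Sum>v\<in>Vset n (\<lambda>(a, b, c, d). even (a - d) \<and> even (b - c)).
     symmetric_term v) = 8 * int k - 6"
proof -
  let ?P = "\<lambda>(a::int, b::int, c::int, d::int). even (a - d) \<and> even (b - c)"
  let ?f = "symmetric_term"
  let ?S = "{v \<in> Vset n ?P. ?f v = 1}"
  let ?K = "int k"
  let ?I = "{1, -1::int} \<times> {1..?K - 1}" and ?J = "{1, -1::int} \<times> {1..2 * ?K - 1}"
  let ?fA = "\<lambda>(e, j). (0::int, e * ?K, e * ?K, -2 * e * j)"
  let ?fB = "\<lambda>(e, j). (-2 * e * j, e * ?K, e * ?K, 0::int)"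
  let ?fC = "\<lambda>(e, j). (e * j, e * (?K - j), e * (?K - j), e * (j - 2 * ?K))"
  let ?A = "?fA ` ?I"
  let ?B = "?fB ` ?I"
  let ?C = "?fC ` ?J"
  have n0: "n > 0" using n k by simp
  have root: "b = ?K \<or> b = - ?K" if "b * b = int n" for b
    using that n by (metis of_nat_power power2_eq_iff power2_eq_square)
  have S: "?S = ?A \<union> (?B \<union> ?C)"
  proof (intro set_eqI iffI)
    fix v assume v: "v \<in> ?S"
    obtain a b c d where abcd: "v = (a, b, c, d)" by (cases v)
    have h: "gate a b b d" "\<bar>a * d - b * b\<bar> = int n" "even (a - d)" "c = b" "a = 0 \<or> d = 0 \<or> a+b+b+d = 0"
      using v by (auto simp: Vset_def abcd split: if_splits)
    consider "a = 0" | "d = 0" | "d = -a-2*b" using h(5) by fastforce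
    then show "v \<in> ?A \<union> (?B \<union> ?C)"
    proof cases
      case 1
      then have g: "(b > 0 \<and> -2*b < d \<and> d < 0) \<or> (b < 0 \<and> 0 < d \<and> d < -2*b)" using h(1) gate_symmetric(1) by simp
      have "b * b = int n" using h 1 by simp
      then have "b = ?K \<or> b = - ?K" by (rule root)
      then show ?thesis
      proof
        assume b: "b = ?K"
        then obtain j where "d = -2*j" "1 \<le> j" "j \<le> ?K - 1" using g h 1 k by (auto elim: even_between[of d ?K])
        then have "v = ?fA (1, j)" "(1, j) \<in> ?I" using abcd b 1 h by auto
        then show ?thesis by blast
      next
        assume b: "b = - ?K"
        then obtain j where "-d = -2*j" "1 \<le> j" "j \<le> ?K - 1" using g h 1 k by (auto elim: even_between[of "-d" ?K])
        then have "v = ?fA (-1, j)" "(-1, j) \<in> ?I" using abcd b 1 h by auto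
        then show ?thesis by blast
      qed
    next
      case 2
      then have g: "(b > 0 \<and> -2*b < a \<and> a < 0) \<or> (b < 0 \<and> 0 < a \<and> a < -2*b)" using h(1) gate_symmetric(2) by simp
      have "b * b = int n" using h 2 by simp
      then have "b = ?K \<or> b = - ?K" by (rule root)
      then show ?thesis
      proof
        assume b: "b = ?K"
        then obtain j where "a = -2*j" "1 \<le> j" "j \<le> ?K - 1" using g h 2 k by (auto elim: even_between[of a ?K])
        then have "v = ?fB (1, j)" "(1, j) \<in> ?I" using abcd b 2 h by auto
        then show ?thesis by blast
      next
        assume b: "b = - ?K"
        then obtain j where "-a = -2*j" "1 \<le> j" "j \<le> ?K - 1" using g h 2 k by (auto elim: even_between[of "-a" ?K])
        then have "v = ?fB (-1, j)" "(-1, j) \<in> ?I" using abcd b 2 h by auto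
        then show ?thesis by blast
      qed
    next
      case 3
      then have g: "(a+b > 0 \<and> 0 < a \<and> a < 2*(a+b)) \<or> (a+b < 0 \<and> 2*(a+b) < a \<and> a < 0)"
        using h(1) gate_symmetric(3) by simp
      have "a * d - b * b = - ((a+b) * (a+b))" by (simp add: 3 algebra_simps)
      then have "(a+b) * (a+b) = int n" using h by simp
      then have "a + b = ?K \<or> a + b = - ?K" by (rule root)
      then show ?thesis
      proof
        assume b: "a + b = ?K"
        then have "v = ?fC (1, a)" "(1, a) \<in> ?J"
          using g abcd 3 h k by auto
        then show ?thesis by blast
      next
        assume b: "a + b = - ?K"
        then have "v = ?fC (-1, -a)" "(-1, -a) \<in> ?J"
          using g abcd 3 h k by auto
        then show ?thesis by blast
      qed
    qed
  next
    fix v assume "v \<in> ?A \<union> (?B \<union> ?C)"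
    then consider "v \<in> ?A" | "v \<in> ?B" | "v \<in> ?C" by blast
    then show "v \<in> ?S"
    proof cases
      case 1
      then obtain x where x: "x \<in> ?I" "v = ?fA x" by blast
      obtain e j where "x = (e, j)" by (cases x)
      then have v: "v = (0::int, e * ?K, e * ?K, -2 * e * j)" and e: "e = 1 \<or> e = -1" and j: "1 \<le> j" "j \<le> ?K - 1" using x by auto
      have "gate 0 (e * ?K) (e * ?K) (-2 * e * j)" unfolding gate_symmetric(1) using e j by auto
      then show ?thesis using e n by (auto simp: v Vset_def power2_eq_square)
    next
      case 2
      then obtain x where x: "x \<in> ?I" "v = ?fB x" by blast
      obtain e j where "x = (e, j)" by (cases x)
      then have v: "v = (-2 * e * j, e * ?K, e * ?K, 0::int)" and e: "e = 1 \<or> e = -1" and j: "1 \<le> j" "j \<le> ?K - 1" using x by auto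
      have "gate (-2 * e * j) (e * ?K) (e * ?K) 0" unfolding gate_symmetric(2) using e j by auto
      then show ?thesis using e n by (auto simp: v Vset_def power2_eq_square)
    next
      case 3
      then obtain x where x: "x \<in> ?J" "v = ?fC x" by blast
      obtain e j where "x = (e, j)" by (cases x)
      then have v: "v = (e * j, e * (?K - j), e * (?K - j), e * (j - 2 * ?K))" and e: "e = 1 \<or> e = -1" and j: "1 \<le> j" "j \<le> 2 * ?K - 1" using x by auto
      have eq: "e * (j - 2 * ?K) = - (e * j) - 2 * (e * (?K - j))" by (simp add: algebra_simps)
      have "gate (e * j) (e * (?K - j)) (e * (?K - j)) (e * (j - 2 * ?K))" unfolding eq gate_symmetric(3)
        using e j k by auto
      moreover have "e * j * (e * (j - 2 * ?K)) - e * (?K - j) * (e * (?K - j)) = - (?K * ?K)"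
        using e by (auto simp: algebra_simps)
      ultimately show ?thesis using e n by (auto simp: v Vset_def power2_eq_square)
    qed
  qed
  have "sum ?f (Vset n ?P) = sum ?f ?S"
    by (rule sum.mono_neutral_right) (auto simp: finite_Vset n0 on_quad_def split: if_splits)
  also have "\<dots> = int (card ?S)" by simp
  also have "card ?S = card ?A + card (?B \<union> ?C)"
    unfolding S by (rule card_Un_disjoint) (use k in auto)
  also have "card (?B \<union> ?C) = card ?B + card ?C"
    by (rule card_Un_disjoint) (use k in auto)
  also have "card ?A = card ?I" by (rule card_image) (use k in \<open>auto simp: inj_on_def\<close>)
  also have "card ?B = card ?I" by (rule card_image) (use k in \<open>auto simp: inj_on_def\<close>)
  also have "card ?C = card ?J"
    by (rule card_image) (use k in \<open>auto simp: inj_on_def\<close>)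
  also have "int (card ?I + (card ?I + card ?J)) = 8 * int k - 6"
    using k by (simp add: card_cartesian_product nat_diff_distrib)
  finally show ?thesis .
qed

lemma antisymmetric_count:
  assumes n: "n = k^2" and k: "k > 0"
  shows "(\<Sum>v\<in>Vset n (\<lambda>(a, b, c, d). even (a - d) \<and> even (b - c)).
     antisymmetric_term v) = 8"
proof -
  let ?P = "\<lambda>(a::int, b::int, c::int, d::int). even (a - d) \<and> even (b - c)"
  let ?f = "antisymmetric_term"
  have n0: "n > 0" using n k by simp
  have root: "b = int k \<or> b = - int k" if "b * b = int n" for b
    using that n by (metis of_nat_power power2_eq_iff power2_eq_square)
  have S: "{v \<in> Vset n ?P. ?f v \<noteq> 0} = {(0, int k, - int k, 0), (0, - int k, int k, 0)}"
  proof (intro set_eqI iffI)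
    fix v assume v: "v \<in> {v \<in> Vset n ?P. ?f v \<noteq> 0}"
    obtain a b c d where abcd: "v = (a, b, c, d)" by (cases v)
    have "?f v \<noteq> 0" using v by blast
    then have h: "a = 0" "d = 0" "c = - b" unfolding abcd on_quad_simp by (simp_all split: if_splits)
    have "\<bar>qdet v\<bar> = int n" using v by (simp add: Vset_def)
    then have "b * b = int n" by (simp add: abcd h)
    from root[OF this] show "v \<in> {(0, int k, - int k, 0), (0, - int k, int k, 0)}"
      by (auto simp: abcd h)
  next
    fix v :: quad assume "v \<in> {(0, int k, - int k, 0), (0, - int k, int k, 0)}"
    then have "v = (0, int k, - int k, 0) \<or> v = (0, - int k, - (- int k), 0)" by simp
    then obtain b where b: "b = int k \<or> b = - int k" and v: "v = (0, b, - b, 0)" by blast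
    then have "gate 0 b (- b) 0" using gate_symmetric(4)[of b] k by auto
    moreover have "b * b = int n" using b n by (auto simp: power2_eq_square)
    ultimately show "v \<in> {v \<in> Vset n ?P. ?f v \<noteq> 0}" by (simp add: v Vset_def)
  qed
  have "sum ?f (Vset n ?P) = sum ?f {v \<in> Vset n ?P. ?f v \<noteq> 0}"
    by (rule sum.mono_neutral_right) (auto simp: finite_Vset n0)
  also have "\<dots> = 8" unfolding S using k by simp
  finally show ?thesis .
qed

lemma symmetric_count_nonsquare:
  assumes n: "n > 0" and ns: "\<And>k. n \<noteq> k^2"
  shows "(\<Sum>v\<in>Vset n P. symmetric_term v) = 0"
    "(\<Sum>v\<in>Vset n P. antisymmetric_term v) = 0"
proof -
  have ns': "b * b \<noteq> int n" for b :: int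
  proof
    assume "b * b = int n"
    then have "n = (nat \<bar>b\<bar>)^2" by (metis abs_mult_self_eq nat_int nat_mult_distrib abs_ge_zero power2_eq_square)
    with ns show False by blast
  qed
  show "(\<Sum>v\<in>Vset n P. antisymmetric_term v) = 0"
    using ns' by (intro sum.neutral) (auto simp: Vset_def on_quad_def)
  have "\<not> (b = c \<and> (a = 0 \<or> d = 0 \<or> a+b+c+d = 0))" if "\<bar>a * d - b * c\<bar> = int n" for a b c d :: int
  proof
    assume h: "b = c \<and> (a = 0 \<or> d = 0 \<or> a+b+c+d = 0)"
    consider "a = 0" | "d = 0" | "d = -a-2*b" using h by fastforce
    then show False
    proof cases
      case 3
      have "a * d - b * c = - ((a+b) * (a+b))" using h by (simp add: 3 algebra_simps)
      then show False using that ns'[of "a+b"] by simp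
    qed (use that h ns' in auto)
  qed
  note neg = this
  show "(\<Sum>v\<in>Vset n P. symmetric_term v) = 0"
  proof (intro sum.neutral ballI)
    fix v assume v: "v \<in> Vset n P"
    obtain a b c d where abcd: "v = (a, b, c, d)" by (cases v)
    have "\<bar>a * d - b * c\<bar> = int n" using v by (simp add: Vset_def abcd)
    from neg[OF this] show "symmetric_term v = 0"
      by (simp only: abcd on_quad_simp if_False)
  qed
qed

lemma sector_count_even:
  assumes n: "n > 0"
  shows "2 * (\<Sum>v\<in>Dset n (\<lambda>(a, b, c, d). even (a - d) \<and> even (b - c)). on_quad sector v) =
    8 * int (co_sum n (\<lambda>x y. even (x + y))) + 4 * int (co_sum n (\<lambda>x y. even x))
     - 16 * int (co_sum n (\<lambda>x y. x \<le> y \<and> even (x + y)))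
     + (if \<exists>k. n = k^2 then 8 * int (THE k. n = k^2) + 2 else 0)"
proof -
  let ?P = "\<lambda>(a::int, b::int, c::int, d::int). even (a - d) \<and> even (b - c)"
  have P: "mod2_inv ?P" unfolding mod2_inv_def by auto
  let ?s = "\<Sum>v\<in>Vset n ?P. symmetric_term v"
  let ?t = "\<Sum>v\<in>Vset n ?P. antisymmetric_term v"
  \<comment> \<open>For n = k^2 the two terms are 8k - 6 and 8.\<close>
  have st: "?s + ?t = (if \<exists>k. n = k^2 then 8 * int (THE k. n = k^2) + 2 else 0)"
  proof (cases "\<exists>k. n = k^2")
    case True
    then obtain k where k: "n = k^2" by blast
    then have "(THE k. n = k^2) = k" by (intro the_equality) auto
    moreover have "k > 0" using k n by auto
    ultimately show ?thesis using True symmetric_count[OF k] antisymmetric_count[OF k] by simp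
  next
    case False
    then show ?thesis using symmetric_count_nonsquare[OF n] by simp
  qed
  let ?F = "co_sum n (\<lambda>x y. x \<le> y \<and> even (x + y))" and ?B = "co_sum n (\<lambda>x y. even (x + y))"
  let ?S = "\<lambda>b c. \<not> lt_abs c b \<and> even (b - c)" and ?E = "\<lambda>b c::int. even (b - c)"
  have SF: "(\<Sum>x | x dvd n \<and> ?S (int x) (int (n div x)). m * x) = m * ?F" for m
    unfolding sum_distrib_left by (rule sum.cong) (auto simp: lt_abs_of_nat not_less)
  have SB: "(\<Sum>x | x dvd n \<and> ?E (int x) (int (n div x)). m * x) = m * ?B" for m
    unfolding sum_distrib_left by (rule sum.cong) auto
  have "cusp_count n (\<lambda>b c d. ?S b c \<and> even d = True) = 2 * ?F"
    unfolding SF[symmetric] by (rule cusp_count_parity[OF n]) (auto simp: lt_abs_uminus)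
  moreover have "cusp_count n (\<lambda>b c d. ?S b c) = 4 * ?F"
    unfolding SF[symmetric] by (rule cusp_count_all[OF n]) (auto simp: lt_abs_uminus)
  moreover have "cusp_count n (\<lambda>b c d. ?E b c \<and> even d = True) = 2 * ?B"
    unfolding SB[symmetric] by (rule cusp_count_parity[OF n]) auto
  moreover have "cusp_count n (\<lambda>b c d. ?E b c \<and> even d = even b) = 2 * ?B"
    unfolding SB[symmetric] by (rule cusp_count_parity[OF n]) auto
  \<comment> \<open>At the third cusp both b + c + d and c + d must be even, that is, b is even and
    d has the parity of c.\<close>
  moreover have "cusp_count n (\<lambda>b c d. even b \<and> even d = even c) = 2 * co_sum n (\<lambda>x y. even x)"
  proof -
    have "cusp_count n (\<lambda>b c d. even b \<and> even d = even c) = (\<Sum>x | x dvd n \<and> even (int x). 2 * x)"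
      by (rule cusp_count_parity[OF n]) auto
    then show ?thesis by (simp add: sum_distrib_left)
  qed
  moreover have
    "(\<lambda>b c (d::int). \<not> lt_abs c b \<and> even (0 - d) \<and> even (b - c)) = (\<lambda>b c d. ?S b c \<and> even d = True)"
    "(\<lambda>b c (d::int). \<not> lt_abs c b \<and> even (b + c + d - 0) \<and> even (- c - - b)) = (\<lambda>b c d. ?S b c \<and> even d = True)"
    "(\<lambda>b c d. \<not> lt_abs c b \<and> even (d - (b+c+d)) \<and> even (-(c+d) - -(b+d))) = (\<lambda>b c (d::int). ?S b c)"
    "(\<lambda>b c (d::int). even (0 - d) \<and> even (b - c)) = (\<lambda>b c d::int. ?E b c \<and> even d = True)"
    "(\<lambda>b c (d::int). even (- c - b) \<and> even (-(b+d) - 0)) = (\<lambda>b c d::int. ?E b c \<and> even d = even b)"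
    "(\<lambda>b c (d::int). even (c - -(b+d)) \<and> even (d - - c)) = (\<lambda>b c d::int. even b \<and> even d = even c)"
    by (intro ext; auto)+
  moreover note sector_count[OF n P, unfolded prod.case]
  ultimately have "2 * (\<Sum>v\<in>Dset n ?P. on_quad sector v) - ?s - ?t
      + 2 * (int (2 * ?F) + int (2 * ?F) + int (4 * ?F)) =
      2 * (int (2 * ?B) + int (2 * ?B) + int (2 * co_sum n (\<lambda>x y. even x)))"
    by (simp only:)
  then show ?thesis using st by simp
qed

section \<open>Class numbers and sums of products of odd numbers\<close>

definition odd_triples :: "int \<Rightarrow> (int \<times> int \<times> int) set" where
  "odd_triples m = {(p, q, r). odd p \<and> odd q \<and> odd r \<and> p > 0 \<and> q > 0 \<and> r > 0 \<and> p * q + q * r + r * p = m}"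

section \<open>Equivalence of forms by explicit substitutions\<close>

fun act :: "int \<Rightarrow> int \<Rightarrow> int \<Rightarrow> int \<Rightarrow> bqf \<Rightarrow> bqf" where
  "act p q r s (a, b, c) = (a*p^2 + b*p*r + c*r^2, 2*a*p*q + b*(p*s + q*r) + 2*c*r*s, a*q^2 + b*q*s + c*s^2)"

lemma bqf_eval_act: "bqf_eval (act p q r s f) x y = bqf_eval f (p * x + q * y) (r * x + s * y)"
  by (cases f) (simp add: power2_eq_square algebra_simps)

lemma bqf_discr_act: "bqf_discr (act p q r s f) = (p * s - q * r)^2 * bqf_discr f"
  by (cases f) (simp add: power2_eq_square algebra_simps)

lemma act_equiv:
  assumes f: "f \<in> pos_def_forms D" and det: "p * s - q * r = 1"
  shows "(f, act p q r s f) \<in> bqf_equiv D"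
proof -
  have "bqf_eval f (p * x + q * y) (r * x + s * y) > 0" if "(x, y) \<noteq> (0, 0)" for x y
  proof -
    have "s * (p * x + q * y) - q * (r * x + s * y) = (p * s - q * r) * x"
      "p * (r * x + s * y) - r * (p * x + q * y) = (p * s - q * r) * y" by (simp_all add: algebra_simps)
    then have "(p * x + q * y, r * x + s * y) \<noteq> (0, 0)" using that det by auto
    then show ?thesis using f by (simp add: pos_def_forms_def bqf_pos_def_def)
  qed
  then have "act p q r s f \<in> pos_def_forms D"
    using f det by (simp add: pos_def_forms_def bqf_pos_def_def bqf_discr_act bqf_eval_act)
  then show ?thesis using f det bqf_eval_act unfolding bqf_equiv_def by blast
qed

lemma equiv_bqf_equiv: "equiv (pos_def_forms D) (bqf_equiv D)"
proof (rule equivI)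
  show "bqf_equiv D \<subseteq> pos_def_forms D \<times> pos_def_forms D" by (auto simp: bqf_equiv_def)
  show "refl_on (pos_def_forms D) (bqf_equiv D)"
  proof (rule refl_onI)
    fix f assume "f \<in> pos_def_forms D"
    moreover have "1 * 1 - 0 * 0 = (1::int) \<and> (\<forall>x y. bqf_eval f x y = bqf_eval f (1 * x + 0 * y) (0 * x + 1 * y))" by simp
    ultimately show "(f, f) \<in> bqf_equiv D" unfolding bqf_equiv_def by blast
  qed
  show "sym (bqf_equiv D)"
  proof (rule symI)
    fix f g assume "(f, g) \<in> bqf_equiv D"
    then obtain p q r s where h: "f \<in> pos_def_forms D" "g \<in> pos_def_forms D" "p * s - q * r = 1"
      "\<And>x y. bqf_eval g x y = bqf_eval f (p * x + q * y) (r * x + s * y)" by (auto simp: bqf_equiv_def)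
    have "bqf_eval f x y = bqf_eval g (s * x + - q * y) (- r * x + p * y)" for x y
    proof -
      have "p * (s * x + - q * y) + q * (- r * x + p * y) = (p * s - q * r) * x"
        "r * (s * x + - q * y) + s * (- r * x + p * y) = (p * s - q * r) * y" by (simp_all add: algebra_simps)
      then show ?thesis using h(3,4) by simp
    qed
    moreover have "s * p - (- q) * (- r) = 1" using h(3) by (simp add: algebra_simps)
    ultimately show "(g, f) \<in> bqf_equiv D" using h(1,2) unfolding bqf_equiv_def by blast
  qed
  show "trans (bqf_equiv D)"
  proof (rule transI)
    fix f g h assume "(f, g) \<in> bqf_equiv D" "(g, h) \<in> bqf_equiv D"
    then obtain p q r s p' q' r' s' where *: "f \<in> pos_def_forms D" "h \<in> pos_def_forms D"
      "p * s - q * r = 1" "\<And>x y. bqf_eval g x y = bqf_eval f (p * x + q * y) (r * x + s * y)"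
      "p' * s' - q' * r' = 1" "\<And>x y. bqf_eval h x y = bqf_eval g (p' * x + q' * y) (r' * x + s' * y)"
      by (auto simp: bqf_equiv_def)
    have "bqf_eval h x y = bqf_eval f ((p*p' + q*r') * x + (p*q' + q*s') * y) ((r*p' + s*r') * x + (r*q' + s*s') * y)" for x y
      unfolding *(4,6) by (simp add: algebra_simps)
    moreover have "(p*p' + q*r') * (r*q' + s*s') - (p*q' + q*s') * (r*p' + s*r') = (p*s - q*r) * (p'*s' - q'*r')"
      by (simp add: algebra_simps)
    then have "(p*p' + q*r') * (r*q' + s*s') - (p*q' + q*s') * (r*p' + s*r') = 1" using *(3,5) by simp
    ultimately show "(f, h) \<in> bqf_equiv D" using *(1,2) unfolding bqf_equiv_def by blast
  qed
qed

section \<open>Obtuse forms and their Selling parameters\<close>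

fun triple_form :: "int \<times> int \<times> int \<Rightarrow> bqf" where
  "triple_form (p, q, r) = ((p + r) div 2, - r, (q + r) div 2)"

lemma triple_form_eval:
  assumes "(p, q, r) \<in> odd_triples m"
  shows "2 * bqf_eval (triple_form (p, q, r)) x y = p * x^2 + q * y^2 + r * (x - y)^2"
proof -
  have e: "2 * ((p + r) div 2) = p + r" "2 * ((q + r) div 2) = q + r"
    using assms by (auto simp: odd_triples_def)
  have "2 * bqf_eval (triple_form (p, q, r)) x y = (2 * ((p + r) div 2)) * x^2 - 2 * r * x * y + (2 * ((q + r) div 2)) * y^2"
    by (simp add: algebra_simps)
  then show ?thesis unfolding e by (simp add: power2_eq_square algebra_simps)
qed

lemma triple_form_pos_def:
  assumes t: "t \<in> odd_triples m"
  shows "triple_form t \<in> pos_def_forms (- m)"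
proof -
  obtain p q r where pqr: "t = (p, q, r)" by (cases t)
  have h: "p > 0" "q > 0" "r > 0" "p * q + q * r + r * p = m" "odd p" "odd q" "odd r"
    using t by (auto simp: odd_triples_def pqr)
  have "bqf_eval (triple_form t) x y > 0" if "(x, y) \<noteq> (0, 0)" for x y
  proof -
    have "p * x^2 \<ge> 0" "q * y^2 \<ge> 0" "r * (x - y)^2 \<ge> 0" using h by simp_all
    moreover have "p * x^2 > 0 \<or> q * y^2 > 0" using that h by auto
    ultimately have "p * x^2 + q * y^2 + r * (x - y)^2 > 0" by linarith
    moreover have "2 * bqf_eval (triple_form t) x y = p * x^2 + q * y^2 + r * (x - y)^2"
      unfolding pqr by (rule triple_form_eval) (use t in \<open>simp add: pqr\<close>)
    ultimately show ?thesis by simp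
  qed
  moreover have "bqf_discr (triple_form t) = - m"
  proof -
    have e: "2 * ((p + r) div 2) = p + r" "2 * ((q + r) div 2) = q + r" using h by auto
    have "4 * ((p + r) div 2) * ((q + r) div 2) = (2 * ((p + r) div 2)) * (2 * ((q + r) div 2))" by simp
    then show ?thesis unfolding e using h(4) by (simp add: pqr power2_eq_square algebra_simps)
  qed
  ultimately show ?thesis by (simp add: pos_def_forms_def bqf_pos_def_def)
qed

text \<open>For odd m the middle coefficient b is odd, and then so are all three parameters.
  Positivity comes from 2a + b \<ge> -b > 0 and likewise for c.\<close>

lemma obtuse_form_triple:
  assumes f: "(a, b, c) \<in> pos_def_forms (- m)" and m: "odd m" and b: "b < 0" "- b \<le> a" "- b \<le> c"
  shows "(2 * a + b, 2 * c + b, - b) \<in> odd_triples m" "triple_form (2 * a + b, 2 * c + b, - b) = (a, b, c)"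
proof -
  have D: "b^2 - 4 * a * c = - m" using f by (simp add: pos_def_forms_def)
  have "odd b"
  proof
    assume "even b"
    then have "even (b^2 - 4 * a * c)" by simp
    then show False using D m by simp
  qed
  moreover have "(2*a+b) * (2*c+b) + (2*c+b) * (-b) + (-b) * (2*a+b) = m"
    using D by (simp add: power2_eq_square algebra_simps)
  ultimately show "(2 * a + b, 2 * c + b, - b) \<in> odd_triples m" using b by (simp add: odd_triples_def)
  show "triple_form (2 * a + b, 2 * c + b, - b) = (a, b, c)" by simp
qed

text \<open>In a form of the class with a + c minimal no shear lowers a + c, so |b| \<le> a and |b|
  \<le> c. A quarter turn makes b negative.\<close>

lemma form_has_triple:
  assumes f: "f \<in> pos_def_forms (- m)" and m: "odd m"
  shows "\<exists>t\<in>odd_triples m. (f, triple_form t) \<in> bqf_equiv (- m)"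
proof -
  let ?E = "bqf_equiv (- m)"
  note E = equiv_bqf_equiv[of "- m"]
  have trans: "(f, h) \<in> ?E" if "(f, g) \<in> ?E" "(g, h) \<in> ?E" for g h
    using E that by (meson equivE transE)
  define w :: "bqf \<Rightarrow> nat" where "w = (\<lambda>(a, b, c). nat (a + c))"
  have "(f, f) \<in> ?E" using E f by (meson equivE refl_onD)
  then obtain g where g: "(f, g) \<in> ?E" and min: "\<And>h. (f, h) \<in> ?E \<Longrightarrow> w g \<le> w h"
    using ex_has_least_nat[of "\<lambda>g. (f, g) \<in> ?E" f w] by blast
  obtain a b c where abc: "g = (a, b, c)" by (cases g)
  have gP: "(a, b, c) \<in> pos_def_forms (- m)" using g by (auto simp: bqf_equiv_def abc)
  have pos: "a > 0" "c > 0" if "(a, b, c) \<in> pos_def_forms (- m)" for a b c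
  proof -
    have "bqf_eval (a, b, c) 1 0 > 0" "bqf_eval (a, b, c) 0 1 > 0"
      using that by (auto simp: pos_def_forms_def bqf_pos_def_def simp del: bqf_eval.simps)
    then show "a > 0" "c > 0" by simp_all
  qed
  have le: "a + c \<le> a' + c'" if "((a, b, c), (a', b', c')) \<in> ?E" for a' b' c'
  proof -
    have "w g \<le> w (a', b', c')" using that trans[OF g] min by (simp add: abc)
    moreover have "(a', b', c') \<in> pos_def_forms (- m)" using that by (auto simp: bqf_equiv_def)
    ultimately show ?thesis using pos[of a' b' c'] by (simp add: w_def abc)
  qed
  \<comment> \<open>The instances are listed in the order p, s, q, r: the shears by 1 and -1 in each
    of the two variables.\<close>
  have "- b \<le> a" "b \<le> a" "- b \<le> c" "b \<le> c"
    using le[of "a" "2*a+b" "a+b+c"] act_equiv[OF gP, of 1 1 1 0] le[of "a" "-2*a+b" "a-b+c"] act_equiv[OF gP, of 1 1 "-1" 0]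
      le[of "a+b+c" "b+2*c" "c"] act_equiv[OF gP, of 1 1 0 1] le[of "a-b+c" "b-2*c" "c"] act_equiv[OF gP, of 1 1 0 "-1"]
    by (simp_all add: algebra_simps)
  moreover have "b \<noteq> 0"
  proof
    assume "b = 0"
    then have "m = 4 * a * c" using gP by (simp add: pos_def_forms_def)
    then show False using m by simp
  qed
  ultimately consider "b < 0" "- b \<le> a" "- b \<le> c" | "- b < 0" "- (- b) \<le> c" "- (- b) \<le> a" by linarith
  then show ?thesis
  proof cases
    case 1
    from obtuse_form_triple[OF gP m this] g show ?thesis by (metis abc)
  next
    case 2
    have ge: "((a, b, c), (c, - b, a)) \<in> ?E" using act_equiv[OF gP, of 0 0 "-1" 1] by simp
    then have "(c, - b, a) \<in> pos_def_forms (- m)" by (auto simp: bqf_equiv_def)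
    from obtuse_form_triple[OF this m 2] trans[OF g] ge show ?thesis by (metis abc)
  qed
qed

lemma eisenstein_norm_pos:
  fixes x y :: int
  assumes "(x, y) \<noteq> (0, 0)"
  shows "x^2 + x * y + y^2 \<ge> 1"
proof -
  define A B where "A = (2 * x + y)^2" and "B = 3 * y^2"
  have "4 * (x^2 + x * y + y^2) = A + B" by (simp add: A_def B_def power2_eq_square algebra_simps)
  moreover have "A > 0 \<or> B > 0" using assms by (auto simp: A_def B_def)
  moreover have "A \<ge> 0" "B \<ge> 0" by (simp_all add: A_def B_def)
  ultimately have "4 * (x^2 + x * y + y^2) > 0" by linarith
  then show ?thesis by simp
qed

lemma eisenstein_units:
  fixes x y :: int
  assumes "x^2 + x * y + y^2 = 1"
  shows "(x, y) \<in> {(1, 0), (-1, 0), (0, 1), (0, -1), (1, -1), (-1, 1)}"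
proof -
  have bound: "\<bar>y\<bar> \<le> 1" if "x^2 + x * y + y^2 = 1" for x y :: int
  proof (rule ccontr)
    assume "\<not> \<bar>y\<bar> \<le> 1"
    then have "2 * 2 \<le> \<bar>y\<bar> * \<bar>y\<bar>" by (intro mult_mono) auto
    moreover define A where "A = (2 * x + y)^2"
    have "4 * (x^2 + x * y + y^2) = A + 3 * (\<bar>y\<bar> * \<bar>y\<bar>)" by (simp add: A_def power2_eq_square algebra_simps)
    moreover have "A \<ge> 0" by (simp add: A_def)
    ultimately have "4 * (x^2 + x * y + y^2) \<ge> 12" by linarith
    then show False using that by simp
  qed
  have "\<bar>y\<bar> \<le> 1" "\<bar>x\<bar> \<le> 1" using bound[of x y] bound[of y x] assms by (simp_all add: algebra_simps)
  then have "x \<in> {-1, 0, 1}" "y \<in> {-1, 0, 1}" by auto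
  then show ?thesis using assms by auto
qed

text \<open>The six lattice vectors attached to the superbase of the second form have total norm at least that
  of the first, because each of the three linear functionals takes a nonzero value on them.\<close>

lemma triple_sum_le:
  assumes t: "(p, q, r) \<in> odd_triples m" and t': "(p', q', r') \<in> odd_triples m" and det: "P * S - Q * R = (1::int)"
    and e: "\<And>x y. bqf_eval (triple_form (p', q', r')) x y = bqf_eval (triple_form (p, q, r)) (P * x + Q * y) (R * x + S * y)"
  shows "p' + r' = p * P^2 + q * R^2 + r * (P - R)^2" "q' + r' = p * Q^2 + q * S^2 + r * (Q - S)^2"
    "p + q + r \<le> p' + q' + r'"
    "p' + q' + r' = p + q + r \<Longrightarrow> P^2 + P*Q + Q^2 = 1 \<and> R^2 + R*S + S^2 = 1 \<and> (P-R)^2 + (P-R)*(Q-S) + (Q-S)^2 = 1"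
proof -
  have ev: "p' * x^2 + q' * y^2 + r' * (x - y)^2 =
      p * (P*x+Q*y)^2 + q * (R*x+S*y)^2 + r * ((P*x+Q*y) - (R*x+S*y))^2" for x y
    using e[of x y] triple_form_eval[OF t, of "P*x+Q*y" "R*x+S*y"] triple_form_eval[OF t', of x y] by simp
  show 1: "p' + r' = p * P^2 + q * R^2 + r * (P - R)^2" using ev[of 1 0] by simp
  show 2: "q' + r' = p * Q^2 + q * S^2 + r * (Q - S)^2" using ev[of 0 1] by simp
  have 3: "p' + q' = p * (P + Q)^2 + q * (R + S)^2 + r * ((P+Q) - (R+S))^2" using ev[of 1 1] by simp
  let ?u = "P^2 + P*Q + Q^2" and ?v = "R^2 + R*S + S^2" and ?w = "(P-R)^2 + (P-R)*(Q-S) + (Q-S)^2"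
  have "2 * (p' + q' + r') = 2 * (p * ?u + q * ?v + r * ?w)"
  proof -
    have "2 * (p' + q' + r') = (p' + r') + (q' + r') + (p' + q')" by simp
    then show ?thesis unfolding 1 2 3 by (simp add: power2_eq_square algebra_simps)
  qed
  then have s: "p' + q' + r' = p * ?u + q * ?v + r * ?w" by simp
  have pos: "p > 0" "q > 0" "r > 0" using t by (auto simp: odd_triples_def)
  have "?u \<ge> 1" by (rule eisenstein_norm_pos) (use det in auto)
  moreover have "?v \<ge> 1" by (rule eisenstein_norm_pos) (use det in auto)
  moreover have "?w \<ge> 1" by (rule eisenstein_norm_pos) (use det in \<open>auto simp: algebra_simps\<close>)
  ultimately have ge: "p * (?u - 1) \<ge> 0" "q * (?v - 1) \<ge> 0" "r * (?w - 1) \<ge> 0" using pos by simp_all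
  have d: "p' + q' + r' - (p + q + r) = p * (?u - 1) + q * (?v - 1) + r * (?w - 1)" unfolding s by (simp add: algebra_simps)
  show "p + q + r \<le> p' + q' + r'" using ge d by linarith
  assume "p' + q' + r' = p + q + r"
  then have "p * (?u - 1) = 0 \<and> q * (?v - 1) = 0 \<and> r * (?w - 1) = 0" using ge d by linarith
  then have z: "p * (?u - 1) = 0" "q * (?v - 1) = 0" "r * (?w - 1) = 0" by (rule conjunct1, rule conjunct1[OF conjunct2], rule conjunct2[OF conjunct2])
  have c: "x = 1" if "z * (x - 1) = 0" "z > 0" for x z :: int using that by simp
  show "?u = 1 \<and> ?v = 1 \<and> ?w = 1" by (intro conjI c[OF z(1) pos(1)] c[OF z(2) pos(2)] c[OF z(3) pos(3)])
qed

text \<open>\<open>triple_sum_le\<close> in both directions makes the parameter sums equal, so (P,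
  Q), (R, S) and their difference are Eisenstein units. Determinant 1 leaves the powers of one
  rotation of order 6; as -1 acts trivially on forms, three cyclic shifts remain.\<close>

lemma triple_form_equiv_imp:
  assumes t: "(p, q, r) \<in> odd_triples m" and t': "(p', q', r') \<in> odd_triples m"
    and e: "(triple_form (p, q, r), triple_form (p', q', r')) \<in> bqf_equiv (- m)"
  shows "(p', q', r') \<in> {(p, q, r), (q, r, p), (r, p, q)}"
proof -
  have e': "(triple_form (p', q', r'), triple_form (p, q, r)) \<in> bqf_equiv (- m)"
    using equiv_bqf_equiv by (rule equivE) (rule symD[OF _ e])
  obtain P Q R S where det: "P * S - Q * R = 1"
    and ev: "\<And>x y. bqf_eval (triple_form (p', q', r')) x y = bqf_eval (triple_form (p, q, r)) (P * x + Q * y) (R * x + S * y)"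
    using e unfolding bqf_equiv_def by blast
  obtain P' Q' R' S' where det': "P' * S' - Q' * R' = 1"
    and ev': "\<And>x y. bqf_eval (triple_form (p, q, r)) x y = bqf_eval (triple_form (p', q', r')) (P' * x + Q' * y) (R' * x + S' * y)"
    using e' unfolding bqf_equiv_def by blast
  note A = triple_sum_le[OF t t' det ev]
  have sum: "p' + q' + r' = p + q + r" using A(3) triple_sum_le(3)[OF t' t det' ev'] by linarith
  have n: "P^2 + P*Q + Q^2 = 1" "R^2 + R*S + S^2 = 1" "(P-R)^2 + (P-R)*(Q-S) + (Q-S)^2 = 1" using A(4)[OF sum] by blast+
  have PQ: "(P, Q) \<in> {(1, 0), (-1, 0), (0, 1), (0, -1), (1, -1), (-1, 1)}" by (rule eisenstein_units[OF n(1)])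
  have RS: "(R, S) \<in> {(1, 0), (-1, 0), (0, 1), (0, -1), (1, -1), (-1, 1)}" by (rule eisenstein_units[OF n(2)])
  have "(P-R, Q-S) \<in> {(1, 0), (-1, 0), (0, 1), (0, -1), (1, -1), (-1, 1)}" by (rule eisenstein_units[OF n(3)])
  with PQ RS det have "(P, Q, R, S) \<in> {(1, 0, 0, 1), (-1, 0, 0, -1), (0, 1, -1, 1), (0, -1, 1, -1), (1, -1, 1, 0), (-1, 1, -1, 0)}"
    by (elim insertE emptyE Pair_inject) simp_all
  then have "p' + r' = p + r \<and> q' + r' = q + r \<or> p' + r' = p + q \<and> q' + r' = p + r \<or> p' + r' = q + r \<and> q' + r' = p + q"
    using A(1,2) by (elim insertE emptyE Pair_inject) simp_all
  then have "p' = p \<and> q' = q \<and> r' = r \<or> p' = q \<and> q' = r \<and> r' = p \<or> p' = r \<and> q' = p \<and> r' = q"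
    using sum by linarith
  then show ?thesis by simp
qed

lemma triple_form_rotate:
  assumes "(p, q, r) \<in> odd_triples m"
  shows "(q, r, p) \<in> odd_triples m" "(triple_form (p, q, r), triple_form (q, r, p)) \<in> bqf_equiv (- m)"
proof -
  show "(q, r, p) \<in> odd_triples m" using assms by (auto simp: odd_triples_def algebra_simps)
  have e: "2 * ((p + r) div 2) = p + r" "2 * ((q + r) div 2) = q + r" "2 * ((q + p) div 2) = q + p" "2 * ((r + p) div 2) = r + p"
    using assms by (auto simp: odd_triples_def)
  \<comment> \<open>Substituting (x - y, x) for (x, y) turns x^2, y^2, (x - y)^2 into (x - y)^2,
    x^2, y^2.\<close>
  have act: "act 1 (-1) 1 0 (triple_form (p, q, r)) = triple_form (q, r, p)"
    using e by (simp add: power2_eq_square)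
  have "1 * 0 - (-1) * 1 = (1::int)" by simp
  from act_equiv[OF triple_form_pos_def[OF assms] this] show "(triple_form (p, q, r), triple_form (q, r, p)) \<in> bqf_equiv (- m)"
    unfolding act .
qed

lemma finite_odd_triples: "finite (odd_triples m)"
proof (rule finite_subset)
  show "odd_triples m \<subseteq> {0..m} \<times> {0..m} \<times> {0..m}"
  proof
    fix t assume "t \<in> odd_triples m"
    then obtain p q r where t: "t = (p, q, r)" and h: "p \<ge> 1" "q \<ge> 1" "r \<ge> 1" "p * q + q * r + r * p = m"
      by (auto simp: odd_triples_def)
    have "p * 1 \<le> p * q" "q * 1 \<le> q * r" "r * 1 \<le> r * p" using h by (intro mult_left_mono; simp)+
    then have "p \<le> m" "q \<le> m" "r \<le> m" using h by linarith+
    then show "t \<in> {0..m} \<times> {0..m} \<times> {0..m}" using h(1-3) by (auto simp: t)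
  qed
qed simp

text \<open>The triples of a class are the cyclic shifts of one triple: three of them, or a single
  one if p = q = r. The latter happens exactly for the multiples of x^2 + x y + y^2, of weight 1/3.
  Multiples of x^2 + y^2 have discriminant divisible by 4 and do not occur.\<close>

theorem hurwitz_class_number_odd:
  assumes m: "odd m" "m > 0"
  shows "3 * hurwitz_class_number m = real (card (odd_triples m))"
proof -
  let ?E = "bqf_equiv (- m)" and ?F = "pos_def_forms (- m)" and ?T = "odd_triples m"
  note E = equiv_bqf_equiv[of "- m"]
  define K where "K t = ?E `` {triple_form t}" for t
  have KK: "K t = K t' \<longleftrightarrow> (triple_form t, triple_form t') \<in> ?E" if "t \<in> ?T" "t' \<in> ?T" for t t'
    unfolding K_def using eq_equiv_class_iff[OF E] triple_form_pos_def that by blast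
  have quot: "?F // ?E = K ` ?T"
  proof (intro set_eqI iffI)
    fix C assume "C \<in> ?F // ?E"
    then obtain f where f: "f \<in> ?F" "C = ?E `` {f}" by (auto elim: quotientE)
    from form_has_triple[OF f(1) m(1)] obtain t where t: "t \<in> ?T" "(f, triple_form t) \<in> ?E" by blast
    then have "C = K t" unfolding K_def f(2) using equiv_class_eq[OF E] by blast
    then show "C \<in> K ` ?T" using t by blast
  next
    fix C assume "C \<in> K ` ?T"
    then show "C \<in> ?F // ?E" unfolding K_def using triple_form_pos_def by (auto intro: quotientI)
  qed
  have fiber: "3 * class_weight (K t) = real (card {t' \<in> ?T. K t' = K t})" if t: "t \<in> ?T" for t
  proof -
    obtain p q r where pqr: "t = (p, q, r)" by (cases t)
    have t0: "(p, q, r) \<in> ?T" using t by (simp add: pqr)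
    note r1 = triple_form_rotate[OF t0]
    note r2 = triple_form_rotate[OF r1(1)]
    have K1: "K (q, r, p) = K (p, q, r)" "K (r, p, q) = K (p, q, r)"
      using KK[OF t0 r1(1)] KK[OF r1(1) r2(1)] r1(2) r2(2) by auto
    have fib: "{t' \<in> ?T. K t' = K t} = {(p, q, r), (q, r, p), (r, p, q)}"
    proof (intro set_eqI iffI)
      fix t' assume t': "t' \<in> {t' \<in> ?T. K t' = K t}"
      obtain p' q' r' where pqr': "t' = (p', q', r')" by (cases t')
      have "(triple_form (p, q, r), triple_form (p', q', r')) \<in> ?E"
        using KK[OF t0, of t'] t' by (auto simp: pqr pqr')
      then show "t' \<in> {(p, q, r), (q, r, p), (r, p, q)}"
        using triple_form_equiv_imp[OF t0, of p' q' r'] t' by (simp add: pqr')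
    next
      fix t' assume "t' \<in> {(p, q, r), (q, r, p), (r, p, q)}"
      then show "t' \<in> {t' \<in> ?T. K t' = K t}" using t0 r1(1) r2(1) K1 by (auto simp: pqr)
    qed
    have no2: "\<not> (\<exists>k. (k, 0, k) \<in> K t)"
    proof
      assume "\<exists>k. (k, 0, k) \<in> K t"
      then obtain k where "(k, 0, k) \<in> ?F" by (auto simp: K_def bqf_equiv_def)
      then have "m = 4 * k * k" by (simp add: pos_def_forms_def)
      then show False using m by simp
    qed
    have iff3: "(\<exists>k. (k, k, k) \<in> K t) \<longleftrightarrow> p = q \<and> q = r"
    proof
      assume "p = q \<and> q = r"
      then have "triple_form t = (r, - r, r)" by (simp add: pqr)
      moreover have "(triple_form t, act 1 1 0 1 (triple_form t)) \<in> ?E"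
        using act_equiv[OF triple_form_pos_def[OF t], of 1 1 1 0] by simp
      ultimately have "(r, r, r) \<in> K t" by (simp add: K_def)
      then show "\<exists>k. (k, k, k) \<in> K t" by blast
    next
      assume "\<exists>k. (k, k, k) \<in> K t"
      then obtain k where k: "(triple_form t, (k, k, k)) \<in> ?E" by (auto simp: K_def)
      then have kF: "(k, k, k) \<in> ?F" by (auto simp: bqf_equiv_def)
      then have "3 * (k * k) = m" by (simp add: pos_def_forms_def power2_eq_square)
      moreover have "bqf_eval (k, k, k) 1 0 > 0" using kF by (auto simp: pos_def_forms_def bqf_pos_def_def simp del: bqf_eval.simps)
      ultimately have kT: "(k, k, k) \<in> ?T" using m by (auto simp: odd_triples_def)
      have "((k, k, k), triple_form (k, k, k)) \<in> ?E"
        using act_equiv[OF kF, of 1 1 "-1" 0] by simp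
      then have "(triple_form t, triple_form (k, k, k)) \<in> ?E" using E k by (meson equivE transE)
      then show "p = q \<and> q = r" using triple_form_equiv_imp[OF t0 kT] by (auto simp: pqr)
    qed
    show ?thesis
    proof (cases "p = q \<and> q = r")
      case True
      then show ?thesis unfolding fib class_weight_def using no2 iff3 by simp
    next
      case False
      then have "card {(p, q, r), (q, r, p), (r, p, q)} = 3" by auto
      then show ?thesis unfolding fib class_weight_def using no2 iff3 False by simp
    qed
  qed
  have "card ?T = (\<Sum>C\<in>K ` ?T. card {t' \<in> ?T. K t' = C})"
    using sum.image_gen[OF finite_odd_triples, of "\<lambda>_. 1::nat" m K] by simp
  then have "real (card ?T) = (\<Sum>C\<in>K ` ?T. real (card {t' \<in> ?T. K t' = C}))" by simp
  also have "\<dots> = (\<Sum>C\<in>K ` ?T. 3 * class_weight C)"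
    by (rule sum.cong) (auto simp: fiber)
  finally show ?thesis using m by (simp add: hurwitz_class_number_def quot sum_distrib_left)
qed

section \<open>The theta expansion of the rank generating function\<close>

unbundle fps_syntax

section \<open>q-products and Bailey pairs\<close>

definition eqpoch :: "nat \<Rightarrow> real fps" where "eqpoch n = (\<Prod>j=1..n. 1 - fps_X ^ j)"

definition opoch :: "nat \<Rightarrow> real fps" where "opoch n = (\<Prod>j=1..n. 1 + fps_X ^ j)"

text \<open>With q for \<open>fps_X\<close>, the three products are (q;q)_n, (-q;q)_n and
  (-q^(k+1);q)_n.\<close>

definition opoch_from :: "nat \<Rightarrow> nat \<Rightarrow> real fps" where "opoch_from k n = (\<Prod>j=1..n. 1 + fps_X ^ (k + j))"

lemma eqpoch_0 [simp]: "eqpoch 0 = 1" and eqpoch_Suc: "eqpoch (Suc n) = eqpoch n * (1 - fps_X ^ Suc n)"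
  by (simp_all add: eqpoch_def)

lemma opoch_0 [simp]: "opoch 0 = 1" and opoch_Suc: "opoch (Suc n) = opoch n * (1 + fps_X ^ Suc n)"
  by (simp_all add: opoch_def)

lemma opoch_from_0 [simp]: "opoch_from k 0 = 1"
  and opoch_from_Suc: "opoch_from k (Suc n) = opoch_from k n * (1 + fps_X ^ (k + Suc n))"
  by (simp_all add: opoch_from_def)

lemma poch_nth_0 [simp]: "eqpoch n $ 0 = 1" "opoch n $ 0 = 1" "opoch_from k n $ 0 = 1"
  by (induction n) (simp_all add: eqpoch_Suc opoch_Suc opoch_from_Suc)

lemma fps_unit: "f $ 0 = 1 \<Longrightarrow> f * inverse f = (1 :: real fps)"
  by (simp add: inverse_mult_eq_1')

lemma fps_nonzero_of_nth_0: "f $ 0 = 1 \<Longrightarrow> f \<noteq> (0 :: real fps)"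
  by auto

lemma poch_nonzero [simp]: "eqpoch n \<noteq> 0" "opoch n \<noteq> 0" "opoch_from k n \<noteq> 0"
  "k > 0 \<Longrightarrow> 1 + fps_X ^ k \<noteq> (0 :: real fps)" "k > 0 \<Longrightarrow> 1 - fps_X ^ k \<noteq> (0 :: real fps)"
  by (intro fps_nonzero_of_nth_0; simp)+

lemma opoch_from_shift: "opoch_from k (Suc n) = (1 + fps_X ^ Suc k) * opoch_from (Suc k) n"
  by (induction n) (simp_all add: opoch_from_Suc mult_ac del: power_Suc)

lemma inverse_factor:
  assumes "A = B * u" "u $ 0 = 1"
  shows "inverse B = u * inverse (A :: real fps)"
proof -
  have "u * inverse A = inverse B * (u * inverse u)" by (simp add: assms(1) fps_inverse_mult mult_ac)
  then show ?thesis by (simp add: fps_unit assms(2))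
qed

lemma inverse_eqpoch: "n > 0 \<Longrightarrow> inverse (eqpoch (n - 1)) = (1 - fps_X ^ n) * inverse (eqpoch n)"
  by (rule inverse_factor) (use eqpoch_Suc[of "n - 1"] in \<open>simp_all del: power_Suc\<close>)

text \<open>The kernel of Bailey pairs relative to 1. The cut-off for r > n stands for the
  convention that 1/(q;q)_m is 0 for m < 0.\<close>

definition bailey_coeff :: "nat \<Rightarrow> nat \<Rightarrow> real fps" where
  "bailey_coeff n r = (if r \<le> n then inverse (eqpoch (n - r)) * inverse (eqpoch (n + r)) else 0)"

lemma bailey_coeff_Suc:
  assumes "r \<le> Suc n"
  shows "bailey_coeff n r = (1 - fps_X ^ (Suc n - r)) * (1 - fps_X ^ (Suc n + r)) * bailey_coeff (Suc n) r"
proof (cases "r = Suc n")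
  case True
  then show ?thesis by (simp add: bailey_coeff_def)
next
  case False
  then have r: "r \<le> n" using assms by simp
  have "inverse (eqpoch (n - r)) = (1 - fps_X ^ (Suc n - r)) * inverse (eqpoch (Suc n - r))"
    "inverse (eqpoch (n + r)) = (1 - fps_X ^ (Suc n + r)) * inverse (eqpoch (Suc n + r))"
    using inverse_eqpoch[of "Suc n - r"] inverse_eqpoch[of "Suc n + r"] r by (simp_all del: power_Suc)
  then show ?thesis
    using r by (simp add: bailey_coeff_def mult_ac del: power_Suc)
qed

lemma tri_Suc: "Suc r * (Suc r + 1) div 2 = r * (r + 1) div 2 + Suc r"
  by simp

text \<open>The summand times \<open>1 - X ^ n\<close> is \<open>g r - g (r + 1)\<close>.\<close>

lemma bailey_unit_pair:
  assumes n: "n > 0"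
  shows "bailey_coeff n 0 + (\<Sum>r=1..n. (-1) ^ r * fps_X ^ (r * (r - 1) div 2) * (1 + fps_X ^ r) * bailey_coeff n r) = 0"
proof -
  define g :: "nat \<Rightarrow> real fps" where "g r = (if r \<le> n then (-1) ^ r * fps_X ^ (r * (r - 1) div 2) *
      inverse (eqpoch (n - r)) * inverse (eqpoch (n + r - 1)) else 0)" for r
  let ?t = "\<lambda>r. (-1) ^ r * fps_X ^ (r * (r - 1) div 2) * (1 + fps_X ^ r) * bailey_coeff n r"
  have step: "(1 - fps_X ^ n) * ?t r = g r - g (Suc r)" if r: "r \<in> {1..n}" for r
  proof -
    let ?u = "inverse (eqpoch (n - r))" and ?w = "inverse (eqpoch (n + r))"
    have 1: "inverse (eqpoch (n + r - 1)) = (1 - fps_X ^ (n + r)) * ?w"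
      using inverse_eqpoch[of "n + r"] r by simp
    have tri: "Suc r * (Suc r - 1) div 2 = r * (r - 1) div 2 + r"
    proof -
      have "Suc r * (Suc r - 1) = r * (r - 1) + r * 2" using r by (cases r) (simp_all add: algebra_simps)
      then show ?thesis by (simp only: div_mult_self3[symmetric]) 
    qed
    have 2: "g (Suc r) = - ((-1) ^ r * fps_X ^ (r * (r - 1) div 2) * fps_X ^ r * (1 - fps_X ^ (n - r)) * ?u * ?w)"
    proof (cases "r = n")
      case False
      then have rn: "Suc r \<le> n" using r by simp
      have "inverse (eqpoch (n - Suc r)) = (1 - fps_X ^ (n - r)) * ?u"
        using inverse_eqpoch[of "n - r"] rn by simp
      then have e: "inverse (eqpoch (n - Suc r)) = (1 - fps_X ^ (n - r)) * ?u" .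
      have m: "n + Suc r - 1 = n + r" by simp
      show ?thesis unfolding g_def tri m power_add e using rn by (simp add: mult_ac)
    qed (simp add: g_def)
    have g1: "g r = (-1) ^ r * fps_X ^ (r * (r - 1) div 2) * ?u * ((1 - fps_X ^ (n + r)) * ?w)"
      using r by (simp only: g_def 1) simp
    have x: "fps_X ^ (n + r) = (fps_X ^ n * fps_X ^ r :: real fps)" by (simp add: power_add)
    have y: "fps_X ^ r * fps_X ^ (n - r) = (fps_X ^ n :: real fps)" using r by (simp add: power_add[symmetric])
    have "g r - g (Suc r) = (-1) ^ r * fps_X ^ (r * (r - 1) div 2) * ?u * ?w *
       ((1 - fps_X ^ (n + r)) + (fps_X ^ r - fps_X ^ r * fps_X ^ (n - r)))"
      unfolding 2 g1 by (simp add: algebra_simps)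
    also have "\<dots> = (1 - fps_X ^ n) * ?t r"
      unfolding x y using r by (simp add: bailey_coeff_def algebra_simps)
    finally show ?thesis by simp
  qed
  have telescope: "(\<Sum>r=1..m. g r - g (Suc r)) = g 1 - g (Suc m)" for m
    by (induction m) simp_all
  have "(1 - fps_X ^ n) * (\<Sum>r=1..n. ?t r) = (\<Sum>r=1..n. g r - g (Suc r))"
    by (simp only: sum_distrib_left step cong: sum.cong)
  also have "\<dots> = g 1 - g (Suc n)" by (rule telescope)
  also have "\<dots> = - (inverse (eqpoch (n - 1)) * inverse (eqpoch n))"
    using n by (simp add: g_def)
  also have "inverse (eqpoch (n - 1)) = (1 - fps_X ^ n) * inverse (eqpoch n)"
    using inverse_eqpoch[OF n] .
  finally have "(1 - fps_X ^ n) * (\<Sum>r=1..n. ?t r) = (1 - fps_X ^ n) * (- bailey_coeff n 0)"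
    by (simp add: bailey_coeff_def)
  then have "(\<Sum>r=1..n. ?t r) = - bailey_coeff n 0"
    using mult_left_cancel[OF poch_nonzero(5)[OF n]] by blast
  then show ?thesis by simp
qed

definition alpha_pair :: "nat \<Rightarrow> real fps" where
  "alpha_pair r = (if r = 0 then 1 else 4 * (-1) ^ r * fps_X ^ (r * (r + 1) div 2) * inverse (1 + fps_X ^ r))"

text \<open>The factor (1 + q^N)^2 - (1 - q^(N-r))(1 - q^(N+r)) = q^(N-r) (1 + q^r)^2 turns
  \<open>alpha_pair r\<close> into 4 q^N times the coefficient of the unit pair. By
  \<open>bailey_unit_pair\<close>, (1 + q^N)^2 times the N-th sum is therefore the preceding
  sum.\<close>

lemma bailey_overpartition_pair:
  "(\<Sum>r\<le>n. alpha_pair r * bailey_coeff n r) = inverse (opoch n) ^ 2"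
proof (induction n)
  case 0
  then show ?case by (simp add: alpha_pair_def bailey_coeff_def)
next
  case (Suc n)
  let ?N = "Suc n" and ?X = "fps_X :: real fps"
  let ?b = "\<lambda>n. \<Sum>r\<le>n. alpha_pair r * bailey_coeff n r"
  let ?f = "\<lambda>r. (1 - ?X ^ (?N - r)) * (1 - ?X ^ (?N + r))"
  let ?t = "\<lambda>r. (-1) ^ r * ?X ^ (r * (r - 1) div 2) * (1 + ?X ^ r) * bailey_coeff ?N r"
  have "?b n = (\<Sum>r\<le>?N. alpha_pair r * bailey_coeff n r)" by (simp add: bailey_coeff_def)
  also have "\<dots> = (\<Sum>r\<le>?N. ?f r * (alpha_pair r * bailey_coeff ?N r))"
    by (intro sum.cong refl) (simp add: bailey_coeff_Suc[of _ n] mult_ac del: power_Suc)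
  finally have "(1 + ?X ^ ?N)^2 * ?b ?N - ?b n = (\<Sum>r\<le>?N. ((1 + ?X ^ ?N)^2 - ?f r) * (alpha_pair r * bailey_coeff ?N r))"
    by (simp only: sum_distrib_left sum_subtractf[symmetric] left_diff_distrib)
  also have "\<dots> = 4 * ?X ^ ?N * bailey_coeff ?N 0 + (\<Sum>r=1..?N. ((1 + ?X ^ ?N)^2 - ?f r) * (alpha_pair r * bailey_coeff ?N r))"
  proof -
    have "{..?N} = insert 0 {1..?N}" by auto
    then show ?thesis by (simp add: alpha_pair_def power2_eq_square algebra_simps del: sum.atLeast1_atMost_eq)
  qed
  also have "(\<Sum>r=1..?N. ((1 + ?X ^ ?N)^2 - ?f r) * (alpha_pair r * bailey_coeff ?N r)) = (\<Sum>r=1..?N. 4 * ?X ^ ?N * ?t r)"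
  proof (intro sum.cong refl)
    fix r assume r: "r \<in> {1..?N}"
    have split: "?X ^ (?N + r) = ?X ^ (?N - r) * ?X ^ r * ?X ^ r" "?X ^ ?N = ?X ^ (?N - r) * ?X ^ r"
      using r by (simp_all only: power_add[symmetric]) (simp_all add: algebra_simps)
    have A: "(1 + ?X ^ ?N)^2 - ?f r = ?X ^ (?N - r) * (1 + ?X ^ r)^2"
      unfolding split by (simp add: power2_eq_square algebra_simps)
    have U: "(1 + ?X ^ r) * inverse (1 + ?X ^ r) = 1" using r by (intro fps_unit) simp
    have E: "r * (r + 1) div 2 = r * (r - 1) div 2 + r"
    proof -
      have "r * (r + 1) = r * (r - 1) + r * 2" using r by (cases r) (simp_all add: algebra_simps)
      then show ?thesis by (simp only: div_mult_self3[symmetric])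
    qed
    define u where "u = 1 + ?X ^ r"
    have "((1 + ?X ^ ?N)^2 - ?f r) * alpha_pair r =
        ?X ^ (?N - r) * (u * u) * (4 * (-1) ^ r * (?X ^ (r * (r - 1) div 2) * ?X ^ r) * inverse u)"
    proof -
      have "alpha_pair r = 4 * (-1) ^ r * (?X ^ (r * (r - 1) div 2) * ?X ^ r) * inverse u"
        using r unfolding alpha_pair_def E power_add u_def by simp
      then show ?thesis unfolding A unfolding power2_eq_square u_def by (simp only:)
    qed
    also have "\<dots> = 4 * (-1) ^ r * (?X ^ (?N - r) * ?X ^ r) * ?X ^ (r * (r - 1) div 2) * u * (u * inverse u)"
      by (simp only: mult_ac)
    finally have "((1 + ?X ^ ?N)^2 - ?f r) * alpha_pair r =
        4 * (-1) ^ r * (?X ^ (?N - r) * ?X ^ r) * ?X ^ (r * (r - 1) div 2) * (1 + ?X ^ r)"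
      unfolding u_def U by simp
    then show "((1 + ?X ^ ?N)^2 - ?f r) * (alpha_pair r * bailey_coeff ?N r) = 4 * ?X ^ ?N * ?t r"
      unfolding split(2)[symmetric] mult.assoc[symmetric] by (simp only: mult_ac)
  qed
  also have "4 * ?X ^ ?N * bailey_coeff ?N 0 + (\<Sum>r=1..?N. 4 * ?X ^ ?N * ?t r) = 0"
    using bailey_unit_pair[of ?N] by (simp only: sum_distrib_left[symmetric] distrib_left[symmetric]) simp
  finally have "(1 + ?X ^ ?N)^2 * ?b ?N = inverse (opoch n) ^ 2" using Suc by simp
  moreover have "(1 + ?X ^ ?N) * inverse (1 + ?X ^ ?N) = 1" by (intro fps_unit) simp
  then have "inverse (1 + ?X ^ ?N) ^ 2 * ((1 + ?X ^ ?N)^2 * ?b ?N) = ?b ?N"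
    by (simp add: power_mult_distrib[symmetric] mult.assoc[symmetric] mult.commute)
  ultimately show ?case by (simp add: opoch_Suc fps_inverse_mult power_mult_distrib mult.commute)
qed

definition vanishing :: "(nat \<Rightarrow> real fps) \<Rightarrow> bool" where
  "vanishing u \<longleftrightarrow> (\<forall>n k. k < n \<longrightarrow> u n $ k = 0)"

text \<open>A formal infinite sum: for a \<open>vanishing\<close> sequence q^n divides the n-th
  term, so only terms up to k reach the coefficient of q^k.\<close>

definition fsum :: "(nat \<Rightarrow> real fps) \<Rightarrow> real fps" where
  "fsum u = Abs_fps (\<lambda>k. \<Sum>n\<le>k. u n $ k)"

lemma fsum_nth:
  assumes "vanishing u" "k \<le> N"
  shows "fsum u $ k = (\<Sum>n\<le>N. u n) $ k"
proof -
  have "(\<Sum>n\<le>N. u n $ k) = (\<Sum>n\<le>k. u n $ k)"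
    using assms by (intro sum.mono_neutral_right) (auto simp: vanishing_def)
  then show ?thesis by (simp add: fsum_def fps_sum_nth)
qed

lemma fps_mult_nth_cong:
  assumes "\<And>i. i \<le> k \<Longrightarrow> A $ i = B $ i"
  shows "(C * A) $ k = (C * B :: real fps) $ k"
  using assms by (simp add: fps_mult_nth)

lemma fsum_mult_nth:
  assumes "vanishing u" "k \<le> N"
  shows "(C * fsum u) $ k = (\<Sum>n\<le>N. C * u n) $ k"
  unfolding sum_distrib_left[symmetric]
  by (rule fps_mult_nth_cong) (use assms in \<open>auto intro: fsum_nth\<close>)

lemma vanishing_X_power: "(\<And>n. e n \<ge> n) \<Longrightarrow> vanishing (\<lambda>n. fps_X ^ e n * v n)"
  unfolding vanishing_def by (metis fps_X_power_mult_nth le_trans not_le)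

text \<open>This is (-1;q)_n q^(n(n+1)/2), the weight in Bailey's lemma for \<rho>_1 = -1 and
  \<rho>_2 tending to infinity.\<close>

definition bailey_delta :: "nat \<Rightarrow> real fps" where
  "bailey_delta n = (if n = 0 then 1 else 2 * opoch (n - 1) * fps_X ^ (n * (n + 1) div 2))"

lemma bailey_delta_Suc: "bailey_delta (Suc n) = bailey_delta n * (1 + fps_X ^ n) * fps_X ^ Suc n"
proof (cases n)
  case (Suc m)
  have "opoch n = opoch (n - 1) * (1 + fps_X ^ n)" using opoch_Suc[of m] Suc by simp
  moreover have "fps_X ^ (Suc n * (Suc n + 1) div 2) = fps_X ^ (n * (n + 1) div 2) * (fps_X ^ Suc n :: real fps)"
    unfolding tri_Suc power_add ..
  ultimately show ?thesis using Suc by (simp add: bailey_delta_def mult_ac)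
qed (simp add: bailey_delta_def)

lemma tri_ge: "n * (n + 1) div 2 \<ge> (n::nat)"
  by (induction n) auto

lemma vanishing_bailey_delta: "vanishing (\<lambda>n. bailey_delta n * v n)"
proof -
  have "(\<lambda>n. bailey_delta n * v n) = (\<lambda>n. fps_X ^ (n * (n + 1) div 2) * ((if n = 0 then 1 else 2 * opoch (n - 1)) * v n))"
    by (auto simp: bailey_delta_def fun_eq_iff mult_ac)
  then show ?thesis using vanishing_X_power[OF tri_ge] by simp
qed

lemma vanishing_nth: "vanishing u \<Longrightarrow> k < n \<Longrightarrow> u n $ k = 0"
  by (simp add: vanishing_def)

text \<open>The sequence \<gamma>_r conjugate to \<delta>_n. \<open>theta_quotient_theta\<close>
  identifies \<gamma>_0 as the reciprocal of \<open>theta_alt\<close>.\<close>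

definition theta_quotient :: "nat \<Rightarrow> real fps" where "theta_quotient r = fsum (\<lambda>n. bailey_delta n * bailey_coeff n r)"

text \<open>The summands of the two sides differ by h n - h (n+1), where h 0 = 0 and q^n divides h
  n, so the difference telescopes to 0.\<close>

lemma theta_quotient_Suc: "(1 + fps_X ^ Suc r) * theta_quotient (Suc r) = fps_X ^ Suc r * (1 + fps_X ^ r) * theta_quotient r"
proof -
  let ?X = "fps_X :: real fps"
  \<comment> \<open>For n \<le> r the factor 1/(q;q)_(n-r-1) is 0, whereas truncated subtraction
    would give 1; hence the case distinction.\<close>
  define h where "h n = (if n \<le> r then 0 else (1 - ?X ^ (2 * r + 1)) *
    (bailey_delta n * (inverse (eqpoch (n - Suc r)) * inverse (eqpoch (n + r)))))" for n
  let ?u = "\<lambda>n. (1 + ?X ^ Suc r) * (bailey_delta n * bailey_coeff n (Suc r)) - ?X ^ Suc r * (1 + ?X ^ r) * (bailey_delta n * bailey_coeff n r)"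
  have step: "?u n = h n - h (Suc n)" for n
  proof (cases "r \<le> n")
    case True
    let ?a = "inverse (eqpoch (n - r))" and ?b = "inverse (eqpoch (n + Suc r))"
    have b: "inverse (eqpoch (n + r)) = (1 - ?X ^ (n + Suc r)) * ?b"
      using inverse_eqpoch[of "n + Suc r"] by (simp del: power_Suc)
    have c1: "bailey_coeff n r = ?a * (1 - ?X ^ (n + Suc r)) * ?b"
      using True b by (simp add: bailey_coeff_def mult_ac)
    have a: "inverse (eqpoch (n - Suc r)) = (1 - ?X ^ (n - r)) * ?a" if "r < n"
      using inverse_eqpoch[of "n - r"] that by simp
    have c2: "bailey_coeff n (Suc r) = (1 - ?X ^ (n - r)) * ?a * ?b"
    proof (cases "r < n")
      case True
      then show ?thesis using a by (simp add: bailey_coeff_def)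
    next
      case False
      then have "n = r" using \<open>r \<le> n\<close> by simp
      then show ?thesis by (simp add: bailey_coeff_def)
    qed
    have h1: "h n = (1 - ?X ^ (2 * r + 1)) * bailey_delta n * (1 - ?X ^ (n - r)) * ?a * (1 - ?X ^ (n + Suc r)) * ?b"
    proof (cases "r < n")
      case True
      then show ?thesis using a b by (simp add: h_def mult_ac)
    next
      case False
      then have "n = r" using \<open>r \<le> n\<close> by simp
      then show ?thesis by (simp add: h_def)
    qed
    have h2: "h (Suc n) = (1 - ?X ^ (2 * r + 1)) * bailey_delta n * (1 + ?X ^ n) * ?X ^ Suc n * ?a * ?b"
      using True by (simp add: h_def bailey_delta_Suc mult_ac)
    define y where "y = ?X ^ (n - r)"
    define x where "x = ?X ^ r"
    have pw: "?X ^ (n - r) = y" "?X ^ n = y * x" "?X ^ Suc n = y * x * ?X" "?X ^ (n + Suc r) = y * x * x * ?X"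
        "?X ^ Suc r = x * ?X" "?X ^ (2 * r + 1) = x * x * ?X" "?X ^ r = x"
      using True by (auto simp: x_def y_def power_add[symmetric] mult_2)
    show ?thesis unfolding h1 h2 c1 c2 pw by (simp add: algebra_simps)
  next
    case False
    then show ?thesis by (cases "n + 1 = r + 1") (auto simp: h_def bailey_coeff_def)
  qed
  have van: "h n $ k = 0" if "k < n" for n k
  proof -
    have "h n = bailey_delta n * (if n \<le> r then 0 else (1 - ?X ^ (2 * r + 1)) * (inverse (eqpoch (n - Suc r)) * inverse (eqpoch (n + r))))"
      by (simp add: h_def mult_ac)
    then show ?thesis
      using vanishing_nth[OF vanishing_bailey_delta that, of "\<lambda>n. if n \<le> r then 0 else (1 - ?X ^ (2 * r + 1)) * (inverse (eqpoch (n - Suc r)) * inverse (eqpoch (n + r)))"]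
      by simp
  qed
  have "((1 + ?X ^ Suc r) * theta_quotient (Suc r) - ?X ^ Suc r * (1 + ?X ^ r) * theta_quotient r) $ k = 0" for k
  proof -
    have "((1 + ?X ^ Suc r) * theta_quotient (Suc r) - ?X ^ Suc r * (1 + ?X ^ r) * theta_quotient r) $ k = (\<Sum>n\<le>k. ?u n) $ k"
      unfolding theta_quotient_def fps_sub_nth sum_subtractf
      by (simp only: fsum_mult_nth[OF vanishing_bailey_delta order_refl])
    also have "(\<Sum>n\<le>k. ?u n) = h 0 - h (Suc k)"
      unfolding step by (induction k) simp_all
    also have "\<dots> $ k = 0" using van[of k "Suc k"] by (simp add: h_def)
    finally show ?thesis .
  qed
  then have "(1 + ?X ^ Suc r) * theta_quotient (Suc r) - ?X ^ Suc r * (1 + ?X ^ r) * theta_quotient r = 0"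
    by (intro fps_ext) simp
  then show ?thesis by simp
qed

lemma theta_quotient_eq: "r > 0 \<Longrightarrow> (1 + fps_X ^ r) * theta_quotient r = 2 * fps_X ^ (r * (r + 1) div 2) * theta_quotient 0"
proof (induction r)
  case (Suc r)
  show ?case
  proof (cases "r = 0")
    case True
    then show ?thesis using theta_quotient_Suc[of 0] by simp
  next
    case False
    then show ?thesis unfolding theta_quotient_Suc tri_Suc power_add using Suc by (simp add: mult_ac)
  qed
qed simp

definition theta_alt :: "real fps" where
  "theta_alt = fsum (\<lambda>r. if r = 0 then 1 else 2 * (-1) ^ r * fps_X ^ (r^2))"

definition lambert :: "real fps" where
  "lambert = fsum (\<lambda>r. if r = 0 then 1 else 8 * (-1) ^ r * fps_X ^ (r^2 + r) * inverse (1 + fps_X ^ r) ^ 2)"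

lemma vanishing_theta: "vanishing (\<lambda>r. if r = 0 then 1 else 2 * (-1) ^ r * fps_X ^ (r^2))"
proof -
  have "(\<lambda>r. if r = 0 then 1 else 2 * (-1) ^ r * fps_X ^ (r^2)) = (\<lambda>r. fps_X ^ (r^2) * (if r = 0 then 1 else 2 * (-1) ^ r :: real fps))"
    by (auto simp: fun_eq_iff mult_ac)
  then show ?thesis using vanishing_X_power[of "\<lambda>r. r^2"] by (simp add: power2_nat_le_imp_le)
qed

lemma vanishing_lambert:
  "vanishing (\<lambda>r. if r = 0 then 1 else 8 * (-1) ^ r * fps_X ^ (r^2 + r) * inverse (1 + fps_X ^ r) ^ 2)"
proof -
  have "(\<lambda>r. if r = 0 then 1 else 8 * (-1) ^ r * fps_X ^ (r^2 + r) * inverse (1 + fps_X ^ r) ^ 2) =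
    (\<lambda>r. fps_X ^ (r^2 + r) * (if r = 0 then 1 else 8 * (-1) ^ r * inverse (1 + fps_X ^ r) ^ 2 :: real fps))"
    by (auto simp: fun_eq_iff mult_ac)
  then show ?thesis using vanishing_X_power[of "\<lambda>r. r^2 + r"] by simp
qed

text \<open>Bailey's transform, the exchange of summation behind \<Sigma> \<delta>_n \<beta>_n =
  \<Sigma> \<alpha>_r \<gamma>_r, for one coefficient so that both sums are finite.\<close>

lemma sum_bailey_swap:
  "(\<Sum>n\<le>k. bailey_delta n * (\<Sum>r\<le>n. a r * bailey_coeff n r)) $ k = (\<Sum>r\<le>k. a r * theta_quotient r) $ k"
proof -
  have "(\<Sum>n\<le>k. bailey_delta n * (\<Sum>r\<le>n. a r * bailey_coeff n r)) = (\<Sum>n\<le>k. \<Sum>r\<le>k. a r * (bailey_delta n * bailey_coeff n r))"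
  proof (intro sum.cong refl)
    fix n assume "n \<in> {..k}"
    then have "(\<Sum>r\<le>n. a r * bailey_coeff n r) = (\<Sum>r\<le>k. a r * bailey_coeff n r)"
      by (intro sum.mono_neutral_left) (auto simp: bailey_coeff_def)
    then show "bailey_delta n * (\<Sum>r\<le>n. a r * bailey_coeff n r) = (\<Sum>r\<le>k. a r * (bailey_delta n * bailey_coeff n r))"
      by (simp add: sum_distrib_left mult_ac)
  qed
  also have "\<dots> = (\<Sum>r\<le>k. \<Sum>n\<le>k. a r * (bailey_delta n * bailey_coeff n r))" by (rule sum.swap)
  also have "\<dots> $ k = (\<Sum>r\<le>k. a r * theta_quotient r) $ k"
    unfolding fps_sum_nth[of _ "{..k}"] theta_quotient_def
    by (simp only: fsum_mult_nth[OF vanishing_bailey_delta order_refl] fps_sum_nth)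
  finally show ?thesis .
qed

text \<open>Bailey's transform for the unit pair: \<beta>_n is 0 for n > 0, so one side is
  \<delta>_0 = 1, while on the other \<alpha>_r \<gamma>_r is \<gamma>_0 times a term of the theta
  series.\<close>

lemma theta_quotient_theta: "theta_quotient 0 * theta_alt = 1"
proof (rule fps_ext)
  fix k
  let ?a = "\<lambda>r. if r = 0 then 1 else (-1) ^ r * fps_X ^ (r * (r - 1) div 2) * (1 + fps_X ^ r) :: real fps"
  have "(\<Sum>r\<le>n. ?a r * bailey_coeff n r) = (if n = 0 then 1 else 0)" for n
  proof (cases "n = 0")
    case False
    have "{..n} = insert 0 {1..n}" by auto
    then have "(\<Sum>r\<le>n. ?a r * bailey_coeff n r) = bailey_coeff n 0 + (\<Sum>r=1..n. ?a r * bailey_coeff n r)"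
      by (simp del: sum.atLeast1_atMost_eq)
    also have "(\<Sum>r=1..n. ?a r * bailey_coeff n r) = (\<Sum>r=1..n. (-1) ^ r * fps_X ^ (r * (r - 1) div 2) * (1 + fps_X ^ r) * bailey_coeff n r)"
      by (intro sum.cong) auto
    finally show ?thesis using False bailey_unit_pair[of n] by simp
  qed (simp add: bailey_coeff_def)
  then have "(\<Sum>n\<le>k. bailey_delta n * (\<Sum>r\<le>n. ?a r * bailey_coeff n r)) = (\<Sum>n\<le>k. if n = 0 then 1 else 0)"
    by (intro sum.cong) (auto simp: bailey_delta_def)
  then have "1 $ k = (\<Sum>r\<le>k. ?a r * theta_quotient r) $ k"
    using sum_bailey_swap[where k = k and a = ?a] by simp
  also have "(\<Sum>r\<le>k. ?a r * theta_quotient r) = (\<Sum>r\<le>k. theta_quotient 0 * (if r = 0 then 1 else 2 * (-1) ^ r * fps_X ^ (r^2)))"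
  proof (intro sum.cong refl)
    fix r
    show "?a r * theta_quotient r = theta_quotient 0 * (if r = 0 then 1 else 2 * (-1) ^ r * fps_X ^ (r^2))"
    proof (cases "r = 0")
      case False
      have e: "r * (r - 1) div 2 + r * (r + 1) div 2 = r^2"
      proof -
        have "r * (r + 1) = r * (r - 1) + r * 2" using False by (cases r) (simp_all add: algebra_simps)
        then have "r * (r + 1) div 2 = r * (r - 1) div 2 + r" by (simp only: div_mult_self3[symmetric])
        moreover have "2 * (r * (r - 1) div 2) = r * (r - 1)" by (rule dvd_mult_div_cancel) (cases r; simp)
        ultimately have "r * (r - 1) div 2 + r * (r + 1) div 2 = r * (r - 1) + r" by linarith
        then show ?thesis using False by (cases r) (simp_all add: power2_eq_square)
      qed
      have "?a r * theta_quotient r = (-1) ^ r * fps_X ^ (r * (r - 1) div 2) * ((1 + fps_X ^ r) * theta_quotient r)"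
        using False by (simp add: mult_ac)
      also have "\<dots> = theta_quotient 0 * (2 * (-1) ^ r * (fps_X ^ (r * (r - 1) div 2) * fps_X ^ (r * (r + 1) div 2)))"
        using False by (subst theta_quotient_eq) (simp_all add: mult_ac)
      finally show ?thesis unfolding power_add[symmetric] e using False by simp
    qed simp
  qed
  also have "\<dots> $ k = (theta_quotient 0 * theta_alt) $ k"
    unfolding theta_alt_def by (rule fsum_mult_nth[OF vanishing_theta order_refl, symmetric])
  finally show "(theta_quotient 0 * theta_alt) $ k = 1 $ k" by simp
qed

lemma bailey_sum: "(\<Sum>n\<le>k. bailey_delta n * inverse (opoch n) ^ 2) $ k = (theta_quotient 0 * lambert) $ k"
proof -
  have "(\<Sum>n\<le>k. bailey_delta n * inverse (opoch n) ^ 2) $ k = (\<Sum>r\<le>k. alpha_pair r * theta_quotient r) $ k"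
    using sum_bailey_swap[where k = k and a = alpha_pair] by (simp only: bailey_overpartition_pair)
  also have "(\<Sum>r\<le>k. alpha_pair r * theta_quotient r) =
     (\<Sum>r\<le>k. theta_quotient 0 * (if r = 0 then 1 else 8 * (-1) ^ r * fps_X ^ (r^2 + r) * inverse (1 + fps_X ^ r) ^ 2))"
  proof (intro sum.cong refl)
    fix r
    show "alpha_pair r * theta_quotient r = theta_quotient 0 * (if r = 0 then 1 else 8 * (-1) ^ r * fps_X ^ (r^2 + r) * inverse (1 + fps_X ^ r) ^ 2)"
    proof (cases "r = 0")
      case False
      have e: "r * (r + 1) div 2 + r * (r + 1) div 2 = r^2 + r"
      proof -
        have "2 * (r * (r + 1) div 2) = r * (r + 1)" by (rule dvd_mult_div_cancel) simp
        then show ?thesis unfolding mult_2[symmetric] by (simp add: power2_eq_square)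
      qed
      have u: "(1 + fps_X ^ r) * inverse (1 + fps_X ^ r) = (1 :: real fps)" using False by (intro fps_unit) simp
      have "theta_quotient r = ((1 + fps_X ^ r) * inverse (1 + fps_X ^ r)) * theta_quotient r" unfolding u by simp
      also have "\<dots> = inverse (1 + fps_X ^ r) * ((1 + fps_X ^ r) * theta_quotient r)" by (simp only: mult_ac)
      also have "\<dots> = inverse (1 + fps_X ^ r) * (2 * fps_X ^ (r * (r + 1) div 2) * theta_quotient 0)" using False by (simp add: theta_quotient_eq)
      finally have "alpha_pair r * theta_quotient r = theta_quotient 0 * (8 * (-1) ^ r * (fps_X ^ (r * (r + 1) div 2) * fps_X ^ (r * (r + 1) div 2)) * inverse (1 + fps_X ^ r) ^ 2)"
        using False by (simp add: alpha_pair_def power2_eq_square mult_ac)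
      then show ?thesis unfolding power_add[symmetric] e using False by simp
    qed (simp add: alpha_pair_def)
  qed
  also have "\<dots> $ k = (theta_quotient 0 * lambert) $ k"
    unfolding lambert_def by (rule fsum_mult_nth[OF vanishing_lambert order_refl, symmetric])
  finally show ?thesis .
qed

lemma fps_inverse_mult_eq:
  assumes "A * F = B" "A $ 0 = 1"
  shows "inverse A * B = (F :: real fps)"
proof -
  have "inverse A * B = (A * inverse A) * F" unfolding assms(1)[symmetric] by (simp only: mult_ac)
  then show ?thesis by (simp add: fps_unit[OF assms(2)])
qed

section \<open>Iteration of Fine's function\<close>

definition fine_term :: "nat \<Rightarrow> nat \<Rightarrow> real fps" where
  "fine_term k n = (-1) ^ n * fps_X ^ (k * n) * eqpoch n * inverse (opoch_from k n)"

text \<open>Fine's function F(1, -q^k; -q^k), where F(a, b; t) = \<Sigma> (aq;q)_n t^n /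
  (bq;q)_n.\<close>

definition fine_sum :: "nat \<Rightarrow> real fps" where "fine_sum k = fsum (fine_term k)"

lemma vanishing_fine: "k > 0 \<Longrightarrow> vanishing (fine_term k)"
  using vanishing_X_power[of "\<lambda>n. k * n" "\<lambda>n. (-1) ^ n * eqpoch n * inverse (opoch_from k n)"]
  by (simp add: fine_term_def[abs_def] mult_ac)

lemma fine_term_Suc:
  "fine_term k (Suc n) + fps_X ^ k * fine_term k n =
    (1 + fps_X ^ k) * fps_X ^ Suc k * inverse (1 + fps_X ^ Suc k) * fine_term (Suc k) n"
proof -
  let ?X = "fps_X :: real fps"
  define w where "w = inverse (opoch_from k (Suc n))"
  define x y where "x = ?X ^ k" and "y = ?X ^ n"
  have "inverse (opoch_from k n) = (1 + ?X ^ (k + Suc n)) * w"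
    unfolding w_def by (rule inverse_factor) (simp_all add: opoch_from_Suc del: power_Suc)
  moreover have "?X ^ (k + Suc n) = x * y * ?X" by (simp add: x_def y_def power_add mult_ac)
  ultimately have 1: "inverse (opoch_from k n) = (1 + x * y * ?X) * w" by simp
  have 2: "inverse (1 + ?X ^ Suc k) * inverse (opoch_from (Suc k) n) = w"
    by (simp only: w_def opoch_from_shift fps_inverse_mult)
  have 3: "?X ^ (k * Suc n) = x * ?X ^ (k * n)" "?X ^ (Suc k * n) = y * ?X ^ (k * n)" "?X ^ Suc n = y * ?X" "?X ^ Suc k = x * ?X"
    by (simp_all add: x_def y_def power_add)
  have "fine_term k (Suc n) + ?X ^ k * fine_term k n =
      (-1) ^ n * ?X ^ (k * n) * eqpoch n * w * x * (- (1 - y * ?X) + (1 + x * y * ?X))"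
    unfolding fine_term_def 1 3 w_def[symmetric] eqpoch_Suc x_def[symmetric] by (simp add: algebra_simps)
  also have "\<dots> = (1 + x) * (x * ?X) * ((-1) ^ n * (y * ?X ^ (k * n)) * eqpoch n * w)"
    by (simp add: algebra_simps)
  also have "\<dots> = (1 + ?X ^ k) * ?X ^ Suc k * inverse (1 + ?X ^ Suc k) * fine_term (Suc k) n"
    unfolding fine_term_def 2[symmetric] 3(2) 3(4) x_def[symmetric] by (simp only: mult_ac)
  finally show ?thesis .
qed

text \<open>Adding q^k times the series to the series itself and pairing term n+1 with q^k times
  term n leaves 1 plus a sum of brackets; by \<open>fine_term_Suc\<close> each bracket is a multiple
  of term n for k+1.\<close>

lemma fine_step:
  assumes k: "k > 0"
  shows "(1 + fps_X ^ k) * fine_sum k = 1 + (1 + fps_X ^ k) * fps_X ^ Suc k * inverse (1 + fps_X ^ Suc k) * fine_sum (Suc k)"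
proof (rule fps_ext)
  fix i
  let ?c = "(1 + fps_X ^ k) * fps_X ^ Suc k * inverse (1 + fps_X ^ Suc k) :: real fps"
  note van = vanishing_fine[OF k]
  have tel: "(1 + fps_X ^ k) * (\<Sum>n\<le>N. fine_term k n) = 1 + (\<Sum>n<N. fine_term k (Suc n) + fps_X ^ k * fine_term k n) + fps_X ^ k * fine_term k N" for N
    by (induction N) (simp_all add: fine_term_def[of _ 0] algebra_simps)
  \<comment> \<open>Summing up to i+1 lets the brackets reach n = i, and the leftover term with
    index i+1 has no coefficient at i.\<close>
  have "((1 + fps_X ^ k) * fine_sum k) $ i = ((1 + fps_X ^ k) * (\<Sum>n\<le>Suc i. fine_term k n)) $ i"
    unfolding fine_sum_def sum_distrib_left by (rule fsum_mult_nth[OF van]) simp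
  also have "\<dots> = (1 + (\<Sum>n\<le>i. ?c * fine_term (Suc k) n)) $ i"
    unfolding tel fine_term_Suc lessThan_Suc_atMost
    using vanishing_nth[OF van, of _ "Suc i"] by (simp add: fps_X_power_mult_nth)
  also have "\<dots> = (1 + ?c * fine_sum (Suc k)) $ i"
    unfolding fine_sum_def fps_add_nth by (simp only: fsum_mult_nth[OF vanishing_fine[OF zero_less_Suc] order_refl])
  finally show "((1 + fps_X ^ k) * fine_sum k) $ i = (1 + ?c * fine_sum (Suc k)) $ i" .
qed

text \<open>Each application of \<open>fine_step\<close> splits off one summand, and the remainder
  is divisible by q^(N(N+1)/2). The factors that accumulate are why a Bailey pair with \<beta>_n =
  1/(-q;q)_n^2 is wanted.\<close>

lemma fine_iterate:
  assumes "N > 0"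
  shows "1 + 2 * fps_X * inverse (1 + fps_X) * fine_sum 1 =
    (\<Sum>n<N. bailey_delta n * inverse (opoch n) ^ 2) + bailey_delta N * inverse (opoch N) ^ 2 * ((1 + fps_X ^ N) * fine_sum N)"
  using assms
proof (induction N rule: nat_induct_non_zero)
  case 1
  have u: "(1 + fps_X) * inverse (1 + fps_X) = (1 :: real fps)" by (rule fps_unit) simp
  have "inverse (1 + fps_X) ^ 2 * ((1 + fps_X) * fine_sum 1) = ((1 + fps_X) * inverse (1 + fps_X)) * inverse (1 + fps_X) * fine_sum 1"
    by (simp add: power2_eq_square mult_ac)
  then have "inverse (1 + fps_X) ^ 2 * ((1 + fps_X) * fine_sum 1) = inverse (1 + fps_X) * fine_sum 1" unfolding u by simp
  moreover have "bailey_delta 0 = 1" "bailey_delta 1 = 2 * fps_X" "opoch 1 = 1 + fps_X" by (simp_all add: bailey_delta_def opoch_def)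
  moreover have "2 * fps_X * inverse (1 + fps_X) ^ 2 * ((1 + fps_X) * fine_sum 1) = 2 * fps_X * (inverse (1 + fps_X) ^ 2 * ((1 + fps_X) * fine_sum 1))"
    by (simp only: mult.assoc)
  ultimately show ?case by (simp only: lessThan_Suc One_nat_def[symmetric] power_one_right) (simp add: mult.assoc)
next
  case (Suc N)
  have u: "(1 + fps_X ^ Suc N) * inverse (1 + fps_X ^ Suc N) = (1 :: real fps)" by (rule fps_unit) simp
  have io: "inverse (opoch (Suc N)) = inverse (opoch N) * inverse (1 + fps_X ^ Suc N)"
    by (simp only: opoch_Suc fps_inverse_mult)
  define b where "b = inverse (1 + fps_X ^ Suc N :: real fps)"
  have "bailey_delta (Suc N) * inverse (opoch (Suc N)) ^ 2 * ((1 + fps_X ^ Suc N) * fine_sum (Suc N)) =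
     bailey_delta N * inverse (opoch N) ^ 2 * ((1 + fps_X ^ N) * fps_X ^ Suc N * b * fine_sum (Suc N)) * ((1 + fps_X ^ Suc N) * b)"
    unfolding bailey_delta_Suc io b_def[symmetric] power2_eq_square by (simp only: mult_ac)
  then have *: "bailey_delta (Suc N) * inverse (opoch (Suc N)) ^ 2 * ((1 + fps_X ^ Suc N) * fine_sum (Suc N)) =
     bailey_delta N * inverse (opoch N) ^ 2 * ((1 + fps_X ^ N) * fps_X ^ Suc N * inverse (1 + fps_X ^ Suc N) * fine_sum (Suc N))"
    unfolding b_def u by simp
  show ?case unfolding * Suc.IH fine_step[OF Suc.hyps] sum.lessThan_Suc distrib_left by simp
qed

lemma fine_bailey: "1 + 2 * fps_X * inverse (1 + fps_X) * fine_sum 1 = theta_quotient 0 * lambert"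
proof (rule fps_ext)
  fix k
  have "(bailey_delta (Suc k) * inverse (opoch (Suc k)) ^ 2 * ((1 + fps_X ^ Suc k) * fine_sum (Suc k))) $ k = 0"
    using vanishing_nth[OF vanishing_bailey_delta, of k "Suc k" "\<lambda>_. inverse (opoch (Suc k)) ^ 2 * ((1 + fps_X ^ Suc k) * fine_sum (Suc k))"]
    by (simp add: mult.assoc)
  then have "(1 + 2 * fps_X * inverse (1 + fps_X) * fine_sum 1) $ k = (\<Sum>n\<le>k. bailey_delta n * inverse (opoch n) ^ 2) $ k"
    unfolding fine_iterate[of "Suc k", OF zero_less_Suc] fps_add_nth lessThan_Suc_atMost by simp
  then show "(1 + 2 * fps_X * inverse (1 + fps_X) * fine_sum 1) $ k = (theta_quotient 0 * lambert) $ k"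
    by (simp only: bailey_sum)
qed

section \<open>Overpartitions with bounded parts\<close>

definition overpartitions_le :: "nat \<Rightarrow> nat \<Rightarrow> (nat multiset \<times> nat set) set" where
  "overpartitions_le l n = {\<pi> \<in> overpartitions n. \<forall>x\<in>#fst \<pi>. x \<le> l}"

definition part_sign :: "nat multiset \<times> nat set \<Rightarrow> int" where "part_sign \<pi> = (-1) ^ size (fst \<pi>)"

definition signed_count :: "nat \<Rightarrow> nat \<Rightarrow> int" where
  "signed_count l n = (\<Sum>\<pi>\<in>overpartitions_le l n. part_sign \<pi>)"

lemma size_le_sum_mset: "0 \<notin># P \<Longrightarrow> size P \<le> sum_mset (P :: nat multiset)"
  by (induction P) auto

lemma finite_overpartitions: "finite (overpartitions n)"
proof (rule finite_subset)
  let ?M = "mset ` {xs. set xs \<subseteq> {..n} \<and> length xs \<le> n}"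
  show "overpartitions n \<subseteq> ?M \<times> Pow {..n}"
  proof
    fix \<pi> assume "\<pi> \<in> overpartitions n"
    then obtain P U where h: "\<pi> = (P, U)" "0 \<notin># P" "sum_mset P = n" "U \<subseteq> set_mset P" by (auto simp: overpartitions_def)
    obtain xs where xs: "P = mset xs" by (metis ex_mset)
    have "x \<le> n" if "x \<in># P" for x using sum_mset.remove[OF that] h(3) by simp
    then have "set_mset P \<subseteq> {..n}" by auto
    moreover have "length xs \<le> n" using size_le_sum_mset[OF h(2)] h(3) xs by simp
    ultimately show "\<pi> \<in> ?M \<times> Pow {..n}" using h xs by auto
  qed
  show "finite (?M \<times> Pow {..n})"
    by (intro finite_cartesian_product finite_imageI finite_lists_length_le) auto
qed

lemma finite_overpartitions_le: "finite (overpartitions_le l n)"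
  by (rule finite_subset[OF _ finite_overpartitions[of n]]) (auto simp: overpartitions_le_def)

lemma overpartitions_le_iff:
  "(P, U) \<in> overpartitions_le l n \<longleftrightarrow> 0 \<notin># P \<and> sum_mset P = n \<and> U \<subseteq> set_mset P \<and> (\<forall>x\<in>#P. x \<le> l)"
  by (auto simp: overpartitions_le_def overpartitions_def)

lemma overpartitions_le_Suc:
  "overpartitions_le l n = {\<pi> \<in> overpartitions_le (Suc l) n. Suc l \<notin># fst \<pi>}"
  unfolding overpartitions_le_def by (auto simp: le_Suc_eq)

lemma signed_count_0: "signed_count 0 n = (if n = 0 then 1 else 0)"
proof -
  have "overpartitions_le 0 n = (if n = 0 then {({#}, {})} else {})"
  proof (intro set_eqI)
    fix \<pi> :: "nat multiset \<times> nat set"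
    obtain P U where \<pi>: "\<pi> = (P, U)" by (cases \<pi>)
    show "\<pi> \<in> overpartitions_le 0 n \<longleftrightarrow> \<pi> \<in> (if n = 0 then {({#}, {})} else {})"
      by (cases "P = {#}") (auto simp: \<pi> overpartitions_le_iff dest: multi_nonempty_split)
  qed
  then show ?thesis by (simp add: signed_count_def part_sign_def)
qed

text \<open>The single copy of l+1 may be overlined or not, which is kept as a separate bit;
  removing it reverses the sign.\<close>

lemma signed_count_single:
  assumes n: "n \<ge> Suc l"
  shows "(\<Sum>\<pi> | \<pi> \<in> overpartitions_le (Suc l) n \<and> count (fst \<pi>) (Suc l) = 1. part_sign \<pi>) = - 2 * signed_count l (n - Suc l)"
proof -
  let ?L = "Suc l"
  let ?A = "{\<pi>. \<pi> \<in> overpartitions_le ?L n \<and> count (fst \<pi>) ?L = 1}"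
  let ?B = "overpartitions_le l (n - ?L) \<times> (UNIV :: bool set)"
  let ?f = "\<lambda>(P, U). ((P - {#?L#}, U - {?L}), ?L \<in> U)"
  let ?g = "\<lambda>((P, U), b). (add_mset ?L P, if b then insert ?L U else U)"
  have "(\<Sum>\<pi>\<in>?A. part_sign \<pi>) = (\<Sum>x\<in>?B. - part_sign (fst x))"
  proof (rule sum.reindex_bij_witness[of _ ?g
        ?f])
    fix \<pi> assume "\<pi> \<in> ?A"
    then obtain P U where \<pi>: "\<pi> = (P, U)" and h: "0 \<notin># P" "sum_mset P = n" "U \<subseteq> set_mset P" "\<forall>x\<in>#P. x \<le> ?L" "count P ?L = 1"
      by (cases \<pi>) (auto simp: overpartitions_le_iff)
    have "?L \<in># P" using h(5) by (metis count_eq_zero_iff zero_neq_one)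
    then obtain Q where Q: "P = add_mset ?L Q" by (metis insert_DiffM)
    have L: "?L \<notin># Q" using h(5) Q by (simp add: not_in_iff)
    show "?g (?f \<pi>) = \<pi>"
      by (auto simp: \<pi> Q)
    show "?f \<pi> \<in> ?B"
      using h L by (auto simp: \<pi> Q overpartitions_le_iff le_Suc_eq)
    show "- part_sign (fst (?f \<pi>)) = part_sign \<pi>"
      by (simp add: \<pi> Q part_sign_def)
  next
    fix x assume "x \<in> ?B"
    then obtain P U b where x: "x = ((P, U), b)" and h: "0 \<notin># P" "sum_mset P = n - ?L" "U \<subseteq> set_mset P" "\<forall>x\<in>#P. x \<le> l"
      by (cases x) (auto simp: overpartitions_le_iff)
    have L: "?L \<notin># P" using h(4) by auto
    then have L': "?L \<notin> U" using h(3) by blast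
    show "?f (?g x) = x"
      using L L' by (auto simp: x)
    show "?g x \<in> ?A"
      using h L n by (auto simp: x overpartitions_le_iff not_in_iff le_Suc_eq)
  qed
  also have "\<dots> = (\<Sum>\<pi>\<in>overpartitions_le l (n - ?L). \<Sum>b\<in>(UNIV :: bool set). - part_sign \<pi>)"
    unfolding sum.cartesian_product by (simp add: case_prod_unfold)
  also have "\<dots> = - 2 * signed_count l (n - ?L)"
    by (simp add: signed_count_def sum_distrib_left UNIV_bool sum_negf)
  finally show ?thesis .
qed

text \<open>With two or more copies of l+1, one can be removed while the overlining stays
  meaningful. What remains is any overpartition of n - (l+1) in which l+1 does occur.\<close>

lemma signed_count_multiple:
  assumes n: "n \<ge> Suc l"
  shows "(\<Sum>\<pi> | \<pi> \<in> overpartitions_le (Suc l) n \<and> count (fst \<pi>) (Suc l) \<ge> 2. part_sign \<pi>) =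
    - (signed_count (Suc l) (n - Suc l) - signed_count l (n - Suc l))"
proof -
  let ?L = "Suc l"
  let ?A = "{\<pi>. \<pi> \<in> overpartitions_le ?L n \<and> count (fst \<pi>) ?L \<ge> 2}"
  let ?S = "overpartitions_le ?L (n - ?L)"
  let ?B = "{\<pi> \<in> ?S. ?L \<in># fst \<pi>}"
  have "(\<Sum>\<pi>\<in>?A. part_sign \<pi>) = (\<Sum>\<pi>\<in>?B. - part_sign \<pi>)"
  proof (rule sum.reindex_bij_witness[of _ "\<lambda>(P, U). (add_mset ?L P, U)" "\<lambda>(P, U). (P - {#?L#}, U)"])
    fix \<pi> assume "\<pi> \<in> ?A"
    then obtain P U where \<pi>: "\<pi> = (P, U)" and h: "0 \<notin># P" "sum_mset P = n" "U \<subseteq> set_mset P" "\<forall>x\<in>#P. x \<le> ?L" "count P ?L \<ge> 2"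
      by (cases \<pi>) (auto simp: overpartitions_le_iff)
    have "?L \<in># P" using h(5) by (metis count_eq_zero_iff not_numeral_le_zero)
    then obtain Q where Q: "P = add_mset ?L Q" by (metis insert_DiffM)
    have L: "?L \<in># Q" using h(5) Q by (simp add: Suc_le_eq numeral_2_eq_2)
    show "(\<lambda>(P, U). (add_mset ?L P, U)) ((\<lambda>(P, U). (P - {#?L#}, U)) \<pi>) = \<pi>" by (simp add: \<pi> Q)
    show "(\<lambda>(P, U). (P - {#?L#}, U)) \<pi> \<in> ?B"
      using h L by (auto simp: \<pi> Q overpartitions_le_iff)
    show "- part_sign ((\<lambda>(P, U). (P - {#?L#}, U)) \<pi>) = part_sign \<pi>" by (simp add: \<pi> Q part_sign_def)
  next
    fix \<pi> assume "\<pi> \<in> ?B"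
    then obtain P U where \<pi>: "\<pi> = (P, U)" and h: "0 \<notin># P" "sum_mset P = n - ?L" "U \<subseteq> set_mset P" "\<forall>x\<in>#P. x \<le> ?L" "?L \<in># P"
      by (cases \<pi>) (auto simp: overpartitions_le_iff)
    show "(\<lambda>(P, U). (P - {#?L#}, U)) ((\<lambda>(P, U). (add_mset ?L P, U)) \<pi>) = \<pi>" by (simp add: \<pi>)
    have "count P ?L \<ge> 1" using h(5) by (simp add: Suc_le_eq)
    then show "(\<lambda>(P, U). (add_mset ?L P, U)) \<pi> \<in> ?A" using h n by (auto simp: \<pi> overpartitions_le_iff)
  qed
  also have "\<dots> = - (\<Sum>\<pi>\<in>?S - overpartitions_le l (n - ?L). part_sign \<pi>)"
    unfolding sum_negf overpartitions_le_Suc[of l] by (rule arg_cong[of _ _ uminus], rule sum.cong) auto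
  also have "\<dots> = - (signed_count (Suc l) (n - Suc l) - signed_count l (n - Suc l))"
    unfolding signed_count_def
    by (subst sum_diff) (auto simp: finite_overpartitions_le, auto simp: overpartitions_le_Suc[of l])
  finally show ?thesis .
qed

text \<open>The coefficients of (1 + q^(l+1)) A_(l+1) = (1 - q^(l+1)) A_l, obtained by separating
  the multiplicities 0, 1 and at least 2 of the part l+1.\<close>

lemma signed_count_Suc:
  "signed_count (Suc l) n = (if n < Suc l then signed_count l n
     else signed_count l n - signed_count l (n - Suc l) - signed_count (Suc l) (n - Suc l))"
proof (cases "n < Suc l")
  case True
  have "Suc l \<notin># P" if "sum_mset P = n" for P
  proof
    assume "Suc l \<in># P"
    from sum_mset.remove[OF this] that True show False by simp
  qed
  then have "overpartitions_le (Suc l) n = overpartitions_le l n"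
    unfolding overpartitions_le_Suc[of l] by (auto simp: overpartitions_le_iff)
  then show ?thesis using True by (simp add: signed_count_def)
next
  case False
  let ?L = "Suc l" and ?S = "overpartitions_le (Suc l) n"
  let ?B = "{\<pi>. \<pi> \<in> ?S \<and> count (fst \<pi>) ?L = 1}" and ?C = "{\<pi>. \<pi> \<in> ?S \<and> count (fst \<pi>) ?L \<ge> 2}"
  have "count P ?L = 0 \<or> count P ?L = 1 \<or> count P ?L \<ge> 2" for P by linarith
  then have S: "?S = overpartitions_le l n \<union> (?B \<union> ?C)"
    unfolding overpartitions_le_Suc[of l] by (simp only: set_eq_iff Un_iff mem_Collect_eq not_in_iff) blast
  have fin: "finite (overpartitions_le l n)" "finite ?B" "finite ?C"
    using finite_overpartitions_le by auto
  have "signed_count ?L n = signed_count l n + ((\<Sum>\<pi>\<in>?B. part_sign \<pi>) + (\<Sum>\<pi>\<in>?C. part_sign \<pi>))"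
  proof -
    have "overpartitions_le l n \<inter> (?B \<union> ?C) = {}" "?B \<inter> ?C = {}"
      unfolding overpartitions_le_Suc[of l] by (auto simp: not_in_iff)
    then have "sum part_sign (overpartitions_le l n \<union> (?B \<union> ?C)) =
        signed_count l n + ((\<Sum>\<pi>\<in>?B. part_sign \<pi>) + (\<Sum>\<pi>\<in>?C. part_sign \<pi>))"
      unfolding signed_count_def using fin by (simp only: sum.union_disjoint finite_Un simp_thms)
    then show ?thesis using arg_cong[OF S, of "sum part_sign"] by (simp only: signed_count_def)
  qed
  then show ?thesis using False signed_count_single[of l n] signed_count_multiple[of l n] by simp
qed

lemma signed_count_gf:
  "Abs_fps (\<lambda>n. real_of_int (signed_count l n)) = eqpoch l * inverse (opoch l)"
proof (induction l)
  case 0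
  show ?case by (rule fps_ext) (simp add: signed_count_0)
next
  case (Suc l)
  let ?A = "\<lambda>l. Abs_fps (\<lambda>n. real_of_int (signed_count l n))"
  have "(1 + fps_X ^ Suc l) * ?A (Suc l) = (1 - fps_X ^ Suc l) * ?A l"
  proof (rule fps_ext)
    fix n
    show "((1 + fps_X ^ Suc l) * ?A (Suc l)) $ n = ((1 - fps_X ^ Suc l) * ?A l) $ n"
      using signed_count_Suc[of l n]
      by (simp add: distrib_right left_diff_distrib fps_X_power_mult_nth del: power_Suc)
  qed
  then have "?A (Suc l) = inverse (1 + fps_X ^ Suc l) * ((1 - fps_X ^ Suc l) * ?A l)"
    by (intro fps_inverse_mult_eq[symmetric]) simp_all
  then show ?case unfolding Suc eqpoch_Suc opoch_Suc fps_inverse_mult by (simp only: mult_ac)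
qed

abbreviation overpartitions_max :: "nat \<Rightarrow> nat \<Rightarrow> (nat multiset \<times> nat set) set" where
  "overpartitions_max l n \<equiv> overpartitions_le l n - overpartitions_le (l - 1) n"

lemma max_part_overpartitions:
  assumes "n > 0"
  shows "overpartitions n = (\<Union>l\<in>{1..n}. overpartitions_max l n)"
    "l \<in> {1..n} \<Longrightarrow> \<pi> \<in> overpartitions_max l n \<Longrightarrow> Max (set_mset (fst \<pi>)) = l"
proof -
  have max: "Max (set_mset (fst \<pi>)) = l" if "l \<ge> 1" "\<pi> \<in> overpartitions_max l n" for l \<pi>
  proof (rule Max_eqI)
    have h: "\<pi> \<in> overpartitions n" "\<forall>x\<in>#fst \<pi>. x \<le> l" "\<not> (\<forall>x\<in>#fst \<pi>. x \<le> l - 1)"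
      using that by (auto simp: overpartitions_le_def)
    then obtain x where "x \<in># fst \<pi>" "x > l - 1" by force
    moreover have "x \<le> l" using h calculation by auto
    ultimately have "x = l" using that(1) by simp
    then show "l \<in># fst \<pi>" using \<open>x \<in># fst \<pi>\<close> by simp
    show "\<And>y. y \<in># fst \<pi> \<Longrightarrow> y \<le> l" using h by auto
  qed simp
  then show "l \<in> {1..n} \<Longrightarrow> \<pi> \<in> overpartitions_max l n \<Longrightarrow> Max (set_mset (fst \<pi>)) = l"
    by auto
  show "overpartitions n = (\<Union>l\<in>{1..n}. overpartitions_max l n)"
  proof (intro set_eqI iffI)
    fix \<pi> assume \<pi>: "\<pi> \<in> overpartitions n"
    obtain P U where PU: "\<pi> = (P, U)" by (cases \<pi>)
    have h: "0 \<notin># P" "sum_mset P = n" using \<pi> by (auto simp: PU overpartitions_def)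
    then have ne: "P \<noteq> {#}" using assms by auto
    define l where "l = Max (set_mset P)"
    have l: "l \<in># P" "\<And>x. x \<in># P \<Longrightarrow> x \<le> l" using ne by (simp_all add: l_def)
    have "l \<le> n" using sum_mset.remove[OF l(1)] h(2) by simp
    moreover have "l \<ge> 1" using l(1) h(1) by (cases l) auto
    moreover have "\<pi> \<in> overpartitions_max l n"
      using \<pi> l \<open>l \<ge> 1\<close> by (force simp: PU overpartitions_le_def)
    ultimately show "\<pi> \<in> (\<Union>l\<in>{1..n}. overpartitions_max l n)" by auto
  next
    fix \<pi> assume "\<pi> \<in> (\<Union>l\<in>{1..n}. overpartitions_max l n)"
    then show "\<pi> \<in> overpartitions n" by (auto simp: overpartitions_le_def)
  qed
qed

text \<open>For a fixed largest part l, the parity of the rank gives the sign (-1)^l times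
  \<open>part_sign\<close>.\<close>

lemma alpha_bar_signed_count:
  assumes n: "n > 0"
  shows "alpha_bar (int n) = (\<Sum>l=1..n. (-1) ^ l * (signed_count l n - signed_count (l - 1) n))"
proof -
  let ?s = "\<lambda>\<pi>. if even (op_rank \<pi>) then 1 else (-1::int)"
  let ?D = "\<lambda>l. overpartitions_max l n"
  have sub: "overpartitions_le (l - 1) n \<subseteq> overpartitions_le l n" for l
    by (auto simp: overpartitions_le_def intro: order_trans[of _ "l - 1"])
  have "alpha_bar (int n) = (\<Sum>\<pi>\<in>overpartitions n. ?s \<pi>)"
  proof -
    have "(\<Sum>\<pi>\<in>overpartitions n. ?s \<pi>) = (\<Sum>\<pi>\<in>{\<pi> \<in> overpartitions n. even (op_rank \<pi>)}. 1) + (\<Sum>\<pi>\<in>{\<pi> \<in> overpartitions n. odd (op_rank \<pi>)}. -1)"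
      using finite_overpartitions by (simp add: sum.If_cases Int_def Collect_neg_eq[symmetric])
    then show ?thesis using n by (simp add: alpha_bar_def)
  qed
  also have "\<dots> = (\<Sum>l\<in>{1..n}. \<Sum>\<pi>\<in>?D l. ?s \<pi>)"
    unfolding max_part_overpartitions(1)[OF n]
  proof (rule sum.UNION_disjoint)
    show "\<forall>l\<in>{1..n}. \<forall>l'\<in>{1..n}. l \<noteq> l' \<longrightarrow> ?D l \<inter> ?D l' = {}"
      using max_part_overpartitions(2)[OF n] by blast
  qed (auto simp: finite_overpartitions_le)
  also have "\<dots> = (\<Sum>l=1..n. (-1) ^ l * (signed_count l n - signed_count (l - 1) n))"
  proof (rule sum.cong)
    fix l assume l: "l \<in> {1..n}"
    have "(\<Sum>\<pi>\<in>?D l. ?s \<pi>) = (\<Sum>\<pi>\<in>?D l. (-1) ^ l * part_sign \<pi>)"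
    proof (rule sum.cong)
      fix \<pi> assume "\<pi> \<in> ?D l"
      then have "op_rank \<pi> = int l - int (size (fst \<pi>))"
        using max_part_overpartitions(2)[OF n l] by (simp add: op_rank_def)
      then show "?s \<pi> = (-1) ^ l * part_sign \<pi>"
        by (auto simp: part_sign_def power_add[symmetric] minus_one_power_iff)
    qed simp
    also have "\<dots> = (-1) ^ l * (signed_count l n - signed_count (l - 1) n)"
      unfolding sum_distrib_left[symmetric] signed_count_def
      by (subst sum_diff[OF finite_overpartitions_le sub]) simp
    finally show "(\<Sum>\<pi>\<in>?D l. ?s \<pi>) = (-1) ^ l * (signed_count l n - signed_count (l - 1) n)" .
  qed simp
  finally show ?thesis .
qed

definition alpha_fps :: "real fps" where "alpha_fps = Abs_fps (\<lambda>n. real_of_int (alpha_bar (int n)))"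

text \<open>The products A_m of \<open>signed_count_gf\<close> satisfy A_(m+1) - A_m = -2 q^(m+1)
  A_m / (1 + q^(m+1)). With the sign (-1)^(m+1) of the largest part this is a Fine term times the
  common factor 2q/(1 + q).\<close>

lemma alpha_fps_fine: "alpha_fps = 1 + 2 * fps_X * inverse (1 + fps_X) * fine_sum 1"
proof (rule fps_ext)
  fix n
  let ?A = "\<lambda>l. eqpoch l * inverse (opoch l)"
  have diff: "(-1) ^ Suc m * (?A (Suc m) - ?A m) = 2 * fps_X * inverse (1 + fps_X) * fine_term 1 m" for m
  proof -
    define w where "w = inverse (opoch (Suc m))"
    have "inverse (opoch m) = (1 + fps_X ^ Suc m) * w"
      unfolding w_def by (rule inverse_factor) (simp_all add: opoch_Suc del: power_Suc)
    then have "(-1) ^ Suc m * (?A (Suc m) - ?A m) = 2 * (-1) ^ m * fps_X ^ Suc m * eqpoch m * w"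
      unfolding w_def[symmetric] eqpoch_Suc by (simp add: algebra_simps)
    moreover have "opoch_from 0 (Suc m) = opoch (Suc m)" by (simp add: opoch_from_def opoch_def)
    then have e: "opoch (Suc m) = (1 + fps_X) * opoch_from 1 m" using opoch_from_shift[of 0 m] by simp
    have "w = inverse (1 + fps_X) * inverse (opoch_from 1 m)"
      unfolding w_def e fps_inverse_mult ..
    ultimately show ?thesis by (simp add: fine_term_def mult_ac)
  qed
  have "alpha_fps $ n = (1 + (\<Sum>m<n. (-1) ^ Suc m * (?A (Suc m) - ?A m))) $ n"
  proof (cases "n = 0")
    case False
    have "alpha_fps $ n = (\<Sum>l=1..n. (-1) ^ l * (real_of_int (signed_count l n) - real_of_int (signed_count (l - 1) n)))"
      using False by (simp add: alpha_fps_def alpha_bar_signed_count)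
    also have "\<dots> = (\<Sum>m<n. (-1) ^ Suc m * (real_of_int (signed_count (Suc m) n) - real_of_int (signed_count m n)))"
      by (simp add: sum.atLeast1_atMost_eq)
    also have "\<dots> = (\<Sum>m<n. ((-1) ^ Suc m * (?A (Suc m) - ?A m)) $ n)"
    proof (rule sum.cong)
      fix m
      have pow: "((-1) ^ k * F) $ n = (-1) ^ k * (F $ n)" for k and F :: "real fps"
        by (cases "even k") simp_all
      show "(-1) ^ Suc m * (real_of_int (signed_count (Suc m) n) - real_of_int (signed_count m n)) = ((-1) ^ Suc m * (?A (Suc m) - ?A m)) $ n"
        unfolding pow signed_count_gf[symmetric] by simp
    qed simp
    finally show ?thesis using False by (simp add: fps_sum_nth)
  qed (simp add: alpha_fps_def alpha_bar_def)
  also have "\<dots> = (1 + (\<Sum>m\<le>n. 2 * fps_X * inverse (1 + fps_X) * fine_term 1 m)) $ n"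
  proof -
    have "fine_term 1 n = fps_X ^ n * ((-1) ^ n * eqpoch n * inverse (opoch_from 1 n))"
      by (simp add: fine_term_def mult_ac)
    then have "2 * fps_X * inverse (1 + fps_X) * fine_term 1 n =
        fps_X ^ Suc n * (2 * inverse (1 + fps_X) * (-1) ^ n * eqpoch n * inverse (opoch_from 1 n))"
      by (simp add: mult_ac)
    then have "(2 * fps_X * inverse (1 + fps_X) * fine_term 1 n) $ n = 0"
      by (simp only: fps_X_power_mult_nth) simp
    then show ?thesis unfolding diff lessThan_Suc_atMost[symmetric] by simp
  qed
  also have "\<dots> = (1 + 2 * fps_X * inverse (1 + fps_X) * fine_sum 1) $ n"
    unfolding fine_sum_def fps_add_nth by (simp only: fsum_mult_nth[OF vanishing_fine[OF zero_less_one] order_refl])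
  finally show "alpha_fps $ n = (1 + 2 * fps_X * inverse (1 + fps_X) * fine_sum 1) $ n" .
qed

lemma alpha_theta: "alpha_fps * theta_alt = lambert"
proof -
  have "alpha_fps * theta_alt = (theta_quotient 0 * theta_alt) * lambert"
    unfolding alpha_fps_fine fine_bailey by (simp only: mult_ac)
  then show ?thesis by (simp add: theta_quotient_theta)
qed

section \<open>Coefficients of the Lambert series\<close>

lemma inverse_square_nth:
  assumes r: "r > 0"
  shows "(inverse (1 + fps_X ^ r) ^ 2 :: real fps) $ i = (if r dvd i then (-1) ^ (i div r) * (real (i div r) + 1) else 0)"
proof -
  define H1 where "H1 = Abs_fps (\<lambda>i. if r dvd i then (-1) ^ (i div r) else (0::real))"
  define H2 where "H2 = Abs_fps (\<lambda>i. if r dvd i then (-1) ^ (i div r) * (real (i div r) + 1) else 0)"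
  have key: "(1 + fps_X ^ r) * F = F + fps_X ^ r * F" for F :: "real fps" by (simp add: distrib_right)
  have H1: "(1 + fps_X ^ r) * H1 = 1"
  proof (rule fps_ext)
    fix i
    have "r dvd i - r \<longleftrightarrow> r dvd i" "r dvd i \<Longrightarrow> i div r = Suc ((i - r) div r)" if "r \<le> i"
      using that r by (auto simp: dvd_minus_self le_div_geq)
    moreover have "\<not> r dvd i" if "i < r" "i > 0" using that by (auto dest: dvd_imp_le)
    ultimately show "((1 + fps_X ^ r) * H1) $ i = 1 $ i"
      unfolding key using r by (auto simp: H1_def fps_X_power_mult_nth not_less)
  qed
  have H2: "(1 + fps_X ^ r) * H2 = H1"
  proof (rule fps_ext)
    fix i
    have "r dvd i - r \<longleftrightarrow> r dvd i" "r dvd i \<Longrightarrow> i div r = Suc ((i - r) div r)" if "r \<le> i"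
      using that r by (auto simp: dvd_minus_self le_div_geq)
    moreover have "i div r = 0" if "i < r" using that by simp
    ultimately show "((1 + fps_X ^ r) * H2) $ i = H1 $ i"
      unfolding key using r by (auto simp: H1_def H2_def fps_X_power_mult_nth not_less algebra_simps)
  qed
  have u: "(1 + fps_X ^ r :: real fps) $ 0 = 1" using r by simp
  have "inverse (1 + fps_X ^ r) = H1" using fps_inverse_mult_eq[OF H1 u] by simp
  moreover have "inverse (1 + fps_X ^ r) * H1 = H2" by (rule fps_inverse_mult_eq[OF H2 u])
  ultimately have "inverse (1 + fps_X ^ r) ^ 2 = H2" by (simp add: power2_eq_square)
  then show ?thesis by (simp add: H2_def)
qed

text \<open>The r-th term reaches q^n exactly if n = r y with y > r. Then n - r^2 - r = r (y - r -
  1), and the coefficient of the inverse square there is y - r up to sign.\<close>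

lemma lambert_nth:
  assumes n: "n > 0"
  shows "lambert $ n = - 8 * (\<Sum>x | x dvd n \<and> x < n div x. (-1) ^ (n div x) * (real (n div x) - real x))"
proof -
  let ?X = "{x. x dvd n \<and> x < n div x}"
  let ?u = "\<lambda>r. if r = 0 then 1 else 8 * (-1) ^ r * fps_X ^ (r^2 + r) * inverse (1 + fps_X ^ r) ^ 2 :: real fps"
  have coeff: "?u r $ n = (if r \<in> ?X then - 8 * ((-1) ^ (n div r) * (real (n div r) - real r)) else 0)" for r
  proof (cases "r = 0")
    case False
    have pow: "(8 * (-1) ^ r * F) $ n = 8 * (-1) ^ r * (F $ n)" for F :: "real fps"
      by (cases "even r") (simp_all add: numeral_fps_const)
    have "?u r $ n = 8 * (-1) ^ r * ((fps_X ^ (r^2 + r) * inverse (1 + fps_X ^ r) ^ 2) $ n)"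
      using False pow by (simp add: mult.assoc)
    also have "(fps_X ^ (r^2 + r) * inverse (1 + fps_X ^ r) ^ 2 :: real fps) $ n =
        (if n < r^2 + r then 0 else if r dvd (n - (r^2 + r)) then (-1) ^ ((n - (r^2 + r)) div r) * (real ((n - (r^2 + r)) div r) + 1) else 0)"
      using False by (simp add: fps_X_power_mult_nth inverse_square_nth)
    also have "8 * (-1) ^ r * \<dots> = (if r \<in> ?X then - 8 * ((-1) ^ (n div r) * (real (n div r) - real r)) else 0)"
    proof (cases "r dvd n")
      case True
      then obtain y where y: "n = r * y" by (elim dvdE)
      have ny: "n div r = y" using False y by simp
      show ?thesis
      proof (cases "r < y")
        case True
        then obtain j where j: "y = r + Suc j" by (auto simp: less_iff_Suc_add)
        have "n = (r^2 + r) + r * j" by (simp add: y j power2_eq_square algebra_simps)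
        then have "\<not> n < r^2 + r" "n - (r^2 + r) = r * j" by simp_all
        moreover have "(-1::real) ^ r * (-1) ^ j = - ((-1) ^ y)" by (simp add: j power_add)
        ultimately show ?thesis using False \<open>r dvd n\<close> True ny by (simp add: j mult.assoc[symmetric])
      next
        case False
        have "r * y \<le> r * r" using False by simp
        then have "n < r^2 + r" using y \<open>r \<noteq> 0\<close> unfolding power2_eq_square by linarith
        then show ?thesis using False ny by simp
      qed
    next
      case nd: False
      have "\<not> r dvd (n - (r^2 + r))" if "\<not> n < r^2 + r"
      proof
        assume "r dvd (n - (r^2 + r))"
        moreover have "r dvd r^2 + r" by (simp add: power2_eq_square)
        ultimately have "r dvd (n - (r^2 + r)) + (r^2 + r)" by (rule dvd_add)
        then show False using nd that by simp
      qed
      then show ?thesis using nd by simp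
    qed
    finally show ?thesis .
  qed (use n in simp)
  have "lambert $ n = (\<Sum>r\<le>n. ?u r) $ n"
    unfolding lambert_def by (rule fsum_nth[OF vanishing_lambert order_refl])
  also have "\<dots> = (\<Sum>r\<le>n. if r \<in> ?X then - 8 * ((-1) ^ (n div r) * (real (n div r) - real r)) else 0)"
    unfolding fps_sum_nth by (rule sum.cong[OF refl coeff])
  also have "\<dots> = (\<Sum>r\<in>{..n} \<inter> ?X. - 8 * ((-1) ^ (n div r) * (real (n div r) - real r)))"
    by (simp only: sum.inter_restrict[OF finite_atMost])
  also have "{..n} \<inter> ?X = ?X" using n by (auto dest: dvd_imp_le)
  finally show ?thesis by (simp add: sum_distrib_left)
qed

theorem alpha_bar_theta_sum:
  assumes n: "n > 0"
  shows "alpha_bar (int n) + 2 * (\<Sum>r | r \<ge> 1 \<and> r^2 \<le> n. (-1) ^ r * alpha_bar (int (n - r^2))) =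
    - 8 * (\<Sum>x | x dvd n \<and> x < n div x. (-1) ^ (n div x) * (int (n div x) - int x))"
proof -
  let ?u = "\<lambda>r. if r = 0 then 1 else 2 * (-1) ^ r * fps_X ^ (r^2) :: real fps"
  let ?S = "{r. r \<ge> 1 \<and> r^2 \<le> n}"
  let ?g = "\<lambda>r. 2 * (-1) ^ r * real_of_int (alpha_bar (int (n - r^2)))"
  have S: "?S \<subseteq> {1..n}" by (auto intro: order_trans[OF power2_nat_le_imp_le])
  have coeff: "(alpha_fps * ?u r) $ n = (if r = 0 then alpha_fps $ n else if r \<in> ?S then ?g r else 0)" for r
  proof (cases "r = 0")
    case False
    have "(alpha_fps * ?u r) $ n = (fps_X ^ (r^2) * (2 * (-1) ^ r * alpha_fps)) $ n" using False by (simp add: mult_ac)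
    also have "\<dots> = (if n < r^2 then 0 else (2 * (-1) ^ r * alpha_fps) $ (n - r^2))" by (simp add: fps_X_power_mult_nth)
    also have "\<dots> = (if r \<in> ?S then ?g r else 0)"
      using False by (cases "even r") (auto simp: alpha_fps_def numeral_fps_const)
    finally show ?thesis using False by simp
  qed simp
  have "(alpha_fps * theta_alt) $ n = (\<Sum>r\<le>n. alpha_fps * ?u r) $ n"
    unfolding theta_alt_def by (rule fsum_mult_nth[OF vanishing_theta order_refl])
  also have "\<dots> = (\<Sum>r\<le>n. if r = 0 then alpha_fps $ n else if r \<in> ?S then ?g r else 0)"
    unfolding fps_sum_nth by (rule sum.cong[OF refl coeff])
  also have "{..n} = insert 0 {1..n}" by auto
  also have "(\<Sum>r\<in>insert 0 {1..n}. if r = 0 then alpha_fps $ n else if r \<in> ?S then ?g r else 0) =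
      alpha_fps $ n + (\<Sum>r\<in>{1..n}. if r \<in> ?S then ?g r else 0)"
    by (subst sum.insert) (auto intro!: sum.cong)
  also have "(\<Sum>r\<in>{1..n}. if r \<in> ?S then ?g r else 0) = (\<Sum>r\<in>?S. ?g r)"
    using S by (subst sum.inter_restrict[symmetric]) (auto intro!: sum.cong)
  finally have "real_of_int (alpha_bar (int n)) + (\<Sum>r\<in>?S. ?g r) =
      - 8 * (\<Sum>x | x dvd n \<and> x < n div x. (-1) ^ (n div x) * (real (n div x) - real x))"
    unfolding alpha_theta lambert_nth[OF n] by (simp add: alpha_fps_def)
  then have "real_of_int (alpha_bar (int n) + 2 * (\<Sum>r\<in>?S. (-1) ^ r * alpha_bar (int (n - r^2)))) =
    real_of_int (- 8 * (\<Sum>x | x dvd n \<and> x < n div x. (-1) ^ (n div x) * (int (n div x) - int x)))"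
    by (simp add: sum_distrib_left mult.assoc)
  then show ?thesis by (simp only: of_int_eq_iff)
qed

section \<open>Divisor sums\<close>

definition even_triples :: "int \<Rightarrow> (int \<times> int \<times> int) set" where
  "even_triples m = {(p, q, r). cone_weight p q r > 0 \<and> even (p - q) \<and> p * q + q * r + r * p = m}"

definition triple_weight :: "int \<Rightarrow> int" where
  "triple_weight m = (\<Sum>(p, q, r)\<in>even_triples m. cone_weight p q r)"

lemma cone_weight_nonneg: "cone_weight p q r \<ge> 0"
  by (simp add: cone_weight_def)

lemma even_triples_bound:
  assumes "(p, q, r) \<in> even_triples m"
  shows "p \<in> {0..m}" "q \<in> {0..m}" "r \<in> {0..m}" "m > 0"
proof -
  have h: "p \<ge> 0" "q \<ge> 0" "r \<ge> 0" "p + q > 0" "q + r > 0" "r + p > 0" and m: "p * q + q * r + r * p = m"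
    using assms by (auto simp: even_triples_def cone_weight_def split: if_splits)
  have le: "x * 1 \<le> x * (y + z)" "y * z \<ge> 0" if "x \<ge> 0" "y \<ge> 0" "z \<ge> 0" "y + z > 0" for x y z :: int
    using that mult_left_mono[of 1 "y + z" x] by simp_all
  have "p \<le> m" using le[OF h(1,2,3,5)] m by (simp add: algebra_simps)
  moreover have "q \<le> m" using le[OF h(2,3,1,6)] m by (simp add: algebra_simps)
  moreover have "r \<le> m" using le[OF h(3,1,2,4)] m by (simp add: algebra_simps)
  ultimately show "p \<in> {0..m}" "q \<in> {0..m}" "r \<in> {0..m}" "m > 0" using h by auto
qed

lemma finite_even_triples: "finite (even_triples m)"
  by (rule finite_subset[of _ "{0..m} \<times> {0..m} \<times> {0..m}"]) (use even_triples_bound in \<open>force, simp\<close>)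

lemma triple_weight_nonneg: "triple_weight m \<ge> 0"
  unfolding triple_weight_def by (rule sum_nonneg) (auto simp: cone_weight_nonneg)

lemma triple_weight_nonpos: "m \<le> 0 \<Longrightarrow> triple_weight m = 0"
  unfolding triple_weight_def by (rule sum.neutral) (use even_triples_bound(4) in force)

lemma abs_le_of_square:
  assumes "s^2 \<le> int n"
  shows "\<bar>s\<bar> \<le> int n"
proof -
  have "int n \<le> (int n)^2" using self_le_power[of "int n" 2] by (cases "n = 0") simp_all
  then have "s^2 \<le> (int n)^2" using assms by (rule order_trans[rotated])
  then show ?thesis by (simp add: abs_le_square_iff[symmetric])
qed

text \<open>The matrix (p+r, s-r; -s-r, q+r) has determinant pq + qr + rp + s^2 and cone parameters
  2p, 2q, 2r, on which \<open>cone_weight\<close> has the same value as on p, q, r. Even b - c makes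
  r and s integral, and even a - d says that p - q is even.\<close>

lemma triple_weight_sum:
  "(\<Sum>s\<in>{-int n..int n}. triple_weight (int n - s^2)) =
    (\<Sum>v\<in>Dset n (\<lambda>(a, b, c, d). even (a - d) \<and> even (b - c)). on_quad sector v)"
proof -
  let ?D = "Dset n (\<lambda>(a, b, c, d). even (a - d) \<and> even (b - c))"
  let ?S = "Sigma {-int n..int n} (\<lambda>s. even_triples (int n - s^2))"
  let ?f = "\<lambda>(s, p, q, r). (p + r, s - r, - s - r, q + r)"
  let ?g = "\<lambda>(a, b, c, d). ((b - c) div 2, (a - (- (b + c)) div 2, d - (- (b + c)) div 2, (- (b + c)) div 2))"
  have "(\<Sum>s\<in>{-int n..int n}. triple_weight (int n - s^2)) = (\<Sum>x\<in>?S. case snd x of (p, q, r) \<Rightarrow> cone_weight p q r)"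
    unfolding triple_weight_def by (subst sum.Sigma) (auto simp: finite_even_triples case_prod_unfold)
  also have "\<dots> = (\<Sum>v\<in>?D. on_quad sector v)"
  proof (rule sum.reindex_bij_witness[of _
        ?g
        ?f])
    fix x assume "x \<in> ?S"
    then obtain s p q r where x: "x = (s, p, q, r)" and h: "cone_weight p q r > 0" "even (p - q)" "p * q + q * r + r * p = int n - s^2"
      by (cases x) (auto simp: even_triples_def)
    have sec: "sector (p + r) (s - r) (- s - r) (q + r) = cone_weight p q r"
      by (simp add: sector_def cone_weight_def)
    have "(s - r - (- s - r)) div 2 = s" "(- (s - r + (- s - r))) div 2 = r" by simp_all
    then show "?g
        (?f x) = x"
      unfolding x prod.case by simp
    have "(p + r) * (q + r) - (s - r) * (- s - r) = int n" using h(3) by (simp add: algebra_simps power2_eq_square)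
    moreover have "even (p + r - (q + r))" "even (s - r - (- s - r))" using h(2) by simp_all
    ultimately show "?f x \<in> ?D"
      using h(1) sec unfolding x prod.case Dset_def by auto
    show "on_quad sector (?f x) = (case snd x of (p, q, r) \<Rightarrow> cone_weight p q r)"
      using sec by (simp add: x)
  next
    fix v assume "v \<in> ?D"
    then obtain a b c d where v: "v = (a, b, c, d)" and h: "sector a b c d > 0" "a * d - b * c = int n" "even (a - d)" "even (b - c)"
      by (cases v) (auto simp: Dset_def)
    have "even (b + c)" using h(4) by simp
    then obtain t where t: "b + c = 2 * t" by (elim evenE)
    obtain s where s: "b - c = 2 * s" using h(4) by (elim evenE)
    have bc: "b = s + t" "c = t - s" using s t by simp_all
    have st: "(b - c) div 2 = s" "(- (b + c)) div 2 = - t" by (simp_all add: bc)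
    have sec: "cone_weight (a + t) (d + t) (- t) = sector a b c d" by (simp add: bc sector_def cone_weight_def)
    have e: "(a + t) * (d + t) + (d + t) * (- t) + (- t) * (a + t) = int n - s^2"
      using h(2) by (simp add: bc algebra_simps power2_eq_square)
    have mem: "(a + t, d + t, - t) \<in> even_triples (int n - s^2)"
      using h(1,3) sec e by (simp add: even_triples_def)
    then have "s^2 \<le> int n" using even_triples_bound(4) by force
    then have "\<bar>s\<bar> \<le> int n" by (rule abs_le_of_square)
    then show "?g v \<in> ?S"
      using mem unfolding v prod.case st by auto
    show "?f
        (?g v) = v"
      unfolding v prod.case st by (simp add: bc)
  qed
  finally show ?thesis .
qed

lemma odd_triples_nonpos: "m \<le> 0 \<Longrightarrow> odd_triples m = {}"
proof -
  have "p * q + q * r + r * p > 0" if "p > 0" "q > 0" "r > 0" for p q r :: int using that by (simp add: add_pos_pos)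
  then show "m \<le> 0 \<Longrightarrow> odd_triples m = {}" unfolding odd_triples_def by force
qed

text \<open>Here p, q, r are the cone parameters themselves and t = b - c, so that 4(ad - bc) = pq +
  qr + rp + t^2; t, p, q, r all have the parity of b - c.\<close>

lemma odd_triples_sum:
  "(\<Sum>t\<in>{t\<in>{-2 * int n..2 * int n}. odd t}. card (odd_triples (4 * int n - t^2))) =
    card (Dset n (\<lambda>(a, b, c, d). odd (b - c)))"
proof -
  let ?D = "Dset n (\<lambda>(a, b, c, d). odd (b - c))"
  let ?S = "Sigma {t\<in>{-2 * int n..2 * int n}. odd t} (\<lambda>t. odd_triples (4 * int n - t^2))"
  let ?f = "\<lambda>(t, p, q, r). ((p + r) div 2, (t - r) div 2, (- t - r) div 2, (q + r) div 2)"
  let ?g = "\<lambda>(a, b, c, d). (b - c, (a + a + b + c, d + d + b + c, - b - c))"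
  have fin: "finite {t\<in>{-2 * int n..2 * int n}. odd t}" by (rule finite_subset[of _ "{-2 * int n..2 * int n}"]) auto
  have "(\<Sum>t\<in>{t\<in>{-2 * int n..2 * int n}. odd t}. card (odd_triples (4 * int n - t^2))) = card ?S"
    using card_SigmaI[OF fin, of "\<lambda>t. odd_triples (4 * int n - t^2)"] finite_odd_triples by simp
  also have "\<dots> = (\<Sum>x\<in>?S. 1)" by simp
  also have "\<dots> = (\<Sum>v\<in>?D. 1)"
  proof (rule sum.reindex_bij_witness[of _
        ?g
        ?f])
    fix x assume "x \<in> ?S"
    then obtain t p q r where x: "x = (t, p, q, r)" and h: "odd t" "odd p" "odd q" "odd r" "p > 0" "q > 0" "r > 0"
        "p * q + q * r + r * p = 4 * int n - t^2"
      by (cases x) (auto simp: odd_triples_def)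
    have "even (p + r)" "even (q + r)" "even (t - r)" using h by simp_all
    then obtain a d b where abd: "p + r = 2 * a" "q + r = 2 * d" "t - r = 2 * b" by (metis evenE)
    have e: "p = 2 * a - r" "q = 2 * d - r" "t = 2 * b + r" "- t - r = 2 * (- b - r)" using abd by simp_all
    have dv: "(p + r) div 2 = a" "(t - r) div 2 = b" "(- t - r) div 2 = - b - r" "(q + r) div 2 = d"
      unfolding abd e(4) by simp_all
    show "?g
        (?f x) = x"
      unfolding x prod.case dv by (simp add: e(1-3))
    have "4 * (a * d - b * (- b - r)) = 4 * int n"
      using h(8) unfolding e(1-3) by (simp add: algebra_simps power2_eq_square)
    moreover have "a + a + b + (- b - r) = p" "d + d + b + (- b - r) = q" "- b - (- b - r) = r" by (simp_all add: e(1-3))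
    then have "sector a b (- b - r) d > 0" using h(5-7) unfolding sector_def by (simp add: cone_weight_def)
    moreover have "odd (b - (- b - r))" using h(4) by simp
    ultimately show "?f x \<in> ?D"
      unfolding x prod.case dv Dset_def by simp
  next
    fix v assume "v \<in> ?D"
    then obtain a b c d where v: "v = (a, b, c, d)" and h: "sector a b c d > 0" "a * d - b * c = int n" "odd (b - c)"
      by (cases v) (auto simp: Dset_def)
    let ?p = "a + a + b + c" and ?q = "d + d + b + c" and ?r = "- b - c"
    have o: "odd ?p" "odd ?q" "odd ?r" using h(3) by simp_all
    have "x \<noteq> 0" if "odd x" for x :: int using that by auto
    then have "?p \<noteq> 0" "?q \<noteq> 0" "?r \<noteq> 0" using o by blast+
    then have pos: "?p > 0" "?q > 0" "?r > 0" using h(1) unfolding sector_def cone_weight_def by (auto split: if_splits)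
    have "?p * ?q + ?q * ?r + ?r * ?p + (b - c)^2 = 4 * (a * d - b * c)" by (simp add: algebra_simps power2_eq_square)
    then have mem: "(?p, ?q, ?r) \<in> odd_triples (4 * int n - (b - c)^2)" using o pos h(2) by (simp add: odd_triples_def)
    then have "(b - c)^2 \<le> 4 * int n" using odd_triples_nonpos[of "4 * int n - (b - c)^2"] by force
    also have "\<dots> \<le> (2 * int n)^2" using self_le_power[of "int n" 2] by (cases "n = 0") (simp_all add: power_mult_distrib)
    finally have "\<bar>b - c\<bar> \<le> \<bar>2 * int n\<bar>" by (rule abs_le_square_iff[THEN iffD2])
    then show "?g v \<in> ?S"
      using mem h(3) unfolding v prod.case by auto
    show "?f
        (?g v) = v"
    proof -
      have "?p + ?r = 2 * a" "b - c - ?r = 2 * b" "- (b - c) - ?r = 2 * c" "?q + ?r = 2 * d" by simp_all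
      then show ?thesis unfolding v prod.case by (simp only: nonzero_mult_div_cancel_left)
    qed
  qed simp
  finally show ?thesis by simp
qed

lemma hurwitz_class_number_theta_sum:
  assumes n: "n > 0"
  shows "3 * (\<Sum>\<^sub>\<infinity>r\<in>{r::int. odd r}. hurwitz_class_number (4 * int n - r^2)) =
    real (card (Dset n (\<lambda>(a, b, c, d). odd (b - c))))"
proof -
  let ?H = "\<lambda>r::int. hurwitz_class_number (4 * int n - r^2)"
  let ?I = "{t\<in>{-2 * int n..2 * int n}. odd t}"
  have H: "3 * ?H t = real (card (odd_triples (4 * int n - t^2)))" if "odd t" for t
  proof -
    have odd: "odd (4 * int n - t^2)" using that by simp
    show ?thesis
    proof (cases "4 * int n - t^2 > 0")
      case True
      then show ?thesis by (rule hurwitz_class_number_odd[OF odd])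
    next
      case False
      moreover have "4 * int n - t^2 \<noteq> 0" using odd by (metis even_zero)
      ultimately have "4 * int n - t^2 < 0" by linarith
      then show ?thesis using odd_triples_nonpos[of "4 * int n - t^2"] by (simp add: hurwitz_class_number_def)
    qed
  qed
  have "?H t = 0" if "t \<notin> {-2 * int n..2 * int n}" for t
  proof -
    have "\<bar>2 * int n\<bar> < \<bar>t\<bar>" using that by auto
    then have "(2 * int n)^2 < t^2" by (meson abs_le_square_iff not_le)
    moreover have "4 * int n \<le> (2 * int n)^2" using self_le_power[of "int n" 2] n by (simp add: power_mult_distrib)
    ultimately have "4 * int n - t^2 < 0" by linarith
    then show ?thesis by (simp add: hurwitz_class_number_def)
  qed
  then have "infsum ?H {r. odd r} = infsum ?H ?I" by (intro infsum_cong_neutral) auto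
  also have "\<dots> = (\<Sum>t\<in>?I. ?H t)"
    by (intro infsum_finite finite_subset[of ?I "{-2 * int n..2 * int n}"]) auto
  finally have "3 * infsum ?H {r. odd r} = (\<Sum>t\<in>?I. 3 * ?H t)" by (simp only: sum_distrib_left)
  also have "\<dots> = (\<Sum>t\<in>?I. real (card (odd_triples (4 * int n - t^2))))" using H by (intro sum.cong) auto
  finally show ?thesis unfolding odd_triples_sum[symmetric] by simp
qed

section \<open>Divisor sums over factorisations n = x y\<close>

definition divisor_sum :: "nat \<Rightarrow> (nat \<Rightarrow> nat \<Rightarrow> real) \<Rightarrow> real" where
  "divisor_sum n F = (\<Sum>x | x dvd n. F x (n div x))"

lemma divisor_sum_add: "divisor_sum n F + divisor_sum n G = divisor_sum n (\<lambda>x y. F x y + G x y)"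
  and divisor_sum_mult: "c * divisor_sum n F = divisor_sum n (\<lambda>x y. c * F x y)"
  by (simp_all add: divisor_sum_def sum.distrib sum_distrib_left)

lemma divisor_sum_swap:
  assumes n: "n > 0"
  shows "divisor_sum n F = divisor_sum n (\<lambda>x y. F y x)"
  unfolding divisor_sum_def
  by (rule sum.reindex_bij_witness[of _ "\<lambda>x. n div x" "\<lambda>x. n div x"]) (use n in auto)

text \<open>Exchanging x and n/x preserves the sum, so only the symmetrised summand matters.
  Identities become checks by order and parity of x and y.\<close>

lemma divisor_sum_eqI:
  assumes n: "n > 0" and eq: "\<And>x y. x * y = n \<Longrightarrow> F x y + F y x = G x y + G y x"
  shows "divisor_sum n F = divisor_sum n G"
proof -
  have "divisor_sum n F + divisor_sum n (\<lambda>x y. F y x) = divisor_sum n G + divisor_sum n (\<lambda>x y. G y x)"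
    unfolding divisor_sum_add unfolding divisor_sum_def by (rule sum.cong) (auto intro!: eq)
  then show ?thesis using divisor_sum_swap[OF n, of F] divisor_sum_swap[OF n, of G] by simp
qed

lemma sum_divisors_if:
  assumes n: "n > 0"
  shows "(\<Sum>x | x dvd n \<and> Q x (n div x). F x (n div x)) = divisor_sum n (\<lambda>x y. if Q x y then F x y else 0)"
  unfolding divisor_sum_def using n by (simp add: sum.inter_filter[symmetric])

lemma co_sum_divisor_sum:
  assumes n: "n > 0"
  shows "real (co_sum n Q) = divisor_sum n (\<lambda>x y. if Q x y then real x else 0)"
  unfolding sum_divisors_if[OF n, symmetric] by simp

lemma square_root_divisor_sum:
  assumes n: "n > 0"
  shows "(if \<exists>k. n = k^2 then real (THE k. n = k^2) else 0) = divisor_sum n (\<lambda>x y. if x = y then real x else 0)"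
proof (cases "\<exists>k. n = k^2")
  case True
  then obtain k where k: "n = k^2" by blast
  have "x = k" if "n = x^2" for x :: nat using that k by simp
  then have the: "(THE k. n = k^2) = k" using k by (intro the_equality) auto
  have e: "{x. x dvd n \<and> x = n div x} = {k}"
  proof -
    have "x = k" if "x dvd n" "x = n div x" for x
    proof -
      have "x * x = n" using dvd_mult_div_cancel[OF that(1)] that(2) by simp
      then show ?thesis using k by (simp add: power2_eq_square[symmetric])
    qed
    moreover have "k \<noteq> 0" using n unfolding k by simp
    ultimately show ?thesis using k by (auto simp: power2_eq_square)
  qed
  show ?thesis unfolding sum_divisors_if[OF n, symmetric] e the using True by simp
next
  case False
  have "x * x = n" if "x dvd n" "x = n div x" for x using dvd_mult_div_cancel[OF that(1)] that(2) by simp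
  then have e: "{x. x dvd n \<and> x = n div x} = {}" using False unfolding power2_eq_square by blast
  show ?thesis unfolding sum_divisors_if[OF n, symmetric] e using False by simp
qed

text \<open>Doubling maps the divisors with even codivisor onto the even divisors. Symmetrisation
  does not see this relation, so later identities add a multiple of it.\<close>

lemma even_divisor_balance:
  assumes n: "n > 0"
  shows "divisor_sum n (\<lambda>x y. (if even x then real x else 0) - 2 * (if even y then real x else 0)) = 0"
proof -
  have "(\<Sum>x | x dvd n \<and> even x. real x) = (\<Sum>x | x dvd n \<and> even (n div x). 2 * real x)"
  proof (rule sum.reindex_bij_witness[of _ "\<lambda>x. 2 * x" "\<lambda>x. x div 2"])
    fix x assume "x \<in> {x. x dvd n \<and> even x}"
    then obtain u y where u: "x = 2 * u" "n = 2 * u * y" by (auto elim!: evenE dvdE)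
    then have "n div u = 2 * y" using n by simp
    then show "x div 2 \<in> {x. x dvd n \<and> even (n div x)}" "2 * (x div 2) = x" "2 * real (x div 2) = real x" using u by auto
  next
    fix x assume "x \<in> {x. x dvd n \<and> even (n div x)}"
    then have "x * (n div x) = n" "even (n div x)" by auto
    then obtain y where "n = x * (2 * y)" by (metis evenE)
    then show "2 * x \<in> {x. x dvd n \<and> even x}" "2 * x div 2 = x" by auto
  qed
  then have "divisor_sum n (\<lambda>x y. if even x then real x else 0) = 2 * divisor_sum n (\<lambda>x y. if even y then real x else 0)"
    unfolding sum_divisors_if[OF n, symmetric] by (simp add: sum_distrib_left)
  then show ?thesis unfolding divisor_sum_mult unfolding divisor_sum_def by (simp add: sum_subtractf)
qed

lemma sigma1_half:
  assumes n: "n > 0" "even n"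
  shows "real (sigma1 (n div 2)) = divisor_sum n (\<lambda>x y. if even y then real x else 0)"
proof -
  have "x dvd n div 2 \<longleftrightarrow> x dvd n \<and> even (n div x)" for x
  proof
    assume "x dvd n div 2"
    then obtain y where "n div 2 = x * y" by (elim dvdE)
    then have y: "n = x * (2 * y)" using n(2) by auto
    then have "n div x = 2 * y" using n(1) by simp
    then show "x dvd n \<and> even (n div x)" using y by simp
  next
    assume "x dvd n \<and> even (n div x)"
    then have "x * (n div x) = n" "even (n div x)" by auto
    then obtain y where "n = x * (2 * y)" by (metis evenE)
    then show "x dvd n div 2" by simp
  qed
  then show ?thesis unfolding sum_divisors_if[OF n(1), symmetric] sigma1_def by simp
qed

lemma lambda1_divisor_sum: "lambda1 n = 1 / 2 * divisor_sum n (\<lambda>x y. real (min x y))"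
  by (simp add: lambda1_def divisor_sum_def)

text \<open>Doubling maps the divisors of n/4 onto the even divisors of n with even codivisor, and
  the minimum doubles. With the 1/2 in \<open>lambda1\<close> this gives 1/4.\<close>

lemma lambda1_quarter:
  assumes n: "n > 0"
  shows "(if 4 dvd n then lambda1 (n div 4) else 0) =
    1 / 4 * divisor_sum n (\<lambda>x y. if even x \<and> even y then real (min x y) else 0)"
proof (cases "4 dvd n")
  case True
  then obtain m where m: "n = 4 * m" by (elim dvdE)
  then have m0: "m > 0" using n by simp
  have "(\<Sum>x | x dvd m. 2 * real (min x (m div x))) = (\<Sum>x | x dvd n \<and> even x \<and> even (n div x). real (min x (n div x)))"
  proof (rule sum.reindex_bij_witness[of _ "\<lambda>x. x div 2" "\<lambda>x. 2 * x"])
    fix x assume "x \<in> {x. x dvd m}"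
    then obtain y where y: "m = x * y" by auto
    have "n = 2 * x * (2 * y)" by (simp add: m y)
    moreover from this have "n div (2 * x) = 2 * y" using n by simp
    moreover have "m div x = y" using y m0 by simp
    ultimately show "2 * x div 2 = x" "2 * x \<in> {x. x dvd n \<and> even x \<and> even (n div x)}"
      "real (min (2 * x) (n div (2 * x))) = 2 * real (min x (m div x))" by (auto simp: min_def)
  next
    fix x assume "x \<in> {x. x dvd n \<and> even x \<and> even (n div x)}"
    then have "x * (n div x) = n" "even x" "even (n div x)" by auto
    then obtain u y where "n = x * (2 * y)" "x = 2 * u" by (metis evenE)
    then show "2 * (x div 2) = x" "x div 2 \<in> {x. x dvd m}" using m by auto
  qed
  then show ?thesis using True sum_divisors_if[OF n, of "\<lambda>x y. real (min x y)" "\<lambda>x y. even x \<and> even y"] m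
    by (simp add: lambda1_def sum_distrib_left[symmetric])
next
  case False
  have "\<not> (even x \<and> even (n div x))" if "x dvd n" for x
  proof
    assume "even x \<and> even (n div x)"
    then have "2 * 2 dvd x * (n div x)" by (intro mult_dvd_mono) auto
    then show False using that False by simp
  qed
  then have "divisor_sum n (\<lambda>x y. if even x \<and> even y then real (min x y) else 0) = 0"
    unfolding divisor_sum_def by (intro sum.neutral) auto
  then show ?thesis using False by simp
qed

text \<open>The divisor sum of \<open>sector_count_even\<close>; its last summand is the term 8k for
  n = k^2, while the constant 2 is kept apart.\<close>

definition cone_divisor_sum :: "nat \<Rightarrow> real" where
  "cone_divisor_sum n = divisor_sum n (\<lambda>x y. 8 * (if even (x + y) then real x else 0) + 4 * (if even x then real x else 0)
     - 16 * (if x \<le> y \<and> even (x + y) then real x else 0) + 8 * (if x = y then real x else 0))"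

lemma triple_weight_theta_sum:
  assumes n: "n > 0"
  shows "real_of_int (2 * (\<Sum>s\<in>{-int n..int n}. triple_weight (int n - s^2))) =
    cone_divisor_sum n + (if \<exists>k. n = k^2 then 2 else 0)"
proof -
  let ?c = "\<lambda>Q. divisor_sum n (\<lambda>x y. if Q x y then real x else 0)"
  have "cone_divisor_sum n = 8 * ?c (\<lambda>x y. even (x + y)) + 4 * ?c (\<lambda>x y. even x) + (- 16) * ?c (\<lambda>x y. x \<le> y \<and> even (x + y)) + 8 * ?c (\<lambda>x y. x = y)"
    unfolding divisor_sum_mult divisor_sum_add cone_divisor_sum_def by (simp only: minus_mult_left diff_conv_add_uminus)
  then show ?thesis
    unfolding triple_weight_sum sector_count_even[OF n] square_root_divisor_sum[OF n, symmetric] co_sum_divisor_sum[OF n, symmetric]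
    by simp
qed

lemma alternating_divisor_sum:
  assumes n: "n > 0"
  shows "8 * (-1) ^ n * (\<Sum>x | x dvd n \<and> x < n div x. (-1) ^ (n div x) * (real (n div x) - real x)) = cone_divisor_sum n"
proof -
  let ?K = "\<lambda>x y. (if even x then real x else 0) - 2 * (if even y then real x else 0)"
  have "8 * (-1) ^ n * (\<Sum>x | x dvd n \<and> x < n div x. (-1) ^ (n div x) * (real (n div x) - real x)) =
     divisor_sum n (\<lambda>x y. 8 * (-1) ^ n * (if x < y then (-1) ^ y * (real y - real x) else 0))"
    by (simp only: sum_divisors_if[OF n, of "\<lambda>x y. (-1) ^ y * (real y - real x)" "\<lambda>x y. x < y"] divisor_sum_mult)
  \<comment> \<open>The added sum is 0 by \<open>even_divisor_balance\<close>; the multiple 4 makes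
    the symmetrised summands agree when x or y is even.\<close>
  also have "\<dots> = cone_divisor_sum n + 4 * divisor_sum n ?K"
    unfolding cone_divisor_sum_def divisor_sum_mult divisor_sum_add
  proof (rule divisor_sum_eqI[OF n])
    fix x y assume "x * y = n"
    then have "(-1::real) ^ n = (if even x \<or> even y then 1 else -1)" by (auto simp: minus_one_power_iff)
    then show "8 * (-1) ^ n * (if x < y then (-1) ^ y * (real y - real x) else 0) + 8 * (-1) ^ n * (if y < x then (-1) ^ x * (real x - real y) else 0) =
       8 * (if even (x + y) then real x else 0) + 4 * (if even x then real x else 0) - 16 * (if x \<le> y \<and> even (x + y) then real x else 0) + 8 * (if x = y then real x else 0) + 4 * ?K x y +
       (8 * (if even (y + x) then real y else 0) + 4 * (if even y then real y else 0) - 16 * (if y \<le> x \<and> even (y + x) then real y else 0) + 8 * (if y = x then real y else 0) + 4 * ?K y x)"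
      by (cases "even x"; cases "even y"; cases x y rule: linorder_cases) simp_all
  qed
  finally show ?thesis by (simp add: even_divisor_balance[OF n])
qed

section \<open>Comparison of the two convolutions\<close>

lemma sum_symmetric_interval:
  fixes f :: "int \<Rightarrow> 'a :: comm_semiring_1"
  assumes "\<And>s. f (- s) = f s"
  shows "(\<Sum>s\<in>{-int n..int n}. f s) = f 0 + 2 * (\<Sum>r=1..n. f (int r))"
proof (induction n)
  case (Suc n)
  have "{-int (Suc n)..int (Suc n)} = insert (int (Suc n)) (insert (- int (Suc n)) {-int n..int n})" by auto
  then have "(\<Sum>s\<in>{-int (Suc n)..int (Suc n)}. f s) = f (int (Suc n)) + (f (- int (Suc n)) + (\<Sum>s\<in>{-int n..int n}. f s))" by simp
  then show ?case unfolding assms Suc by (simp add: algebra_simps mult_2)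
qed simp

lemma square_indicator_sum:
  fixes n :: nat
  assumes n: "n > 0"
  shows "(\<Sum>r=1..n. if r^2 = n then 1 else 0 :: int) = (if \<exists>k. n = k^2 then 1 else 0)"
proof (cases "\<exists>k. n = k^2")
  case True
  then obtain k where k: "n = k^2" by blast
  have "k \<noteq> 0" using n unfolding k by simp
  then have "k \<in> {1..n}" using k by (simp add: power2_nat_le_imp_le)
  moreover have "r^2 = n \<longleftrightarrow> r = k" for r using k by simp
  ultimately show ?thesis using True by simp
next
  case False
  then have "(\<Sum>r=1..n. if r^2 = n then 1 else 0 :: int) = 0" by (intro sum.neutral) auto
  then show ?thesis using False by simp
qed

text \<open>The theta series has coefficient 1 at 0 and 2 at each positive square. Hence the
  generating series of D times theta is theta, and D must be the series 1; the induction is division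
  by a series with constant term 1.\<close>

lemma theta_inverse_unique:
  fixes D :: "int \<Rightarrow> int"
  assumes D0: "D 0 = 1" and neg: "\<And>m. m < 0 \<Longrightarrow> D m = 0"
    and theta: "\<And>n. n > 0 \<Longrightarrow> (\<Sum>s\<in>{-int n..int n}. D (int n - s^2)) = (if \<exists>k. n = k^2 then 2 else 0)"
  shows "n > 0 \<Longrightarrow> D (int n) = 0"
proof (induction n rule: less_induct)
  case (less n)
  have "D (int n - (int r)^2) = (if r^2 = n then 1 else 0)" if r: "r \<in> {1..n}" for r
  proof (cases "r^2" n rule: linorder_cases)
    case less': less
    have "r^2 > 0" using r by simp
    then have "D (int (n - r^2)) = 0" using less' by (intro less.IH) auto
    moreover have "int (n - r^2) = int n - (int r)^2" using less' by (simp add: of_nat_diff)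
    ultimately show ?thesis using less' by simp
  next
    case equal
    then have e: "int n - (int r)^2 = 0" by (simp add: equal[symmetric])
    show ?thesis unfolding e using equal D0 by simp
  next
    case greater
    then have "int n < (int r)^2" by (metis of_nat_less_iff of_nat_power)
    then show ?thesis using greater neg by simp
  qed
  then have "(\<Sum>r=1..n. D (int n - (int r)^2)) = (\<Sum>r=1..n. if r^2 = n then 1 else 0)" by (intro sum.cong) auto
  moreover have "(\<Sum>s\<in>{-int n..int n}. D (int n - s^2)) = D (int n) + 2 * (\<Sum>r=1..n. D (int n - (int r)^2))"
    by (subst sum_symmetric_interval) simp_all
  ultimately show ?case using theta[OF less.prems] square_indicator_sum[OF less.prems] by (auto split: if_splits)
qed

text \<open>Since s^2 and s have the same parity, this twist turns the alternating theta convolution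
  of \<open>alpha_bar\<close> into a plain one, up to the sign -(-1)^n.\<close>

definition signed_alpha :: "int \<Rightarrow> int" where
  "signed_alpha m = (if even m then - alpha_bar m else alpha_bar m)"

lemma signed_alpha_theta_sum:
  assumes n: "n > 0"
  shows "real_of_int (\<Sum>s\<in>{-int n..int n}. signed_alpha (int n - s^2)) = cone_divisor_sum n"
proof -
  let ?R = "{r. r \<ge> 1 \<and> r^2 \<le> n}"
  have sub: "?R \<subseteq> {1..n}" by (auto intro: order_trans[OF power2_nat_le_imp_le])
  have pos: "signed_alpha (int n - (int r)^2) = - ((-1) ^ n) * ((-1) ^ r * alpha_bar (int (n - r^2)))" if "r^2 \<le> n" for r
  proof -
    have "int (n - r^2) = int n - (int r)^2" using that by (simp add: of_nat_diff)
    then show ?thesis by (auto simp: signed_alpha_def minus_one_power_iff)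
  qed
  have "signed_alpha (int n - (int r)^2) = 0" if "\<not> r^2 \<le> n" for r
  proof -
    have "int n < (int r)^2" using that by (metis not_le of_nat_less_iff of_nat_power)
    then show ?thesis by (simp add: signed_alpha_def alpha_bar_def)
  qed
  then have "(\<Sum>r=1..n. signed_alpha (int n - (int r)^2)) = (\<Sum>r\<in>?R. signed_alpha (int n - (int r)^2))"
    using sub by (intro sum.mono_neutral_right) auto
  also have "\<dots> = - ((-1) ^ n) * (\<Sum>r\<in>?R. (-1) ^ r * alpha_bar (int (n - r^2)))"
    unfolding sum_distrib_left by (rule sum.cong) (simp_all add: pos)
  finally have "(\<Sum>s\<in>{-int n..int n}. signed_alpha (int n - s^2)) =
      - ((-1) ^ n) * (alpha_bar (int n) + 2 * (\<Sum>r\<in>?R. (-1) ^ r * alpha_bar (int (n - r^2))))"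
    using pos[of 0] by (subst sum_symmetric_interval) (simp_all add: algebra_simps)
  also have "\<dots> = 8 * (-1) ^ n * (\<Sum>x | x dvd n \<and> x < n div x. (-1) ^ (n div x) * (int (n div x) - int x))"
    unfolding alpha_bar_theta_sum[OF n] by simp
  finally have "real_of_int (\<Sum>s\<in>{-int n..int n}. signed_alpha (int n - s^2)) =
     real_of_int (8 * (-1) ^ n * (\<Sum>x | x dvd n \<and> x < n div x. (-1) ^ (n div x) * (int (n div x) - int x)))"
    by (simp only: of_int_eq_iff)
  then show ?thesis unfolding alternating_divisor_sum[OF n, symmetric] by simp
qed

text \<open>The two convolutions differ only by 2 at squares, left by the symmetric and
  antisymmetric boundary terms. That is exactly the contribution of D 0 = 1, which comes from
  \<open>alpha_bar 0\<close> being 1.\<close>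

theorem signed_alpha_triple_weight:
  assumes n: "n > 0"
  shows "signed_alpha (int n) = 2 * triple_weight (int n)"
proof -
  define D where "D m = 2 * triple_weight m - signed_alpha m" for m
  have "D (int n) = 0"
  proof (rule theta_inverse_unique[OF _ _ _ n])
    show "D 0 = 1" by (simp add: D_def triple_weight_nonpos signed_alpha_def alpha_bar_def)
    show "D m = 0" if "m < 0" for m using that by (simp add: D_def triple_weight_nonpos signed_alpha_def alpha_bar_def)
    fix n :: nat assume n: "n > 0"
    have "real_of_int (\<Sum>s\<in>{-int n..int n}. D (int n - s^2)) =
        real_of_int (2 * (\<Sum>s\<in>{-int n..int n}. triple_weight (int n - s^2))) - real_of_int (\<Sum>s\<in>{-int n..int n}. signed_alpha (int n - s^2))"
      by (simp add: D_def sum_subtractf sum_distrib_left)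
    also have "\<dots> = real_of_int (if \<exists>k. n = k^2 then 2 else 0)"
      unfolding triple_weight_theta_sum[OF n] signed_alpha_theta_sum[OF n] by simp
    finally show "(\<Sum>s\<in>{-int n..int n}. D (int n - s^2)) = (if \<exists>k. n = k^2 then 2 else 0)" by (simp only: of_int_eq_iff)
  qed
  then show ?thesis by (simp add: D_def)
qed

lemma abs_alpha_bar: "\<bar>alpha_bar m\<bar> = 2 * triple_weight m + (if m = 0 then 1 else 0)"
proof (cases "m > 0")
  case True
  then have "\<bar>signed_alpha m\<bar> = 2 * triple_weight m"
    using signed_alpha_triple_weight[of "nat m"] triple_weight_nonneg[of m] by simp
  then show ?thesis using True by (simp add: signed_alpha_def split: if_splits)
next
  case False
  then show ?thesis by (simp add: alpha_bar_def triple_weight_nonpos)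
qed

text \<open>At a square the 4 is 2 + 2: one 2 from the cone count, the other from the two r with r^2
  = n, where the summand is \<open>alpha_bar 0\<close>.\<close>

lemma abs_alpha_bar_theta_sum:
  assumes n: "n > 0"
  shows "(\<Sum>\<^sub>\<infinity>r::int. real_of_int \<bar>alpha_bar (int n - r^2)\<bar>) = cone_divisor_sum n + (if \<exists>k. n = k^2 then 4 else 0)"
proof -
  let ?I = "{-int n..int n}"
  have "alpha_bar (int n - s^2) = 0" if "s \<notin> ?I" for s
  proof -
    have "\<not> \<bar>s\<bar> \<le> int n" using that by auto
    then have "\<not> s^2 \<le> int n" using abs_le_of_square by blast
    then show ?thesis by (simp add: alpha_bar_def)
  qed
  then have "(\<Sum>\<^sub>\<infinity>r::int. real_of_int \<bar>alpha_bar (int n - r^2)\<bar>) = (\<Sum>\<^sub>\<infinity>s\<in>?I. real_of_int \<bar>alpha_bar (int n - s^2)\<bar>)"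
    by (intro infsum_cong_neutral) auto
  also have "\<dots> = real_of_int (\<Sum>s\<in>?I. \<bar>alpha_bar (int n - s^2)\<bar>)" by simp
  also have "(\<Sum>s\<in>?I. \<bar>alpha_bar (int n - s^2)\<bar>) =
      2 * (\<Sum>s\<in>?I. triple_weight (int n - s^2)) + (\<Sum>s\<in>?I. if int n - s^2 = 0 then 1 else 0)"
    unfolding abs_alpha_bar sum.distrib sum_distrib_left ..
  also have "(\<Sum>s\<in>?I. if int n - s^2 = 0 then 1 else 0) = (if \<exists>k. n = k^2 then 2 else (0::int))"
  proof -
    have "int n - (int r)^2 = 0 \<longleftrightarrow> r^2 = n" for r by (metis eq_iff_diff_eq_0 of_nat_eq_iff of_nat_power)
    then have "(\<Sum>r=1..n. if int n - (int r)^2 = 0 then 1 else (0::int)) = (if \<exists>k. n = k^2 then 1 else 0)"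
      using square_indicator_sum[OF n] by simp
    then show ?thesis using n by (subst sum_symmetric_interval) simp_all
  qed
  finally show ?thesis using triple_weight_theta_sum[OF n] by simp
qed

section \<open>Evaluation for odd and for even n\<close>

abbreviation hurwitz_divisor_sum :: "nat \<Rightarrow> real" where
  "hurwitz_divisor_sum n \<equiv> divisor_sum n (\<lambda>x y. 2 * real x + 2 * (if odd (x + y) then real x else 0) - 6 * (if x \<le> y \<and> odd (x + y) then real x else 0))"

lemma hurwitz_class_number_divisor_sum:
  assumes n: "n > 0"
  shows "3 * (\<Sum>\<^sub>\<infinity>r\<in>{r::int. odd r}. hurwitz_class_number (4 * int n - r^2)) =
    hurwitz_divisor_sum n"
proof -
  let ?c = "\<lambda>Q. divisor_sum n (\<lambda>x y. if Q x y then real x else 0)"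
  have s: "real (sigma1 n) = divisor_sum n (\<lambda>x y. real x)" by (simp add: sigma1_def divisor_sum_def)
  have "real (card (Dset n (\<lambda>(a, b, c, d). odd (b - c)))) =
      2 * real (sigma1 n) + 2 * real (co_sum n (\<lambda>x y. odd (x + y))) - 6 * real (co_sum n (\<lambda>x y. x \<le> y \<and> odd (x + y)))"
    using arg_cong[OF sector_count_odd[OF n], of real_of_int] by simp
  also have "\<dots> = 2 * divisor_sum n (\<lambda>x y. real x) + 2 * ?c (\<lambda>x y. odd (x + y)) + (- 6) * ?c (\<lambda>x y. x \<le> y \<and> odd (x + y))"
    unfolding s co_sum_divisor_sum[OF n, symmetric] by simp
  also have "\<dots> = hurwitz_divisor_sum n"
    unfolding divisor_sum_mult divisor_sum_add by (simp only: minus_mult_left diff_conv_add_uminus)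
  finally show ?thesis unfolding hurwitz_class_number_theta_sum[OF n] .
qed

lemma cone_divisor_sum_odd:
  assumes n: "n > 0" "odd n"
  shows "cone_divisor_sum n = - 16 * lambda1 n + 16 * real (sigma1 n)
     - 12 * (\<Sum>\<^sub>\<infinity>r\<in>{r::int. odd r}. hurwitz_class_number (4 * int n - r^2))"
proof -
  have s: "real (sigma1 n) = divisor_sum n (\<lambda>x y. real x)" by (simp add: sigma1_def divisor_sum_def)
  have "cone_divisor_sum n = (- 8) * divisor_sum n (\<lambda>x y. real (min x y)) + 16 * divisor_sum n (\<lambda>x y. real x)
    + (- 4) * hurwitz_divisor_sum n"
    unfolding cone_divisor_sum_def divisor_sum_mult divisor_sum_add
  proof (rule divisor_sum_eqI[OF n(1)], goal_cases)
    case (1 x y)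
    then have "odd x" "odd y" using n(2) by auto
    then show ?case by (cases x y rule: linorder_cases) simp_all
  qed
  then show ?thesis unfolding hurwitz_class_number_divisor_sum[OF n(1), symmetric] lambda1_divisor_sum s by simp
qed

lemma cone_divisor_sum_even:
  assumes n: "n > 0" "even n"
  shows "cone_divisor_sum n = - 8 * lambda1 n - 16 * (if 4 dvd n then lambda1 (n div 4) else 0) + 24 * real (sigma1 (n div 2))
     - 4 * (\<Sum>\<^sub>\<infinity>r\<in>{r::int. odd r}. hurwitz_class_number (4 * int n - r^2))"
proof -
  let ?K = "\<lambda>x y. (if even x then real x else 0) - 2 * (if even y then real x else 0)"
  \<comment> \<open>The last sum is 0; its coefficient 28/3 is forced by the factorisations with
    exactly one even factor. The coefficient -4/3 appears because \<open>hurwitz_divisor_sum\<close>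
    is three times the class number sum.\<close>
  have "cone_divisor_sum n = (- 4) * divisor_sum n (\<lambda>x y. real (min x y))
    + (- 4) * divisor_sum n (\<lambda>x y. if even x \<and> even y then real (min x y) else 0)
    + 24 * divisor_sum n (\<lambda>x y. if even y then real x else 0)
    + (- 4 / 3) * hurwitz_divisor_sum n
    + (28 / 3) * divisor_sum n ?K"
    unfolding cone_divisor_sum_def divisor_sum_mult divisor_sum_add
  proof (rule divisor_sum_eqI[OF n(1)], goal_cases)
    case (1 x y)
    then have "even x \<or> even y" using n(2) by auto
    then show ?case by (cases "even x"; cases "even y"; cases x y rule: linorder_cases) simp_all
  qed
  then show ?thesis unfolding lambda1_quarter[OF n(1)] unfolding even_divisor_balance[OF n(1)] sigma1_half[OF n] hurwitz_class_number_divisor_sum[OF n(1), symmetric] lambda1_divisor_sum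
    by simp
qed

theorem proposition21:
  fixes n :: nat
  assumes "n > 0"
  shows
    "(odd n \<longrightarrow>
        (\<Sum>\<^sub>\<infinity>r::int. real_of_int \<bar>alpha_bar (int n - r^2)\<bar>)
        = - 16 * lambda1 n + 16 * real (sigma1 n)
          - 12 * (\<Sum>\<^sub>\<infinity>r\<in>{r::int. odd r}. hurwitz_class_number (4 * int n - r^2))
          + (if is_square n then 4 else 0))
     \<and> (even n \<longrightarrow>
        (\<Sum>\<^sub>\<infinity>r::int. real_of_int \<bar>alpha_bar (int n - r^2)\<bar>)
        = - 8 * lambda1 n - 16 * (if 4 dvd n then lambda1 (n div 4) else 0)
          + 24 * real (sigma1 (n div 2))
          - 4 * (\<Sum>\<^sub>\<infinity>r\<in>{r::int. odd r}. hurwitz_class_number (4 * int n - r^2))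
          + (if is_square n then 4 else 0))"
  unfolding abs_alpha_bar_theta_sum[OF assms] is_nth_power_def
  using cone_divisor_sum_odd[OF assms] cone_divisor_sum_even[OF assms] by simp

end
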